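(* Let $f\in C^2(\mathbb{R})$ with $f''>0$ on $\mathbb{R}$, and let $\overline{u}_l>\overline{u}_r$ be real constants. Let $w_{0l},w_{0r}\in L^\infty(\mathbb{R})$ be arbitrary periodic functions with periods $p_l>0$ and $p_r>0$ respectively, satisfying $$\frac{1}{p_l}\int_0^{p_l}w_{0l}(x)\,dx=\frac{1}{p_r}\int_0^{p_r}w_{0r}(x)\,dx=0.$$ Let $N>0$ and let $u_0\in L^\infty(\mathbb{R})$ satisfy $u_0(x)=\overline{u}_l+w_{0l}(x)$ for $x<-N$ and $u_0(x)=\overline{u}_r+w_{0r}(x)$ for $x>N$. Let $u$, $u_l$, $u_r$ be the entropy solutions of $\partial_t u+\partial_x f(u)=0$ on $\mathbb{R}\times(0,\infty)$ with initial data $u_0$, $\overline{u}_l+w_{0l}$, $\overline{u}_r+w_{0r}$ respectively. Set $s=\frac{f(\overline{u}_l)-f(\overline{u}_r)}{\overline{u}_l-\overline{u}_r}$ and $$X_\infty:=\frac{1}{\overline{u}_l-\overline{u}_r}\Big[\int_{-\infty}^0\big(u_0(y)-\overline{u}_l-w_{0l}(y)\big)dy+\int_0^{+\infty}\big(u_0(y)-\overline{u}_r-w_{0r}(y)\big)dy-\min_{x\in\mathbb{R}}\int_0^x w_{0l}(y)\,dy+\min_{x\in\mathbb{R}}\int_0^x w_{0r}(y)\,dy\Big].$$ Then there exist a finite time $T_S>0$ and a unique Lipschitz continuous curve $X\in\mathrm{Lip}(T_S,+\infty)$ such that for all $t>T_S$, $$u(x,t)=\begin{cases}u_l(x,t)&\text{if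 }x<X(t),\\ u_r(x,t)&\text{if }x>X(t).\end{cases}$$ Moreover, there exists a constant $C>0$, independent of $t$, such that for all $t>T_S$, $$\sup_{x<X(t)}|u(x,t)-\overline{u}_l|+\sup_{x>X(t)}|u(x,t)-\overline{u}_r|+|X(t)-st-X_\infty|\le\frac{C}{t}.$$
   Context: For initial data $u_0\in L^\infty(\mathbb{R})$, the entropy solution of $\partial_t u+\partial_x f(u)=0$, $u(\cdot,0)=u_0$, is the unique bounded weak (distributional) solution satisfying, for some constant $E>0$ depending only on $f$ and $u_0$, $u(x+a,t)-u(x,t)\le \frac{Ea}{t}$ for a.e. $x\in\mathbb{R}$ and all $t>0$, $a>0$. For each $t>0$, $u(\cdot,t)$ has one-sided limits at every point; pointwise equalities, inequalities and suprema in $x$ are understood for a.e. $x$ (equivalently, for one-sided limits). *)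

theory Defs
  imports "HOL-Analysis.Analysis" "HOL-Probability.Essential_Supremum"
begin

text \<open>Membership in \<open>L\<^sup>\<infinity>(S)\<close>.  Functions are not identified up to null sets, so all
  pointwise statements about such functions are made almost everywhere.\<close>

definition Linfty_on :: "'a::euclidean_space set \<Rightarrow> ('a \<Rightarrow> real) \<Rightarrow> bool" where
  "Linfty_on S g \<longleftrightarrow>
     g \<in> borel_measurable (lebesgue_on S) \<and> (\<exists>M. AE x in lebesgue_on S. \<bar>g x\<bar> \<le> M)"

text \<open>\<open>\<phi> \<in> C\<^sub>c\<^sup>\<infinity>(\<real>\<^sup>2)\<close>; here \<open>D i j\<close> is the mixed partial derivative of order \<open>i\<close> in the first
  variable (space) and \<open>j\<close> in the second (time).  The support may meet the line \<open>t = 0\<close>.\<close>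

definition test_function :: "(real \<Rightarrow> real \<Rightarrow> real) \<Rightarrow> bool" where
  "test_function \<phi> \<longleftrightarrow>
     bounded {(x, t). \<phi> x t \<noteq> 0} \<and>
     (\<exists>D :: nat \<Rightarrow> nat \<Rightarrow> real \<Rightarrow> real \<Rightarrow> real.
        D 0 0 = \<phi> \<and>
        (\<forall>i j. continuous_on UNIV (\<lambda>(x, t). D i j x t)) \<and>
        (\<forall>i j x t. ((\<lambda>y. D i j y t) has_real_derivative D (Suc i) j x t) (at x)) \<and>
        (\<forall>i j x t. ((\<lambda>\<tau>. D i j x \<tau>) has_real_derivative D i (Suc j) x t) (at t)))"

text \<open>Distributional solutions of \<open>\<partial>\<^sub>t u + \<partial>\<^sub>x f(u) = 0\<close> with \<open>u(\<cdot>, 0) = u\<^sub>0\<close>; \<open>u x t\<close> matters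
  only for \<open>t > 0\<close>, and the initial value is attained in the weak sense.\<close>

definition weak_solution ::
    "(real \<Rightarrow> real) \<Rightarrow> (real \<Rightarrow> real) \<Rightarrow> (real \<Rightarrow> real \<Rightarrow> real) \<Rightarrow> bool" where
  "weak_solution f u0 u \<longleftrightarrow>
     (\<forall>\<phi>. test_function \<phi> \<longrightarrow>
        (\<integral>(x, t). u x t * deriv (\<lambda>\<tau>. \<phi> x \<tau>) t + f (u x t) * deriv (\<lambda>y. \<phi> y t) x
            \<partial>lebesgue_on (UNIV \<times> {0<..}))
        + (\<integral>x. u0 x * \<phi> x 0 \<partial>lebesgue) = 0)"

text \<open>A bounded weak solution is determined only up to null sets of the half-plane, whereas the
  one-sided estimate and the slices \<open>u(\<cdot>, t)\<close> are considered at every \<open>t > 0\<close>.  As usual, the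
  slices are those of the representative that is continuous in time with values in
  \<open>L\<^sup>1\<^sub>l\<^sub>o\<^sub>c(\<real>)\<close>; this determines \<open>u(\<cdot>, t)\<close> a.e. in \<open>x\<close> for every \<open>t > 0\<close>.\<close>

definition L1loc_time_continuous :: "(real \<Rightarrow> real \<Rightarrow> real) \<Rightarrow> bool" where
  "L1loc_time_continuous u \<longleftrightarrow>
     (\<forall>t>0. \<forall>R>0. ((\<lambda>\<tau>. \<integral>x. \<bar>u x \<tau> - u x t\<bar> \<partial>lebesgue_on {-R..R}) \<longlongrightarrow> 0) (at t))"

definition entropy_solution ::
    "(real \<Rightarrow> real) \<Rightarrow> (real \<Rightarrow> real) \<Rightarrow> (real \<Rightarrow> real \<Rightarrow> real) \<Rightarrow> bool" where
  "entropy_solution f u0 u \<longleftrightarrow>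
     Linfty_on (UNIV \<times> {0<..}) (\<lambda>(x, t). u x t) \<and>
     (\<forall>t>0. Linfty_on UNIV (\<lambda>x. u x t)) \<and>
     L1loc_time_continuous u \<and>
     weak_solution f u0 u \<and>
     (\<exists>E>0. \<forall>t>0. \<forall>a>0. AE x in lebesgue. u (x + a) t - u x t \<le> E * a / t)"

definition periodic_ae :: "real \<Rightarrow> (real \<Rightarrow> real) \<Rightarrow> bool" where
  "periodic_ae p w \<longleftrightarrow> (AE x in lebesgue. w (x + p) = w x)"

text \<open>The limiting shift.  The primitives of \<open>w0l\<close> and \<open>w0r\<close> are oriented integrals; for periodic
  functions of mean zero they are continuous and periodic, so both infima are minima.\<close>

definition shock_shift ::
    "real \<Rightarrow> real \<Rightarrow> (real \<Rightarrow> real) \<Rightarrow> (real \<Rightarrow> real) \<Rightarrow> (real \<Rightarrow> real) \<Rightarrow> real" where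
  "shock_shift ul ur w0l w0r u0 =
     1 / (ul - ur) *
     ((LINT y=(-\<infinity>)..0|lebesgue. (u0 y - ul - w0l y))
      + (LINT y=0..\<infinity>|lebesgue. (u0 y - ur - w0r y))
      - (INF x::real. LINT y=0..ereal x|lebesgue. w0l y)
      + (INF x::real. LINT y=0..ereal x|lebesgue. w0r y))"

text \<open>\<open>X\<close> is Lipschitz on \<open>(T, \<infinity>)\<close> and separates \<open>v\<close> (to the left) from \<open>w\<close> (to the right) in
  \<open>u\<close> after time \<open>T\<close>.\<close>

definition glues_along ::
    "real \<Rightarrow> (real \<Rightarrow> real) \<Rightarrow> (real \<Rightarrow> real \<Rightarrow> real) \<Rightarrow> (real \<Rightarrow> real \<Rightarrow> real)
      \<Rightarrow> (real \<Rightarrow> real \<Rightarrow> real) \<Rightarrow> bool" where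
  "glues_along T X u v w \<longleftrightarrow>
     (\<exists>L. L-lipschitz_on {T<..} X) \<and>
     (\<forall>t>T. AE x in lebesgue. (x < X t \<longrightarrow> u x t = v x t) \<and> (x > X t \<longrightarrow> u x t = w x t))"

end

theory Submission
  imports Defs
begin

text \<open>The potential \<open>U\<close> with \<open>U\<^sub>x = u\<close> and \<open>U\<^sub>t = - f(u)\<close> is the largest subsolution of the
  Hamilton--Jacobi equation with its initial data: it is a subsolution by convexity of \<open>f\<close>, and the one-sided
  estimate yields \<open>V \<le> U\<close> for every subsolution \<open>V\<close> with \<open>V \<le> U\<close> at \<open>t = 0\<close>, by an \<open>L\<^sup>1\<close> estimate of
  the positive part of \<open>V - U\<close> along small backward steps with the speed \<open>f'\<close> of a spatial average of \<open>u\<close>.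

  Let \<open>P\<close> and \<open>Q\<close> be the potentials of the two periodic solutions, so that \<open>U = P + A\<close> far to the left and
  \<open>U = Q + B\<close> far to the right at \<open>t = 0\<close>, and let \<open>Z\<close> be a plane whose slope is the mean of the two constant
  states and which lies below the data. Minima of subsolutions are subsolutions, so comparison gives
  \<open>min (P + A) (Q + B) Z \<le> U\<close> and \<open>min U Z \<le> P + A\<close>, \<open>min U Z \<le> Q + B\<close>. By strict convexity \<open>Z\<close> exceeds
  \<open>min (P + A) (Q + B)\<close> after a finite time, from which on \<open>U = min (P + A) (Q + B)\<close>; the shock is the
  zero set of \<open>P + A - Q - B\<close>. Periodicity and the one-sided estimate give \<open>u\<^sub>l = ubar\<^sub>l + O(1/t)\<close>, and the
  comparison with planes together with the Hopf--Lax bound gives \<open>P = ubar\<^sub>l x - f(ubar\<^sub>l) t + min + O(1/t)\<close>,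
  which locates the shock.\<close>

section \<open>Calculus on the line\<close>

text \<open>The comparison has to be an integral estimate. Near a jump of \<open>u\<close> the
  defect of one backward step is of the size of the jump times the step, so it does not become small
  in the supremum norm. Integrated in \<open>x\<close> it does: it is dominated by a difference of
  two translates of a bounded average, whose integral telescopes to \<open>O(l)\<close>, where
  \<open>l\<close> is the averaging length. The transport speed must be differentiable for a change
  of variables, hence \<open>u\<close> is averaged twice; the one-sided estimate bounds the
  derivative of that speed from above, which is exactly a lower bound for the Jacobian of the
  backward step. A time step \<open>h\<close> costs \<open>l\<close>, \<open>h / l\<close> and
  \<open>h\<close> per unit time, so \<open>l = sqrt h\<close>. As \<open>E / t\<close> is singular
  at \<open>0\<close>, the argument starts at a positive time \<delta> with an initial error
  \<open>O(\<delta>)\<close>. The plane is needed because nothing is known about the data in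
  \<open>|x| \<le> N\<close>: its slope lies strictly between the two states, so where a periodic
  state does not prescribe the data a low enough plane stays below that state, and the gap in
  Jensen's inequality at the midpoint later makes it irrelevant.\<close>

definition bdd_meas :: "real \<Rightarrow> (real \<Rightarrow> real) \<Rightarrow> bool" where
  "bdd_meas M v \<longleftrightarrow> v \<in> borel_measurable lebesgue \<and> (\<forall>x. \<bar>v x\<bar> \<le> M)"

lemma bdd_meas_nonneg: "bdd_meas M v \<Longrightarrow> 0 \<le> M"
  unfolding bdd_meas_def by (meson abs_ge_zero order_trans)

lemma bdd_meas_mult_integrable:
  assumes v: "bdd_meas M v" and "continuous_on {a..b} g"
  shows "(\<lambda>x. v x * g x) integrable_on {a..b}"
proof (rule measurable_bounded_by_integrable_imp_integrable)
  have "v \<in> borel_measurable (lebesgue_on {a..b})"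
    using v unfolding bdd_meas_def by (auto intro: measurable_restrict_space1)
  moreover have "g \<in> borel_measurable (lebesgue_on {a..b})"
    using assms by (intro continuous_imp_measurable_on_sets_lebesgue) auto
  ultimately show "(\<lambda>x. v x * g x) \<in> borel_measurable (lebesgue_on {a..b})"
    by measurable
  show "(\<lambda>x. M * \<bar>g x\<bar>) integrable_on {a..b}"
    by (intro integrable_continuous_real continuous_intros assms)
  show "norm (v x * g x) \<le> M * \<bar>g x\<bar>" for x
    using v unfolding bdd_meas_def by (auto simp: abs_mult intro: mult_right_mono)
qed auto

lemma bdd_meas_integrable: "bdd_meas M v \<Longrightarrow> v integrable_on {a..b}"
  using bdd_meas_mult_integrable[of M v a b "\<lambda>_. 1"] by simp

lemma bdd_meas_compose:
  assumes "bdd_meas M v" "continuous_on UNIV f" "\<And>y. \<bar>y\<bar> \<le> M \<Longrightarrow> \<bar>f y\<bar> \<le> K"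
  shows "bdd_meas K (\<lambda>x. f (v x))"
  using assms unfolding bdd_meas_def
  by (auto intro: measurable_compose[OF _ borel_measurable_continuous_onI])

lemma bdd_meas_abs_diff:
  assumes v: "bdd_meas K v" and w: "bdd_meas L w"
  shows "bdd_meas (K + L) (\<lambda>x. \<bar>v x - w x\<bar>)"
  unfolding bdd_meas_def
proof (intro conjI allI)
  show "(\<lambda>x. \<bar>v x - w x\<bar>) \<in> borel_measurable lebesgue"
    using v w unfolding bdd_meas_def by (intro borel_measurable_abs borel_measurable_diff) auto
  have "\<bar>v x\<bar> \<le> K" "\<bar>w x\<bar> \<le> L" for x using v w unfolding bdd_meas_def by auto
  then show "\<bar>\<bar>v x - w x\<bar>\<bar> \<le> K + L" for x
    using abs_triangle_ineq4[of "v x" "w x"] add_mono[of "\<bar>v x\<bar>" K "\<bar>w x\<bar>" L] by simp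
qed

text \<open>Cut the interval into \<open>n + 1\<close> equal pieces: the linear terms add up, while
  the quadratic errors sum to \<open>C h^2 / (n + 1)\<close> and disappear. This replaces
  differentiation for functions whose increments are known only up to second order.\<close>

lemma increment_le_linear:
  fixes \<phi> :: "real \<Rightarrow> real"
  assumes "a \<le> b"
    and inc: "\<And>x y. a \<le> x \<Longrightarrow> x \<le> y \<Longrightarrow> y \<le> b \<Longrightarrow> \<phi> y - \<phi> x \<le> c * (y - x) + C * (y - x)\<^sup>2"
  shows "\<phi> b - \<phi> a \<le> c * (b - a)"
proof -
  define h where "h = b - a"
  have h: "0 \<le> h" using assms by (simp add: h_def)
  have est: "\<phi> b - \<phi> a \<le> c * h + C * h\<^sup>2 * inverse (real (Suc n))" for n
  proof -
    let ?N = "real (Suc n)"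
    let ?x = "\<lambda>k. a + real k * h / ?N"
    have "\<phi> b - \<phi> a = (\<Sum>k<Suc n. \<phi> (?x (Suc k)) - \<phi> (?x k))"
      by (subst sum_lessThan_telescope) (simp_all add: h_def)
    also have "\<dots> \<le> (\<Sum>k<Suc n. c * (h / ?N) + C * (h / ?N)\<^sup>2)"
    proof (rule sum_mono)
      fix k assume k: "k \<in> {..<Suc n}"
      have d: "?x (Suc k) - ?x k = h / ?N" by (simp add: add_divide_distrib distrib_right del: of_nat_Suc) (simp add: add_divide_distrib distrib_right)
      have "real (Suc k) * h \<le> ?N * h" using k h by (intro mult_right_mono) auto
      then have "real (Suc k) * h / ?N \<le> h" by (simp add: divide_le_eq mult.commute)
      then have "?x (Suc k) \<le> b" by (simp add: h_def)
      moreover have "a \<le> ?x k" using h by simp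
      moreover have "?x k \<le> ?x (Suc k)" using h d by (smt (verit) divide_nonneg_nonneg of_nat_0_le_iff)
      ultimately show "\<phi> (?x (Suc k)) - \<phi> (?x k) \<le> c * (h / ?N) + C * (h / ?N)\<^sup>2"
        using inc[of "?x k" "?x (Suc k)"] unfolding d by blast
    qed
    also have "\<dots> = c * h + C * h\<^sup>2 * inverse ?N"
      by (simp add: field_simps power2_eq_square del: of_nat_Suc)
    finally show ?thesis .
  qed
  have "(\<lambda>n. c * h + C * h\<^sup>2 * inverse (real (Suc n))) \<longlonglongrightarrow> c * h + C * h\<^sup>2 * 0"
    by (intro tendsto_intros LIMSEQ_inverse_real_of_nat)
  then have "\<phi> b - \<phi> a \<le> c * h + C * h\<^sup>2 * 0"
    by (rule LIMSEQ_le_const) (use est in blast)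
  then show ?thesis by (simp add: h_def)
qed

lemma increment_eq_0:
  fixes \<phi> :: "real \<Rightarrow> real"
  assumes "a \<le> b"
    and inc: "\<And>x y. a \<le> x \<Longrightarrow> x \<le> y \<Longrightarrow> y \<le> b \<Longrightarrow> \<bar>\<phi> y - \<phi> x\<bar> \<le> C * (y - x)\<^sup>2"
  shows "\<phi> b = \<phi> a"
proof -
  have "\<phi> b - \<phi> a \<le> 0 * (b - a)"
    by (rule increment_le_linear[where C = C]) (use assms in \<open>auto dest!: inc\<close>)
  moreover have "- \<phi> b - - \<phi> a \<le> 0 * (b - a)"
    by (rule increment_le_linear[where C = C]) (use assms in \<open>auto dest!: inc\<close>)
  ultimately show ?thesis by simp
qed

text \<open>The oriented integral from \<open>0\<close> to \<open>x\<close>: at least one of the two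
  intervals is empty or a point.\<close>

definition prim :: "(real \<Rightarrow> real) \<Rightarrow> real \<Rightarrow> real" where
  "prim v x = integral {0..x} v - integral {x..0} v"

lemma prim_0 [simp]: "prim v 0 = 0"
  by (simp add: prim_def)

lemma prim_diff:
  assumes "\<And>a b. v integrable_on {a..b}" "x \<le> y"
  shows "prim v y - prim v x = integral {x..y} v"
proof -
  have c: "integral {a..b} v + integral {b..c} v = integral {a..c} v" if "a \<le> b" "b \<le> c" for a b c
    using that assms(1) by (intro Henstock_Kurzweil_Integration.integral_combine) auto
  have e: "integral {a..b} v = 0" if "b \<le> a" for a b
    using that by (cases "a = b") auto
  consider "0 \<le> x" | "x \<le> 0" "0 \<le> y" | "y \<le> 0" by linarith
  then show ?thesis
  proof cases
    case 1 then show ?thesis using c[of 0 x y] assms(2) e[of 0 x] e[of 0 y] by (simp add: prim_def)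
  next
    case 2 then show ?thesis using c[of x 0 y] e[of x 0] e[of 0 y] by (simp add: prim_def)
  next
    case 3 then show ?thesis using c[of x y 0] assms(2) e[of x 0] e[of y 0] by (simp add: prim_def)
  qed
qed

lemma prim_DERIV:
  assumes c: "continuous_on UNIV v"
  shows "(prim v has_real_derivative v x) (at x)"
proof -
  have i: "v integrable_on {a..b}" for a b
    using c by (intro integrable_continuous_real) (auto intro: continuous_on_subset)
  have "((\<lambda>y. integral {x-1..y} v) has_real_derivative v x) (at x within {x-1..x+1})"
    using c by (intro integral_has_real_derivative) (auto intro: continuous_on_subset)
  then have "((\<lambda>y. prim v (x-1) + integral {x-1..y} v) has_real_derivative v x) (at x within {x-1..x+1})"
    by (auto intro!: derivative_eq_intros)
  then have "(prim v has_real_derivative v x) (at x within {x-1..x+1})"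
    by (rule has_field_derivative_transform_within[where d = 1])
       (use prim_diff[OF i, of "x-1"] in force)+
  then show ?thesis
    by (simp add: at_within_Icc_at)
qed

lemma integral_bound_linear:
  fixes v :: "real \<Rightarrow> real"
  assumes "v integrable_on {x..y}" "x \<le> y" "\<And>z. z \<in> {x..y} \<Longrightarrow> \<bar>v z\<bar> \<le> B"
  shows "\<bar>integral {x..y} v\<bar> \<le> B * (y - x)"
proof -
  have "norm (integral {x..y} v) \<le> integral {x..y} (\<lambda>_. B)"
    by (rule integral_norm_bound_integral) (use assms in auto)
  then show ?thesis using assms(2) by (simp add: mult.commute)
qed

lemma continuous_on_Icc_bound:
  fixes g :: "real \<Rightarrow> real"
  assumes "continuous_on {a..b} g"
  obtains G where "\<And>x. x \<in> {a..b} \<Longrightarrow> \<bar>g x\<bar> \<le> G"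
proof -
  have "compact (g ` {a..b})" by (intro compact_continuous_image assms) auto
  then show ?thesis using that compact_imp_bounded bounded_iff by (metis imageI real_norm_def)
qed

text \<open>As \<open>v\<close> is only measurable, \<open>V\<close> need not be differentiable at
  every point. Instead the defect \<open>P\<close> of the formula on \<open>{a..x}\<close> has
  increments of second order, since \<open>g\<close> and \<open>V\<close> each vary by at most a
  constant times \<open>y - x\<close> on \<open>{x..y}\<close>; hence \<open>P\<close> is
  constant.\<close>

lemma integration_by_parts_ae:
  fixes v V g g' :: "real \<Rightarrow> real"
  assumes v: "bdd_meas M v" and "a \<le> b"
    and V: "\<And>x y. x \<le> y \<Longrightarrow> V y - V x = integral {x..y} v"
    and g: "\<And>x. (g has_real_derivative g' x) (at x)" and g': "continuous_on UNIV g'"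
  shows "integral {a..b} (\<lambda>x. v x * g x) = V b * g b - V a * g a - integral {a..b} (\<lambda>x. V x * g' x)"
proof -
  have M: "0 \<le> M" using bdd_meas_nonneg v by blast
  have cg: "continuous_on S g" for S
    using g by (intro continuous_at_imp_continuous_on) (auto intro: DERIV_isCont)
  have cg': "continuous_on S g'" for S using g' continuous_on_subset by blast
  have VL: "\<bar>V y - V x\<bar> \<le> M * \<bar>y - x\<bar>" for x y
  proof -
    have "\<bar>V y - V x\<bar> \<le> M * (y - x)" if "x \<le> y" for x y
      unfolding V[OF that] using v that
      by (intro integral_bound_linear bdd_meas_integrable[OF v]) (auto simp: bdd_meas_def)
    from this[of x y] this[of y x] show ?thesis by (cases "x \<le> y") (auto simp: abs_minus_commute)
  qed
  have cV: "continuous_on S V" for S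
    by (rule lipschitz_on_continuous_on[where L = M], rule lipschitz_onI)
       (use VL M in \<open>auto simp: dist_real_def\<close>)
  have ivg: "(\<lambda>x. v x * g x) integrable_on {x..y}" for x y
    by (rule bdd_meas_mult_integrable[OF v cg])
  have iVg: "(\<lambda>x. V x * g' x) integrable_on {x..y}" for x y
    by (intro integrable_continuous_real continuous_intros cV cg')
  obtain K where K: "\<And>x. x \<in> {a..b} \<Longrightarrow> \<bar>g' x\<bar> \<le> K"
    by (rule continuous_on_Icc_bound[OF cg']) blast
  have K0: "0 \<le> K" using K[of a] \<open>a \<le> b\<close> by force
  define P where "P x = V x * g x - integral {a..x} (\<lambda>x. v x * g x) - integral {a..x} (\<lambda>x. V x * g' x)" for x
  have "P b = P a"
  proof (rule increment_eq_0[OF \<open>a \<le> b\<close>, where C = "2 * M * K"])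
    fix x y assume xy: "a \<le> x" "x \<le> y" "y \<le> b"
    have c1: "integral {a..y} (\<lambda>x. v x * g x) - integral {a..x} (\<lambda>x. v x * g x) = integral {x..y} (\<lambda>x. v x * g x)"
      using Henstock_Kurzweil_Integration.integral_combine[of a x y "\<lambda>x. v x * g x"] ivg xy by simp
    have c2: "integral {a..y} (\<lambda>x. V x * g' x) - integral {a..x} (\<lambda>x. V x * g' x) = integral {x..y} (\<lambda>x. V x * g' x)"
      using Henstock_Kurzweil_Integration.integral_combine[of a x y "\<lambda>x. V x * g' x"] iVg xy by simp
    have FT: "(g' has_integral (g y - g x)) {x..y}"
      by (rule fundamental_theorem_of_calculus[OF xy(2)])
         (use g in \<open>auto simp: has_real_derivative_iff_has_vector_derivative[symmetric] intro: has_field_derivative_at_within\<close>)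
    have i1: "(\<lambda>z. v z * (g y - g z) + (V x - V z) * g' z) integrable_on {x..y}"
      by (intro integrable_add bdd_meas_mult_integrable[OF v] integrable_continuous_real continuous_intros cV cg' cg)
    \<comment> \<open>The boundary increment is split as
      \<open>(V y - V x) g y + V x (g y - g x)\<close>, so that subtracting the two integrals leaves
      only products with one small factor.\<close>
    have "((\<lambda>z. v z * g y + V x * g' z - v z * g z - V z * g' z) has_integral
        (V y - V x) * g y + V x * (g y - g x) - integral {x..y} (\<lambda>x. v x * g x) - integral {x..y} (\<lambda>x. V x * g' x)) {x..y}"
      unfolding V[OF xy(2)]
      by (intro has_integral_diff has_integral_add has_integral_mult_left has_integral_mult_right
          integrable_integral ivg iVg FT bdd_meas_integrable[OF v])
    then have "integral {x..y} (\<lambda>z. v z * g y + V x * g' z - v z * g z - V z * g' z) = P y - P x"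
      using c1 c2 by (subst integral_unique) (auto simp: P_def algebra_simps)
    also have "(\<lambda>z. v z * g y + V x * g' z - v z * g z - V z * g' z) = (\<lambda>z. v z * (g y - g z) + (V x - V z) * g' z)"
      by (auto simp: algebra_simps)
    finally have eq: "P y - P x = integral {x..y} (\<lambda>z. v z * (g y - g z) + (V x - V z) * g' z)" by simp
    have "\<bar>P y - P x\<bar> \<le> (2 * M * K * (y - x)) * (y - x)"
      unfolding eq
    proof (rule integral_bound_linear[OF i1 xy(2)])
      fix z assume z: "z \<in> {x..y}"
      have "\<bar>g y - g z\<bar> \<le> K * (y - z)"
      proof -
        have "(g' has_integral (g y - g z)) {z..y}"
          by (rule fundamental_theorem_of_calculus)
            (use g z in \<open>auto simp: has_real_derivative_iff_has_vector_derivative[symmetric] intro: has_field_derivative_at_within\<close>)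
        then have "g y - g z = integral {z..y} g'" by (simp add: integral_unique)
        then show ?thesis
          using integral_bound_linear[of g' z y K] K z xy by (auto intro: integrable_continuous_real cg')
      qed
      also have "\<dots> \<le> K * (y - x)" using z K0 by (intro mult_left_mono) auto
      finally have A: "\<bar>v z * (g y - g z)\<bar> \<le> M * (K * (y - x))"
        unfolding abs_mult using v M by (intro mult_mono) (auto simp: bdd_meas_def)
      have "\<bar>V x - V z\<bar> \<le> M * (y - x)"
        using VL[of x z] z M by (smt (verit) atLeastAtMost_iff mult_left_mono)
      then have B: "\<bar>(V x - V z) * g' z\<bar> \<le> (M * (y - x)) * K"
        unfolding abs_mult using K[of z] z xy by (intro mult_mono) (use M in auto)
      show "\<bar>v z * (g y - g z) + (V x - V z) * g' z\<bar> \<le> 2 * M * K * (y - x)"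
        using abs_triangle_ineq[of "v z * (g y - g z)" "(V x - V z) * g' z"] A B by (simp add: algebra_simps)
    qed
    then show "\<bar>P y - P x\<bar> \<le> 2 * M * K * (y - x)\<^sup>2" by (simp add: power2_eq_square algebra_simps)
  qed
  then show ?thesis by (simp add: P_def)
qed

lemma integral_supset_eq:
  fixes F :: "real \<Rightarrow> real"
  assumes "S \<subseteq> T" "\<And>x. x \<in> T - S \<Longrightarrow> F x = 0"
  shows "integral T F = integral S F"
proof -
  have "integral T F = integral T (\<lambda>x. if x \<in> S then F x else 0)"
    by (rule Henstock_Kurzweil_Integration.integral_cong) (use assms in auto)
  also have "\<dots> = integral S F" using assms(1) by (simp add: integral_restrict_Int Int_absorb2)
  finally show ?thesis .
qed

section \<open>Smooth bump functions\<close>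

text \<open>Finite order with an existentially quantified derivative at each level: closure under
  products and affine substitutions then follows by induction on the order, without formulas for
  higher derivatives.\<close>

primrec smooth_upto :: "nat \<Rightarrow> (real \<Rightarrow> real) \<Rightarrow> bool" where
  "smooth_upto 0 g \<longleftrightarrow> True"
| "smooth_upto (Suc n) g \<longleftrightarrow> (\<exists>g'. (\<forall>x. (g has_real_derivative g' x) (at x)) \<and> smooth_upto n g')"

lemma smooth_upto_SucD: "smooth_upto (Suc n) g \<Longrightarrow> smooth_upto n g"
proof (induction n arbitrary: g)
  case (Suc n)
  from Suc.prems obtain g' where "\<And>x. (g has_real_derivative g' x) (at x)" "smooth_upto (Suc n) g'"
    by (auto simp del: smooth_upto.simps(2) simp: smooth_upto.simps(2)[of "Suc n"])
  then show ?case using Suc.IH[of g'] by (subst smooth_upto.simps) blast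
qed simp

lemma smooth_upto_SucI:
  "(\<And>x. (g has_real_derivative g' x) (at x)) \<Longrightarrow> smooth_upto n g' \<Longrightarrow> smooth_upto (Suc n) g"
  by auto

lemma smooth_upto_lin:
  "smooth_upto n g \<Longrightarrow> smooth_upto n h \<Longrightarrow> smooth_upto n (\<lambda>x. a * g x + b * h x)"
proof (induction n arbitrary: g h)
  case (Suc n)
  from Suc.prems obtain g' h' where "\<And>x. (g has_real_derivative g' x) (at x)" "smooth_upto n g'"
    "\<And>x. (h has_real_derivative h' x) (at x)" "smooth_upto n h'" by auto
  then show ?case using Suc.IH[of g' h']
    by (subst smooth_upto.simps)
       (intro exI[of _ "\<lambda>x. a * g' x + b * h' x"] conjI allI, auto intro!: derivative_eq_intros)
qed simp

lemma smooth_upto_mult: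
  "smooth_upto n g \<Longrightarrow> smooth_upto n h \<Longrightarrow> smooth_upto n (\<lambda>x. g x * h x)"
proof (induction n arbitrary: g h)
  case (Suc n)
  from Suc.prems obtain g' h' where g: "\<And>x. (g has_real_derivative g' x) (at x)" "smooth_upto n g'"
    and h: "\<And>x. (h has_real_derivative h' x) (at x)" "smooth_upto n h'" by auto
  have "smooth_upto n (\<lambda>x. 1 * (g' x * h x) + 1 * (g x * h' x))"
    by (intro smooth_upto_lin Suc.IH g h smooth_upto_SucD[OF Suc.prems(1)] smooth_upto_SucD[OF Suc.prems(2)])
  moreover have "((\<lambda>x. g x * h x) has_real_derivative 1 * (g' x * h x) + 1 * (g x * h' x)) (at x)" for x
    by (auto intro!: derivative_eq_intros g h)
  ultimately show ?case by (rule smooth_upto_SucI[rotated])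
qed simp

lemma smooth_upto_affine:
  "smooth_upto n g \<Longrightarrow> smooth_upto n (\<lambda>x. g (c + k * x))"
proof (induction n arbitrary: g)
  case (Suc n)
  from Suc.prems obtain g' where g: "\<And>x. (g has_real_derivative g' x) (at x)" "smooth_upto n g'" by auto
  have "smooth_upto n (\<lambda>x. k * g' (c + k * x) + 0 * g' (c + k * x))"
    by (intro smooth_upto_lin Suc.IH g)
  moreover have "((\<lambda>x. g (c + k * x)) has_real_derivative k * g' (c + k * x) + 0 * g' (c + k * x)) (at x)" for x
    by (rule DERIV_chain'[where f = "\<lambda>x. c + k * x" and g = g and E = "g' (c + k * x)" and D = k, THEN DERIV_cong])
       (auto intro!: derivative_eq_intros g)
  ultimately show ?case by (rule smooth_upto_SucI[rotated])
qed simp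

text \<open>The powers of \<open>1 / x\<close> are included because the family is then closed under
  differentiation up to linear combinations.\<close>

definition flat_exp :: "nat \<Rightarrow> real \<Rightarrow> real" where
  "flat_exp k x = (if x > 0 then exp (- inverse x) * inverse x ^ k else 0)"

lemma flat_exp_tendsto_0: "(flat_exp k \<longlongrightarrow> 0) (at 0)"
proof -
  have "((\<lambda>x. inverse x ^ k / exp (inverse x)) \<longlongrightarrow> 0) (at_right (0::real))"
    by (rule filterlim_compose[OF tendsto_power_div_exp_0 filterlim_inverse_at_top_right])
  then have "(flat_exp k \<longlongrightarrow> 0) (at_right 0)"
    by (rule Lim_transform_eventually)
       (auto simp: flat_exp_def exp_minus field_simps eventually_at_right_less intro!: eventually_at_right_less[THEN eventually_mono])
  moreover have "(flat_exp k \<longlongrightarrow> 0) (at_left 0)"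
    by (rule tendsto_eventually) (auto simp: eventually_at_left_field flat_exp_def intro!: exI[of _ "-1"])
  ultimately show ?thesis by (simp add: filterlim_split_at)
qed

lemma flat_exp_DERIV:
  "(flat_exp k has_real_derivative flat_exp (k + 2) x + (- real k) * flat_exp (k + 1) x) (at x)"
proof -
  consider "x > 0" | "x < 0" | "x = 0" by linarith
  then show ?thesis
  proof cases
    case 1
    have "((\<lambda>x. exp (- inverse x) * inverse x ^ k) has_real_derivative
        flat_exp (k + 2) x + (- real k) * flat_exp (k + 1) x) (at x)"
    proof -
      have p: "((\<lambda>x. inverse x ^ k) has_real_derivative - real k * inverse x ^ (k + 1)) (at x)"
      proof (induction k)
        case (Suc k)
        have "(inverse has_real_derivative - (inverse x * inverse x)) (at x)"
          using DERIV_inverse[of x] 1 by (simp add: power2_eq_square)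
        from DERIV_mult[OF this Suc]
        show ?case by (simp add: algebra_simps)
      qed simp
      have e: "((\<lambda>x. exp (- inverse x)) has_real_derivative exp (- inverse x) * (inverse x * inverse x)) (at x)"
        using 1 by (auto intro!: derivative_eq_intros)
      show ?thesis
        using DERIV_mult[OF e p] 1 by (simp add: flat_exp_def algebra_simps)
    qed
    then show ?thesis
      by (rule has_field_derivative_transform_within_open[of _ _ _ "{0<..}"]) (use 1 in \<open>auto simp: flat_exp_def\<close>)
  next
    case 2
    have "((\<lambda>x. 0) has_real_derivative flat_exp (k + 2) x + (- real k) * flat_exp (k + 1) x) (at x)"
      using 2 by (simp add: flat_exp_def)
    then show ?thesis
      by (rule has_field_derivative_transform_within_open[of _ _ _ "{..<0}"]) (use 2 in \<open>auto simp: flat_exp_def\<close>)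
  next
    case 3
    \<comment> \<open>The difference quotient of \<open>flat_exp k\<close> at \<open>0\<close> is
      \<open>flat_exp (k + 1)\<close>, which tends to \<open>0\<close>.\<close>
    have "((\<lambda>h. (flat_exp k (0 + h) - flat_exp k 0) / h) \<longlongrightarrow> 0) (at 0)"
      by (rule Lim_transform_eventually[OF flat_exp_tendsto_0[of "k + 1"]])
         (auto simp: flat_exp_def divide_inverse eventually_at_filter)
    then show ?thesis using 3 by (simp add: DERIV_def flat_exp_def)
  qed
qed

lemma smooth_upto_flat_exp: "smooth_upto n (flat_exp k)"
proof (induction n arbitrary: k)
  case (Suc n)
  have "smooth_upto n (\<lambda>x. 1 * flat_exp (k + 2) x + (- real k) * flat_exp (k + 1) x)"
    by (intro smooth_upto_lin Suc)
  moreover have "(flat_exp k has_real_derivative 1 * flat_exp (k + 2) x + (- real k) * flat_exp (k + 1) x) (at x)" for x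
    using flat_exp_DERIV[of k x] by simp
  ultimately show ?case by (rule smooth_upto_SucI[rotated])
qed simp

text \<open>The successive derivatives are carried along explicitly, as in \<^const>\<open>test_function\<close>.\<close>

definition csmooth :: "real \<Rightarrow> (real \<Rightarrow> real) \<Rightarrow> bool" where
  "csmooth R g \<longleftrightarrow>
     (\<exists>D::nat \<Rightarrow> real \<Rightarrow> real. D 0 = g \<and> (\<forall>i x. (D i has_real_derivative D (Suc i) x) (at x))) \<and>
     (\<forall>x. R < \<bar>x\<bar> \<longrightarrow> g x = 0)"

text \<open>Derivatives are unique, so the witnesses for the different finite orders agree and the
  iterates of \<open>deriv\<close> form one common sequence.\<close>

lemma csmoothI:
  assumes "\<And>n. smooth_upto n g" "\<And>x. R < \<bar>x\<bar> \<Longrightarrow> g x = 0"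
  shows "csmooth R g"
proof -
  have step: "(h has_real_derivative deriv h x) (at x)" "smooth_upto n (deriv h)"
    if "\<And>n. smooth_upto n h" for h n x
  proof -
    have "smooth_upto (Suc n) h" by (rule that)
    then obtain g' where g': "\<And>x. (h has_real_derivative g' x) (at x)" "smooth_upto n g'"
      by auto
    then have "deriv h = g'" by (auto intro: DERIV_imp_deriv)
    with g' show "(h has_real_derivative deriv h x) (at x)" "smooth_upto n (deriv h)" by auto
  qed
  define D where "D i = (deriv ^^ i) g" for i
  have D: "smooth_upto n (D i)" for i n
    by (induction i arbitrary: n) (use assms(1) step(2) in \<open>auto simp: D_def\<close>)
  have "(D i has_real_derivative D (Suc i) x) (at x)" for i x
    using step(1)[OF D] by (simp add: D_def)
  then show ?thesis using assms(2) unfolding csmooth_def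
    by (intro conjI exI[of _ D]) (auto simp: D_def)
qed

lemma csmooth_deriv:
  assumes "csmooth R g"
  shows "csmooth R (deriv g)" and "(g has_real_derivative deriv g x) (at x)"
proof -
  obtain D where D: "D 0 = g" "\<And>i x. (D i has_real_derivative D (Suc i) x) (at x)"
    and R: "\<And>x. R < \<bar>x\<bar> \<Longrightarrow> g x = 0" using assms unfolding csmooth_def by auto
  have d: "deriv g = D 1" using D by (auto intro!: DERIV_imp_deriv)
  show "(g has_real_derivative deriv g x) (at x)" using D(2)[of 0 x] D(1) d by simp
  have "D 1 x = 0" if "R < \<bar>x\<bar>" for x
  proof -
    have op: "open {x::real. R < \<bar>x\<bar>}"
      by (intro open_Collect_less continuous_intros)
    have "((\<lambda>_. 0) has_real_derivative 0) (at x)" by simp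
    then have "(g has_real_derivative 0) (at x)"
      by (rule has_field_derivative_transform_within_open[OF _ op]) (use that R in auto)
    then show ?thesis using D(2)[of 0 x] D(1) DERIV_unique by fastforce
  qed
  then show "csmooth R (deriv g)" unfolding csmooth_def
    by (intro conjI exI[of _ "\<lambda>i. D (Suc i)"]) (use D d in auto)
qed

lemma csmooth_continuous: "csmooth R g \<Longrightarrow> continuous_on S g"
  by (intro continuous_at_imp_continuous_on) (auto intro: DERIV_isCont csmooth_deriv(2))

lemma csmooth_zero: "csmooth R g \<Longrightarrow> R < \<bar>x\<bar> \<Longrightarrow> g x = 0"
  by (simp add: csmooth_def)

lemma csmooth_mono: "csmooth R g \<Longrightarrow> R \<le> R' \<Longrightarrow> csmooth R' g"
  by (auto simp: csmooth_def)

lemma csmooth_lin: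
  assumes "csmooth R g" "csmooth R h"
  shows "csmooth R (\<lambda>x. a * g x + b * h x)"
proof -
  obtain D E where D: "D 0 = g" "\<And>i x. (D i has_real_derivative D (Suc i) x) (at x)"
    and E: "E 0 = h" "\<And>i x. (E i has_real_derivative E (Suc i) x) (at x)"
    using assms unfolding csmooth_def by auto
  show ?thesis unfolding csmooth_def
    by (intro conjI exI[of _ "\<lambda>i x. a * D i x + b * E i x"])
       (use assms D E in \<open>auto intro!: derivative_eq_intros simp: csmooth_def\<close>)
qed

lemma csmooth_shift:
  assumes "csmooth R g"
  shows "csmooth (R + \<bar>c\<bar>) (\<lambda>x. g (x - c))"
proof -
  obtain D where D: "D 0 = g" "\<And>i x. (D i has_real_derivative D (Suc i) x) (at x)"
    using assms unfolding csmooth_def by auto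
  have "((\<lambda>x. D i (x - c)) has_real_derivative D (Suc i) (x - c)) (at x)" for i x
    using D(2)[of i "x - c"] DERIV_shift[of "D i" "D (Suc i) (x - c)" x "- c"] by simp
  then show ?thesis unfolding csmooth_def
    by (intro conjI exI[of _ "\<lambda>i x. D i (x - c)"])
       (use assms D in \<open>auto simp: csmooth_def\<close>)
qed

text \<open>The primitive starting at \<open>-R\<close> vanishes to the left of the support, and to
  the right of it because the mean is zero. Its derivatives are those of \<open>g\<close>, shifted
  by one place.\<close>

lemma csmooth_antideriv:
  assumes g: "csmooth R g" and R: "0 < R" and int: "integral {-R..R} g = 0"
  obtains e where "csmooth R e" "\<And>x. (e has_real_derivative g x) (at x)"
proof -
  obtain D where D: "D 0 = g" "\<And>i x. (D i has_real_derivative D (Suc i) x) (at x)"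
    using g unfolding csmooth_def by auto
  have c: "continuous_on UNIV g" using g by (rule csmooth_continuous)
  have i: "g integrable_on {a..b}" for a b
    using c by (intro integrable_continuous_real) (auto intro: continuous_on_subset)
  define e where "e x = prim g x - prim g (- R)" for x
  have e': "(e has_real_derivative g x) (at x)" for x
    unfolding e_def by (auto intro!: derivative_eq_intros prim_DERIV c)
  have z: "integral S g = 0" if "\<And>x. x \<in> S \<Longrightarrow> R \<le> \<bar>x\<bar>" for S
  proof -
    have "integral S g = integral S (\<lambda>_. 0)"
    proof (rule integral_spike[of "{R, -R}"])
      show "negligible {R, -R}" by simp
      show "0 = g x" if "x \<in> S - {R, -R}" for x
        using that \<open>\<And>x. x \<in> S \<Longrightarrow> R \<le> \<bar>x\<bar>\<close>[of x] csmooth_zero[OF g, of x] by auto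
    qed
    then show ?thesis by simp
  qed
  have "e x = 0" if "R < \<bar>x\<bar>" for x
  proof (cases "x < 0")
    case True
    then have "prim g (- R) - prim g x = integral {x..-R} g"
      using that by (intro prim_diff i) auto
    then show ?thesis using z[of "{x..-R}"] R by (simp add: e_def)
  next
    case False
    then have "prim g x - prim g R = integral {R..x} g"
      using that by (intro prim_diff i) auto
    moreover have "prim g R - prim g (- R) = 0"
      using prim_diff[OF i, of "-R" R] R int by simp
    ultimately show ?thesis using z[of "{R..x}"] R by (simp add: e_def)
  qed
  then have "csmooth R e" unfolding csmooth_def
    by (intro conjI exI[of _ "\<lambda>i. case i of 0 \<Rightarrow> e | Suc j \<Rightarrow> D j"])
       (use D e' in \<open>auto split: nat.split\<close>)
  with e' show ?thesis by (rule that[rotated])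
qed

text \<open>Each of the two factors is positive on one half-line and zero on the rest; their product
  is positive exactly on the overlap.\<close>

lemma bump_exists:
  assumes "0 < r"
  obtains b where "csmooth (\<bar>c\<bar> + r) b" "\<And>x. 0 \<le> b x" "\<And>x. 0 < b x \<longleftrightarrow> \<bar>x - c\<bar> < r"
proof
  let ?b = "\<lambda>x. flat_exp 0 ((r - c) + 1 * x) * flat_exp 0 ((r + c) + (-1) * x)"
  show "csmooth (\<bar>c\<bar> + r) ?b"
    by (rule csmoothI, intro smooth_upto_mult smooth_upto_affine smooth_upto_flat_exp)
       (auto simp: flat_exp_def)
  show "0 \<le> ?b x" for x by (simp add: flat_exp_def)
  show "0 < ?b x \<longleftrightarrow> \<bar>x - c\<bar> < r" for x by (auto simp: flat_exp_def)
qed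

lemma csmooth_unit:
  obtains \<rho> where "csmooth 1 \<rho>" "\<And>x. 0 \<le> \<rho> x" "integral {-1..1} \<rho> = 1"
proof -
  obtain b where b: "csmooth 1 b" "\<And>x. 0 \<le> b x" "\<And>x. 0 < b x \<longleftrightarrow> \<bar>x\<bar> < 1"
    using bump_exists[of 1 0] by auto
  have i: "b integrable_on {-1..1}"
    using csmooth_continuous[OF b(1)] by (intro integrable_continuous_real)
  have "integral {-1..1} b \<noteq> 0"
  proof
    assume "integral {-1..1} b = 0"
    then have "(b has_integral 0) (cbox (-1) 1)" using i by (simp add: has_integral_integral)
    then have "b 0 = 0"
      by (rule has_integral_0_cbox_imp_0[rotated 2]) (use b csmooth_continuous[OF b(1)] in auto)
    then show False using b(3)[of 0] by simp
  qed
  moreover have "0 \<le> integral {-1..1} b" by (rule Henstock_Kurzweil_Integration.integral_nonneg[OF i]) (use b in auto)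
  ultimately have p: "0 < integral {-1..1} b" by simp
  define c where "c = inverse (integral {-1..1} b)"
  have "csmooth 1 (\<lambda>x. c * b x + 0 * b x)" by (intro csmooth_lin b)
  moreover have "integral {-1..1} (\<lambda>x. c * b x + 0 * b x) = 1" using p by (simp add: c_def)
  ultimately show ?thesis using that[of "\<lambda>x. c * b x + 0 * b x"] b(2) p by (simp add: c_def)
qed

text \<open>If \<psi> were negative at \<open>c\<close>, it would be negative on a neighbourhood; a
  bump supported there gives an integral that is both nonnegative and nonpositive, so the continuous
  integrand vanishes, contradicting its value at \<open>c\<close>. The radius \<open>r0\<close>
  restricts the bumps, so continuity is needed only near \<open>c\<close>, for instance at positive
  times.\<close>

lemma localize_nonneg:
  fixes \<psi> :: "real \<Rightarrow> real"
  assumes "0 < r0" and c: "continuous_on {c - r0<..<c + r0} \<psi>"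
    and test: "\<And>r b. 0 < r \<Longrightarrow> r < r0 \<Longrightarrow> csmooth (\<bar>c\<bar> + r) b \<Longrightarrow> (\<And>x. 0 \<le> b x) \<Longrightarrow>
        (\<And>x. r \<le> \<bar>x - c\<bar> \<Longrightarrow> b x = 0) \<Longrightarrow> 0 \<le> integral {c - r..c + r} (\<lambda>x. \<psi> x * b x)"
  shows "0 \<le> \<psi> c"
proof (rule ccontr)
  assume neg: "\<not> 0 \<le> \<psi> c"
  have "isCont \<psi> c"
    using c assms(1) by (simp add: continuous_on_eq_continuous_at)
  then have "\<forall>\<^sub>F x in nhds c. \<psi> x < 0"
    using neg order_tendstoD(2)[of \<psi> "\<psi> c" "nhds c" 0] by (simp add: tendsto_at_iff_tendsto_nhds isCont_def)
  then obtain d where d: "0 < d" "\<And>x. \<bar>x - c\<bar> < d \<Longrightarrow> \<psi> x < 0"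
    by (auto simp: eventually_nhds_metric dist_real_def)
  define r where "r = min d r0 / 2"
  have r: "0 < r" "r < r0" "r < d" using d assms(1) by (auto simp: r_def min_def)
  obtain b where b: "csmooth (\<bar>c\<bar> + r) b" "\<And>x. 0 \<le> b x" "\<And>x. 0 < b x \<longleftrightarrow> \<bar>x - c\<bar> < r"
    using bump_exists[OF r(1)] by blast
  have cb: "continuous_on {c - r..c + r} (\<lambda>x. - (\<psi> x * b x))"
    by (intro continuous_intros continuous_on_subset[OF c] csmooth_continuous[OF b(1)]) (use r in auto)
  have b0: "b x = 0" if "r \<le> \<bar>x - c\<bar>" for x using b(2)[of x] b(3)[of x] that by linarith
  have "0 \<le> integral {c - r..c + r} (\<lambda>x. \<psi> x * b x)"
    by (rule test[OF r(1,2) b(1,2) b0])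
  moreover have nn: "0 \<le> - (\<psi> x * b x)" if "x \<in> {c - r..c + r}" for x
  proof -
    have "\<bar>x - c\<bar> < d" using that r by auto
    then show ?thesis using d(2)[of x] b(2)[of x] by (auto intro!: mult_nonpos_nonneg)
  qed
  then have "0 \<le> integral {c - r..c + r} (\<lambda>x. - (\<psi> x * b x))"
    by (intro Henstock_Kurzweil_Integration.integral_nonneg integrable_continuous_real cb)
  ultimately have "integral {c - r..c + r} (\<lambda>x. - (\<psi> x * b x)) = 0" by simp
  then have "((\<lambda>x. - (\<psi> x * b x)) has_integral 0) (cbox (c - r) (c + r))"
    using integrable_continuous_real[OF cb] by (simp add: has_integral_integral)
  then have "- (\<psi> c * b c) = 0"
    by (rule has_integral_0_cbox_imp_0[rotated 2]) (use cb nn r in auto)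
  then show False using b(3)[of c] r neg by auto
qed

section \<open>From the weak formulation to moments of the slices\<close>

locale weak_slices =
  fixes f :: "real \<Rightarrow> real" and v :: "real \<Rightarrow> real \<Rightarrow> real" and M L :: real
  assumes slice: "\<And>t. 0 \<le> t \<Longrightarrow> bdd_meas M (\<lambda>x. v x t)"
    and f_cont: "continuous_on UNIV f"
    and f_lip: "\<And>a b. \<bar>a\<bar> \<le> M \<Longrightarrow> \<bar>b\<bar> \<le> M \<Longrightarrow> \<bar>f a - f b\<bar> \<le> L * \<bar>a - b\<bar>"
    and time_cont: "\<And>t R. 0 < t \<Longrightarrow> 0 < R \<Longrightarrow>
        ((\<lambda>\<tau>. integral {-R..R} (\<lambda>x. \<bar>v x \<tau> - v x t\<bar>)) \<longlongrightarrow> 0) (at t)"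
begin

lemma M_nonneg: "0 \<le> M"
  using bdd_meas_nonneg slice[of 0] by simp

lemma v_bound: "0 \<le> t \<Longrightarrow> \<bar>v x t\<bar> \<le> M"
  using slice[of t] by (simp add: bdd_meas_def)

text \<open>The largest flux over the range of the solution. It will be the Lipschitz constant in
  time of the potential.\<close>

definition F :: real where "F = (SUP y\<in>{-M..M}. \<bar>f y\<bar>)"

lemma f_bound: assumes "\<bar>y\<bar> \<le> M" shows "\<bar>f y\<bar> \<le> F"
proof -
  have "compact ((\<lambda>y. \<bar>f y\<bar>) ` {-M..M})"
    by (intro compact_continuous_image continuous_intros continuous_on_subset[OF f_cont]) auto
  then have "bdd_above ((\<lambda>y. \<bar>f y\<bar>) ` {-M..M})"
    by (intro bounded_imp_bdd_above compact_imp_bounded)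
  then show ?thesis unfolding F_def by (rule cSUP_upper[rotated]) (use assms in auto)
qed

lemma F_nonneg: "0 \<le> F"
  using f_bound[of 0] M_nonneg by force

lemma flux_slice: "0 \<le> t \<Longrightarrow> bdd_meas F (\<lambda>x. f (v x t))"
  by (rule bdd_meas_compose[OF slice f_cont f_bound])

lemma moment_bound:
  assumes w: "bdd_meas K w" and g: "continuous_on {-R..R} g" and "0 \<le> R"
    and G: "\<And>x. x \<in> {-R..R} \<Longrightarrow> \<bar>g x\<bar> \<le> G"
  shows "\<bar>integral {-R..R} (\<lambda>x. w x * g x)\<bar> \<le> K * G * (2 * R)"
proof -
  have "\<bar>integral {-R..R} (\<lambda>x. w x * g x)\<bar> \<le> K * G * (R - - R)"
  proof (rule integral_bound_linear)
    show "\<bar>w x * g x\<bar> \<le> K * G" if "x \<in> {-R..R}" for x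
      unfolding abs_mult using w G[OF that] bdd_meas_nonneg[OF w]
      by (intro mult_mono) (auto simp: bdd_meas_def)
  qed (use assms bdd_meas_mult_integrable[OF w g] in auto)
  then show ?thesis by simp
qed

text \<open>A Lipschitz \<Psi> turns continuity in time with values in local \<open>L^1\<close> into
  continuity of the moments. Both \<Psi> = \<open>f\<close> and the identity occur, for the two
  sides of the conservation law.\<close>

lemma moment_continuous:
  assumes lip: "\<And>a b. \<bar>a\<bar> \<le> M \<Longrightarrow> \<bar>b\<bar> \<le> M \<Longrightarrow> \<bar>\<Psi> a - \<Psi> b\<bar> \<le> C * \<bar>a - b\<bar>"
    and int: "\<And>t. 0 \<le> t \<Longrightarrow> bdd_meas K (\<lambda>x. \<Psi> (v x t))"
    and g: "continuous_on UNIV g" and "0 < R"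
  shows "continuous_on {0<..} (\<lambda>t. integral {-R..R} (\<lambda>x. \<Psi> (v x t) * g x))"
proof (rule continuous_at_imp_continuous_on, rule ballI)
  fix t :: real assume "t \<in> {0<..}"
  then have t: "0 < t" by simp
  have g': "continuous_on S g" for S using g continuous_on_subset by blast
  obtain G where G: "\<And>x. x \<in> {-R..R} \<Longrightarrow> \<bar>g x\<bar> \<le> G"
    by (rule continuous_on_Icc_bound[OF g']) blast
  have G0: "0 \<le> G" using G[of 0] \<open>0 < R\<close> by force
  have C0: "\<bar>\<Psi> a - \<Psi> b\<bar> \<le> \<bar>C\<bar> * \<bar>a - b\<bar>" if "\<bar>a\<bar> \<le> M" "\<bar>b\<bar> \<le> M" for a b
    using lip[OF that] abs_ge_self[of C] mult_right_mono[of C "\<bar>C\<bar>" "\<bar>a - b\<bar>"] by linarith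
  have ii: "(\<lambda>x. \<Psi> (v x \<tau>) * g x) integrable_on {-R..R}" if "0 \<le> \<tau>" for \<tau>
    using that by (intro bdd_meas_mult_integrable[OF int] g')
  have id: "(\<lambda>x. \<bar>v x \<tau> - v x t\<bar>) integrable_on {-R..R}" if "0 \<le> \<tau>" for \<tau>
  proof -
    have "bdd_meas (M + M) (\<lambda>x. \<bar>v x \<tau> - v x t\<bar>)"
      using that t by (intro bdd_meas_abs_diff slice) auto
    then show ?thesis by (rule bdd_meas_integrable)
  qed
  have "((\<lambda>\<tau>. \<bar>C\<bar> * G * integral {-R..R} (\<lambda>x. \<bar>v x \<tau> - v x t\<bar>)) \<longlongrightarrow> \<bar>C\<bar> * G * 0) (at t)"
    by (intro tendsto_intros time_cont t \<open>0 < R\<close>)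
  then have lim: "((\<lambda>\<tau>. \<bar>C\<bar> * G * integral {-R..R} (\<lambda>x. \<bar>v x \<tau> - v x t\<bar>)) \<longlongrightarrow> 0) (at t)" by simp
  have ev: "\<forall>\<^sub>F \<tau> in at t. norm (integral {-R..R} (\<lambda>x. \<Psi> (v x \<tau>) * g x) - integral {-R..R} (\<lambda>x. \<Psi> (v x t) * g x))
      \<le> \<bar>C\<bar> * G * integral {-R..R} (\<lambda>x. \<bar>v x \<tau> - v x t\<bar>)"
  proof -
    have "\<forall>\<^sub>F \<tau> in at t. \<tau> \<in> {0<..}"
      using t by (intro eventually_at_in_open') auto
    then show ?thesis
    proof (rule eventually_mono)
      fix \<tau> :: real assume "\<tau> \<in> {0<..}"
      then have \<tau>: "0 < \<tau>" by simp
      have "integral {-R..R} (\<lambda>x. \<Psi> (v x \<tau>) * g x) - integral {-R..R} (\<lambda>x. \<Psi> (v x t) * g x)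
          = integral {-R..R} (\<lambda>x. \<Psi> (v x \<tau>) * g x - \<Psi> (v x t) * g x)"
        using \<tau> t by (intro Henstock_Kurzweil_Integration.integral_diff[symmetric] ii) auto
      also have "norm \<dots> \<le> integral {-R..R} (\<lambda>x. \<bar>C\<bar> * G * \<bar>v x \<tau> - v x t\<bar>)"
      proof (rule integral_norm_bound_integral)
        show "(\<lambda>x. \<Psi> (v x \<tau>) * g x - \<Psi> (v x t) * g x) integrable_on {-R..R}"
          using \<tau> t by (intro integrable_diff ii) auto
        show "(\<lambda>x. \<bar>C\<bar> * G * \<bar>v x \<tau> - v x t\<bar>) integrable_on {-R..R}"
          using id[of \<tau>] \<tau> by (intro integrable_on_mult_right) auto
        fix x assume x: "x \<in> {-R..R}"
        have "\<bar>(\<Psi> (v x \<tau>) - \<Psi> (v x t)) * g x\<bar> \<le> (\<bar>C\<bar> * \<bar>v x \<tau> - v x t\<bar>) * G"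
          unfolding abs_mult using G[OF x] C0 v_bound \<tau> t G0 by (intro mult_mono) auto
        then show "norm (\<Psi> (v x \<tau>) * g x - \<Psi> (v x t) * g x) \<le> \<bar>C\<bar> * G * \<bar>v x \<tau> - v x t\<bar>"
          by (simp add: algebra_simps)
      qed
      finally show "norm (integral {-R..R} (\<lambda>x. \<Psi> (v x \<tau>) * g x) - integral {-R..R} (\<lambda>x. \<Psi> (v x t) * g x))
          \<le> \<bar>C\<bar> * G * integral {-R..R} (\<lambda>x. \<bar>v x \<tau> - v x t\<bar>)" by simp
    qed
  qed
  have "((\<lambda>\<tau>. integral {-R..R} (\<lambda>x. \<Psi> (v x \<tau>) * g x) - integral {-R..R} (\<lambda>x. \<Psi> (v x t) * g x)) \<longlongrightarrow> 0) (at t)"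
    by (rule Lim_null_comparison[OF ev lim])
  then show "isCont (\<lambda>t. integral {-R..R} (\<lambda>x. \<Psi> (v x t) * g x)) t"
    unfolding isCont_def by (simp add: Lim_null[symmetric])
qed

lemma flux_moment_continuous:
  "continuous_on UNIV g \<Longrightarrow> 0 < R \<Longrightarrow> continuous_on {0<..} (\<lambda>t. integral {-R..R} (\<lambda>x. f (v x t) * g x))"
  by (rule moment_continuous[OF f_lip flux_slice]) auto

lemma slice_moment_continuous:
  "continuous_on UNIV g \<Longrightarrow> 0 < R \<Longrightarrow> continuous_on {0<..} (\<lambda>t. integral {-R..R} (\<lambda>x. v x t * g x))"
  by (rule moment_continuous[where \<Psi> = "\<lambda>x. x" and C = 1, OF _ slice]) auto

text \<open>Moments are continuous only for \<open>t > 0\<close>, since the slice at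
  \<open>0\<close> holds the initial data, which are attained in the weak sense. Extension by
  \<open>0\<close> gives a bounded measurable function on the whole line.\<close>

lemma bdd_meas_half_line:
  assumes c: "continuous_on {0<..} k" and b: "\<And>t. 0 < t \<Longrightarrow> \<bar>k t\<bar> \<le> K"
  shows "bdd_meas K (\<lambda>t. if 0 < t then k t else 0)"
proof -
  have "0 \<le> K" using b[of 1] by simp
  moreover have "(\<lambda>t. if t \<in> {0<..} then k t else 0) \<in> borel_measurable lebesgue"
    using c by (subst borel_measurable_if) (auto intro: continuous_imp_measurable_on_sets_lebesgue)
  ultimately show ?thesis using b by (auto simp: bdd_meas_def)
qed

lemma flux_moment_bdd_meas:
  assumes "continuous_on UNIV g" "0 < R"
  obtains K where "bdd_meas K (\<lambda>t. if 0 < t then integral {-R..R} (\<lambda>x. f (v x t) * g x) else 0)"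
proof -
  have g': "continuous_on S g" for S using assms continuous_on_subset by blast
  obtain G where G: "\<And>x. x \<in> {-R..R} \<Longrightarrow> \<bar>g x\<bar> \<le> G"
    by (rule continuous_on_Icc_bound[OF g']) blast
  show ?thesis
    by (rule that, rule bdd_meas_half_line[OF flux_moment_continuous[OF assms]],
        rule moment_bound[OF flux_slice g' _ G]) (use assms in auto)
qed

lemma half_line_spike:
  assumes "0 \<le> s"
  shows "integral {s..t} (\<lambda>t. if 0 < t then k t else 0) = integral {s..t} (k :: real \<Rightarrow> real)"
    and "(\<lambda>t. if 0 < t then k t else 0) integrable_on {s..t} \<Longrightarrow> k integrable_on {s..t}"
  by (rule integral_spike[of "{0}"], use assms in \<open>auto\<close>)
     (erule integrable_spike[of _ _ "{0}" k], use assms in \<open>auto\<close>)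

lemma flux_moment_integrable:
  assumes "continuous_on UNIV g" "0 < R" "0 \<le> s"
  shows "(\<lambda>t. integral {-R..R} (\<lambda>x. f (v x t) * g x)) integrable_on {s..t}"
proof -
  obtain K where "bdd_meas K (\<lambda>t. if 0 < t then integral {-R..R} (\<lambda>x. f (v x t) * g x) else 0)"
    by (rule flux_moment_bdd_meas[OF assms(1,2)])
  then show ?thesis
    by (rule half_line_spike(2)[OF assms(3) bdd_meas_integrable])
qed

text \<open>Test functions in time: the derivative of \<open>\<kappa>\<close> is a bump at \<open>t\<close> minus a multiple of
  a bump on the negative axis, so that \<open>\<kappa> 0\<close> is the mass of the bump at \<open>t\<close>.\<close>

lemma weak_moment:
  assumes R: "0 < R" and e: "csmooth R e"
    and weak: "\<And>S \<kappa>. 0 < S \<Longrightarrow> csmooth S \<kappa> \<Longrightarrow>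
      ((\<lambda>t. integral {-R..R} (\<lambda>x. v x t * e x) * deriv \<kappa> t
          + integral {-R..R} (\<lambda>x. f (v x t) * deriv e x) * \<kappa> t)
        has_integral - (\<kappa> 0 * integral {-R..R} (\<lambda>x. v x 0 * e x))) {0..S}"
    and t: "0 \<le> t"
  shows "integral {-R..R} (\<lambda>x. v x t * e x) = integral {-R..R} (\<lambda>x. v x 0 * e x)
      + integral {0..t} (\<lambda>\<tau>. integral {-R..R} (\<lambda>x. f (v x \<tau>) * deriv e x))"
proof (cases "t = 0")
  case False
  with t have t: "0 < t" by simp
  define P where "P t = integral {-R..R} (\<lambda>x. v x t * e x)" for t
  define k where "k t = integral {-R..R} (\<lambda>x. f (v x t) * deriv e x)" for t
  define k0 where "k0 t = (if 0 < t then k t else 0)" for t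
  define H where "H = prim k0"
  have ce: "continuous_on UNIV e" "continuous_on UNIV (deriv e)"
    using e csmooth_deriv csmooth_continuous by blast+
  have k0_eq: "k0 = (\<lambda>t. if 0 < t then integral {-R..R} (\<lambda>x. f (v x t) * deriv e x) else 0)"
    by (auto simp: k0_def k_def)
  obtain K where K: "bdd_meas K k0"
    unfolding k0_eq by (rule flux_moment_bdd_meas[OF ce(2) R])
  have H: "H y - H x = integral {x..y} k0" if "x \<le> y" for x y
    unfolding H_def using that by (intro prim_diff bdd_meas_integrable[OF K])
  have ccH: "continuous_on {0<..} H"
  proof -
    have K0: "0 \<le> K" using bdd_meas_nonneg[OF K] .
    have "\<bar>H y - H x\<bar> \<le> K * \<bar>y - x\<bar>" for x y
    proof -
      have "\<bar>H y - H x\<bar> \<le> K * (y - x)" if "x \<le> y" for x y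
        unfolding H[OF that] by (rule integral_bound_linear[OF bdd_meas_integrable[OF K] that]) (use K in \<open>auto simp: bdd_meas_def\<close>)
      from this[of x y] this[of y x] show ?thesis by (cases "x \<le> y") (auto simp: abs_minus_commute)
    qed
    then have "K-lipschitz_on {0<..} H"
      using K0 by (intro lipschitz_onI) (auto simp: dist_real_def abs_minus_commute)
    then show ?thesis by (rule lipschitz_on_continuous_on)
  qed
  have cP: "continuous_on {0<..} P"
    unfolding P_def using ce R by (intro slice_moment_continuous)
  have key: "integral {t - r..t + r} (\<lambda>x. (P x - H x - P 0) * b x) = 0"
    if r: "0 < r" "r < t" and b: "csmooth (\<bar>t\<bar> + r) b" and bz: "\<And>x. r \<le> \<bar>x - t\<bar> \<Longrightarrow> b x = 0" for r b
  proof -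
    \<comment> \<open>\<open>S - 1 = t + r + 3\<close> covers the bump around \<open>t\<close> and
      the auxiliary bump on \<open>{-3..-1}\<close>; the extra unit makes \<kappa> vanish at the
      endpoint \<open>S\<close>.\<close>
    define S where "S = t + r + 4"
    have S: "0 < S" using r t by (simp add: S_def)
    obtain \<rho> where \<rho>: "csmooth 1 \<rho>" "integral {-1..1} \<rho> = 1" by (rule csmooth_unit)
    define B where "B = integral {t - r..t + r} b"
    define \<rho>2 where "\<rho>2 x = \<rho> (x - (-2))" for x
    have \<rho>2: "csmooth (S - 1) \<rho>2"
      unfolding \<rho>2_def by (rule csmooth_mono[OF csmooth_shift[OF \<rho>(1)]]) (use r t in \<open>simp add: S_def\<close>)
    have b': "csmooth (S - 1) b" by (rule csmooth_mono[OF b]) (use r t in \<open>simp add: S_def\<close>)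
    define \<theta> where "\<theta> x = B * \<rho>2 x + (-1) * b x" for x
    have \<theta>: "csmooth (S - 1) \<theta>" unfolding \<theta>_def by (intro csmooth_lin \<rho>2 b')
    have cb: "continuous_on X b" and c\<rho>: "continuous_on X \<rho>2" for X
      using b' \<rho>2 csmooth_continuous by blast+
    have I\<rho>: "integral {a..c} \<rho>2 = 1" if "a \<le> -3" "-1 \<le> c" for a c
    proof -
      have "integral {a..c} \<rho>2 = integral {-1 - 2..1 - 2} \<rho>2"
        by (rule integral_supset_eq) (use that in \<open>auto simp: \<rho>2_def intro!: csmooth_zero[OF \<rho>(1)]\<close>)
      also have "\<dots> = integral {-1..1} \<rho>"
        unfolding \<rho>2_def using integral_shift_real_ivl[of "-1" 2 1 \<rho>] by simp
      finally show ?thesis using \<rho>(2) by simp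
    qed
    have Ib: "integral {a..c} (\<lambda>x. q x * b x) = integral {t - r..t + r} (\<lambda>x. q x * b x)"
      if "a \<le> t - r" "t + r \<le> c" for a c and q :: "real \<Rightarrow> real"
      by (rule integral_supset_eq) (use that bz in auto)
    have "integral {-(S-1)..S-1} \<theta> = B * integral {-(S-1)..S-1} \<rho>2 + (-1) * integral {-(S-1)..S-1} b"
      unfolding \<theta>_def
      by (intro integral_unique has_integral_add has_integral_mult_right integrable_integral
          integrable_continuous_real cb c\<rho>)
    also have "\<dots> = 0" using I\<rho>[of "-(S-1)" "S-1"] Ib[of "-(S-1)" "S-1" "\<lambda>_. 1"] r t by (simp add: S_def B_def)
    finally obtain \<kappa> where \<kappa>: "csmooth (S - 1) \<kappa>" "\<And>x. (\<kappa> has_real_derivative \<theta> x) (at x)"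
      using csmooth_antideriv[OF \<theta>] r t by (auto simp: S_def)
    have d\<kappa>: "deriv \<kappa> = \<theta>" using \<kappa>(2) by (auto intro: DERIV_imp_deriv)
    have \<kappa>S: "\<kappa> S = 0" "\<kappa> (-S) = 0" using S by (auto intro!: csmooth_zero[OF \<kappa>(1)])
    have c\<theta>: "continuous_on X \<theta>" for X using \<theta> csmooth_continuous by blast
    have \<theta>pos: "\<theta> x = - b x" if "0 \<le> x" for x
      using that csmooth_zero[OF \<rho>(1), of "x + 2"] by (simp add: \<theta>_def \<rho>2_def)
    have \<kappa>0: "\<kappa> 0 = B"
    proof -
      have "(\<theta> has_integral (\<kappa> S - \<kappa> 0)) {0..S}"
        using S \<kappa>(2) by (intro fundamental_theorem_of_calculus)
          (auto simp: has_real_derivative_iff_has_vector_derivative[symmetric] intro: has_field_derivative_at_within)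
      then have "\<kappa> S - \<kappa> 0 = integral {0..S} \<theta>" by (simp add: integral_unique)
      also have "\<dots> = integral {0..S} (\<lambda>x. - b x)"
        by (rule Henstock_Kurzweil_Integration.integral_cong) (use \<theta>pos in auto)
      also have "\<dots> = - B" using Ib[of 0 S "\<lambda>_. 1"] r t by (simp add: S_def B_def)
      finally show ?thesis using \<kappa>S by simp
    qed
    have w: "((\<lambda>t. P t * \<theta> t + k t * \<kappa> t) has_integral - (B * P 0)) {0..S}"
      using weak[OF S csmooth_mono[OF \<kappa>(1), of S]] unfolding d\<kappa> \<kappa>0 P_def k_def by simp
    \<comment> \<open>Moving the derivative from \<open>H\<close> to \<kappa> puts the same weight
      \<open>b\<close> on both terms of the weak formulation. The boundary terms vanish because
      \<open>H 0 = 0\<close> and \<open>\<kappa> S = 0\<close>.\<close>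
    have k\<kappa>: "integral {0..S} (\<lambda>t. k0 t * \<kappa> t) = integral {0..S} (\<lambda>t. H t * b t)"
    proof -
      have "integral {0..S} (\<lambda>t. k0 t * \<kappa> t) = H S * \<kappa> S - H 0 * \<kappa> 0 - integral {0..S} (\<lambda>t. H t * \<theta> t)"
        by (rule integration_by_parts_ae[OF K _ H \<kappa>(2) c\<theta>]) (use S in auto)
      also have "\<dots> = - integral {0..S} (\<lambda>t. H t * \<theta> t)" using \<kappa>S by (simp add: H_def)
      also have "\<dots> = integral {0..S} (\<lambda>t. - (H t * \<theta> t))" by simp
      also have "\<dots> = integral {0..S} (\<lambda>t. H t * b t)"
        by (rule Henstock_Kurzweil_Integration.integral_cong) (use \<theta>pos in auto)
      finally show ?thesis .
    qed
    have ik0: "(\<lambda>t. k0 t * \<kappa> t) integrable_on {0..S}"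
      by (intro bdd_meas_mult_integrable[OF K] csmooth_continuous[OF \<kappa>(1)])
    have "((\<lambda>t. k0 t * \<kappa> t) has_integral integral {0..S} (\<lambda>t. H t * b t)) {0..S}"
      using ik0 k\<kappa> by (simp add: has_integral_integral)
    then have "((\<lambda>t. k t * \<kappa> t) has_integral integral {0..S} (\<lambda>t. H t * b t)) {0..S}"
      by (rule has_integral_spike[of "{0}", rotated 2]) (auto simp: k0_def)
    from has_integral_diff[OF w this]
    have "((\<lambda>t. P t * \<theta> t) has_integral - (B * P 0) - integral {0..S} (\<lambda>t. H t * b t)) {0..S}"
      by simp
    then have "((\<lambda>t. - (P t * b t)) has_integral - (B * P 0) - integral {0..S} (\<lambda>t. H t * b t)) {0..S}"
      by (rule has_integral_eq[rotated]) (use \<theta>pos in auto)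
    then have "integral {0..S} (\<lambda>t. - (P t * b t)) = - (B * P 0) - integral {0..S} (\<lambda>t. H t * b t)"
      by (rule integral_unique)
    then have "integral {0..S} (\<lambda>t. P t * b t) = B * P 0 + integral {0..S} (\<lambda>t. H t * b t)" by simp
    then have PB: "integral {t - r..t + r} (\<lambda>t. P t * b t) = B * P 0 + integral {t - r..t + r} (\<lambda>t. H t * b t)"
      using Ib[of 0 S P] Ib[of 0 S H] r t by (simp add: S_def)
    have "integral {t - r..t + r} (\<lambda>x. (P x - H x - P 0) * b x)
        = integral {t - r..t + r} (\<lambda>x. P x * b x - H x * b x - P 0 * b x)"
      by (simp add: algebra_simps)
    also have "\<dots> = integral {t - r..t + r} (\<lambda>x. P x * b x) - integral {t - r..t + r} (\<lambda>x. H x * b x) - P 0 * B"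
    proof -
      have sub: "{t - r..t + r} \<subseteq> {0<..}" using r by auto
      have "((\<lambda>x. P x * b x - H x * b x - P 0 * b x) has_integral
          integral {t - r..t + r} (\<lambda>x. P x * b x) - integral {t - r..t + r} (\<lambda>x. H x * b x) - P 0 * B) {t - r..t + r}"
        unfolding B_def
        by (intro has_integral_diff has_integral_mult_right integrable_integral integrable_continuous_real
            continuous_on_mult cb continuous_on_subset[OF cP sub] continuous_on_subset[OF ccH sub])
      then show ?thesis by (rule integral_unique)
    qed
    finally show ?thesis using PB by simp
  qed
  have cc: "continuous_on {t - t<..<t + t} (\<lambda>x. P x - H x - P 0)"
    by (intro continuous_intros continuous_on_subset[OF cP] continuous_on_subset[OF ccH]) auto
  have "0 \<le> P t - H t - P 0"
    by (rule localize_nonneg[OF t cc]) (use key in auto)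
  moreover have "0 \<le> - (P t - H t - P 0)"
  proof (rule localize_nonneg[OF t, where \<psi> = "\<lambda>x. - (P x - H x - P 0)"])
    show "continuous_on {t - t<..<t + t} (\<lambda>x. - (P x - H x - P 0))" by (intro continuous_on_minus cc)
    show "0 \<le> integral {t - r..t + r} (\<lambda>x. - (P x - H x - P 0) * b x)"
      if "0 < r" "r < t" "csmooth (\<bar>t\<bar> + r) b" "\<And>x. 0 \<le> b x"
        "\<And>x. r \<le> \<bar>x - t\<bar> \<Longrightarrow> b x = 0" for r b
      using key[OF that(1-3,5)] by (simp only: mult_minus_left Henstock_Kurzweil_Integration.integral_neg)
  qed
  moreover have "H t = integral {0..t} k"
  proof -
    have "k0 = (\<lambda>t. if 0 < t then k t else 0)" by (auto simp: k0_def)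
    then show ?thesis
      using H[of 0 t] t half_line_spike(1)[of 0 t k] by (simp add: H_def)
  qed
  moreover have "k = (\<lambda>t. integral {-R..R} (\<lambda>x. f (v x t) * deriv e x))"
    by (auto simp: k_def)
  ultimately show ?thesis by (simp add: P_def)
qed simp

end

section \<open>Null sets, slices and Fubini on the half-plane\<close>

lemma AE_lebesgue_slices:
  fixes Q :: "real \<times> real \<Rightarrow> bool"
  assumes "AE z in lebesgue. Q z"
  shows "AE t in lborel. AE x in lborel. Q (x, t)"
proof -
  have "AE z in lborel. Q z" using assms by (simp add: AE_completion_iff)
  \<comment> \<open>Lebesgue measure on the plane is the completion of the product measure, so the
    exceptional set is first enlarged to a Borel null set, for which the iterated statement is
    available in either order.\<close>
  then obtain N where N: "{z \<in> space lborel. \<not> Q z} \<subseteq> N" "emeasure lborel N = 0" "N \<in> sets lborel"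
    by (rule AE_E)
  then have "N \<in> null_sets (lborel :: (real \<times> real) measure)" by (auto simp: null_sets_def)
  then have "AE z in (lborel :: (real \<times> real) measure). z \<notin> N" by (rule AE_not_in)
  then have *: "AE z in lborel \<Otimes>\<^sub>M (lborel :: real measure). z \<notin> N" unfolding lborel_prod .
  have m: "{z \<in> space (lborel \<Otimes>\<^sub>M lborel). (fst z :: real, snd z :: real) \<notin> N} \<in> sets (lborel \<Otimes>\<^sub>M lborel)"
  proof -
    have "{z \<in> space (lborel \<Otimes>\<^sub>M lborel). (fst z :: real, snd z :: real) \<notin> N} = - N"
      by (auto simp: space_pair_measure)
    then show ?thesis using N(3) by (simp only: lborel_prod) (simp add: borel_comp)
  qed
  have "AE x in lborel. AE t in lborel. (x, t) \<notin> N" by (rule lborel_pair.AE_pair[OF *])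
  then have "AE t in lborel. AE x in lborel. (x, t) \<notin> N"
    using lborel_pair.AE_commute[of "\<lambda>x t. (x, t) \<notin> N", OF m] by simp
  then show ?thesis
    by (elim eventually_mono) (use N(1) in auto)
qed

text \<open>A Borel representative, clipped to the bound and cut off outside the square, is
  integrable for the product measure. Fubini applies to it, and for almost every \<open>t\<close>
  its slice agrees with that of \<open>F\<close> almost everywhere.\<close>

lemma lebesgue_Fubini_has_integral:
  fixes F :: "real \<times> real \<Rightarrow> real"
  assumes F: "F \<in> borel_measurable lebesgue" and bd: "\<And>z. \<bar>F z\<bar> \<le> K"
    and supp: "\<And>x t. \<not> (\<bar>x\<bar> \<le> R \<and> \<bar>t\<bar> \<le> R) \<Longrightarrow> F (x, t) = 0"
  shows "((\<lambda>t. integral {-R..R} (\<lambda>x. F (x, t))) has_integral integral\<^sup>L lebesgue F) UNIV"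
proof -
  obtain g0 where g0: "g0 \<in> borel_measurable lborel" "AE z in lborel. F z = g0 z"
    using completion_ex_borel_measurable_real[OF F] by blast
  define B where "B = cbox (-R, -R) (R, R)"
  define g where "g z = (if z \<in> B then max (- K) (min K (g0 z)) else 0)" for z
  have K: "0 \<le> K" using bd[of "(0, 0)"] by linarith
  have [measurable]: "B \<in> sets borel" unfolding B_def by simp
  have gm: "g \<in> borel_measurable borel"
    using g0(1) unfolding g_def by measurable
  have Fg: "AE z in lborel. F z = g z"
    using g0(2)
  proof eventually_elim
    case (elim z)
    then show ?case using bd[of z] supp[of "fst z" "snd z"]
      by (cases z) (auto simp: g_def B_def abs_le_iff cbox_Pair_eq)
  qed
  have gi: "integrable lborel g"
  proof (rule integrableI_bounded_set[where A = B and B = K])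
    show "emeasure lborel B < \<infinity>" unfolding B_def by (rule emeasure_lborel_cbox_finite)
    show "AE x in lborel. x \<in> B \<longrightarrow> norm (g x) \<le> K" using K by (auto simp: g_def)
  qed (use gm in \<open>auto simp: g_def\<close>)
  have gi': "integrable (lborel \<Otimes>\<^sub>M lborel) (case_prod (\<lambda>x t. g (x, t)))"
    using gi by (simp add: lborel_prod)
  have "integral\<^sup>L lebesgue F = integral\<^sup>L lebesgue g"
    using Fg F gm by (intro integral_cong_AE) (auto simp: AE_completion_iff intro: measurable_completion)
  also have "\<dots> = integral\<^sup>L lborel g" using gm by (intro integral_completion) simp
  also have "\<dots> = (\<integral>t. (\<integral>x. g (x, t) \<partial>lborel) \<partial>lborel)"
    using lborel_pair.integral_snd[OF gi'] by (simp add: lborel_prod)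
  finally have eq: "integral\<^sup>L lebesgue F = (\<integral>t. (\<integral>x. g (x, t) \<partial>lborel) \<partial>lborel)" .
  have h: "((\<lambda>t. (\<integral>x. g (x, t) \<partial>lborel)) has_integral integral\<^sup>L lebesgue F) UNIV"
    unfolding eq by (rule has_integral_integral_lborel) (rule lborel_pair.integrable_snd[OF gi'])
  have "AE t in lborel. t \<in> UNIV \<longrightarrow> (\<integral>x. g (x, t) \<partial>lborel) = integral {-R..R} (\<lambda>x. F (x, t))"
  proof -
    have "AE t in lborel. AE x in lborel. F (x, t) = g (x, t)"
      using Fg by (intro AE_lebesgue_slices[of "\<lambda>z. F z = g z"] AE_completion)
    then show ?thesis
    proof eventually_elim
      case (elim t)
      have gmt: "(\<lambda>x. g (x, t)) \<in> borel_measurable borel"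
        using gm by measurable
      have "integrable lborel (\<lambda>x. g (x, t))"
      proof (rule integrableI_bounded_set[where A = "{-R..R}" and B = K])
        show "AE x in lborel. x \<notin> {-R..R} \<longrightarrow> g (x, t) = 0"
          by (auto simp: g_def B_def cbox_Pair_eq)
      qed (use gmt K in \<open>auto simp: g_def emeasure_lborel_Icc_eq\<close>)
      then have h: "((\<lambda>x. g (x, t)) has_integral (\<integral>x. g (x, t) \<partial>lborel)) UNIV"
        by (rule has_integral_integral_lborel)
      have "AE x in lborel. x \<in> UNIV \<longrightarrow> g (x, t) = F (x, t)"
        using elim by eventually_elim simp
      from iffD1[OF has_integral_AE[OF this] h]
      have "(\<integral>x. g (x, t) \<partial>lborel) = integral UNIV (\<lambda>x. F (x, t))" by (simp add: integral_unique)
      also have "\<dots> = integral {-R..R} (\<lambda>x. F (x, t))"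
      proof (rule integral_supset_eq)
        show "F (x, t) = 0" if "x \<in> UNIV - {-R..R}" for x
          using that by (intro supp) auto
      qed simp
      finally show ?case by simp
    qed
  qed
  from iffD1[OF has_integral_AE[OF this] h] show ?thesis .
qed

lemma csmooth_bounded:
  assumes "csmooth R g"
  obtains G where "0 \<le> G" "\<And>x. \<bar>g x\<bar> \<le> G"
proof -
  obtain G where G: "\<And>x. x \<in> {-R..R} \<Longrightarrow> \<bar>g x\<bar> \<le> G"
    by (rule continuous_on_Icc_bound[OF csmooth_continuous[OF assms]]) blast
  have "\<bar>g x\<bar> \<le> max G 0" for x
  proof (cases "R < \<bar>x\<bar>")
    case False
    then have "\<bar>g x\<bar> \<le> G" by (intro G) auto
    then show ?thesis by simp
  qed (simp add: csmooth_zero[OF assms])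
  then show ?thesis using that[of "max G 0"] by auto
qed

lemma test_function_product:
  assumes "csmooth R e" "csmooth S \<kappa>"
  shows "test_function (\<lambda>x t. e x * \<kappa> t)"
proof -
  obtain D where D: "D 0 = e" "\<And>i x. (D i has_real_derivative D (Suc i) x) (at x)"
    using assms unfolding csmooth_def by auto
  obtain D' where D': "D' 0 = \<kappa>" "\<And>i x. (D' i has_real_derivative D' (Suc i) x) (at x)"
    using assms unfolding csmooth_def by auto
  have c: "continuous_on X (D i)" "continuous_on X (D' i)" for X i
    using DERIV_isCont[OF D(2)] DERIV_isCont[OF D'(2)] by (simp_all add: continuous_at_imp_continuous_on)
  have "bounded {(x, t). e x * \<kappa> t \<noteq> 0}"
  proof (rule bounded_subset[of "{-R..R} \<times> {-S..S}"])
    show "{(x, t). e x * \<kappa> t \<noteq> 0} \<subseteq> {-R..R} \<times> {-S..S}"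
      using assms unfolding csmooth_def by (force simp: not_less[symmetric])
  qed (auto intro: bounded_Times)
  moreover have "continuous_on UNIV (\<lambda>(x, t). D i x * D' j t)" for i j
    unfolding case_prod_beta
    by (intro continuous_on_mult continuous_on_compose2[OF c(1)] continuous_on_compose2[OF c(2)] continuous_intros) auto
  ultimately show ?thesis unfolding test_function_def
    by (intro conjI exI[of _ "\<lambda>i j x t. D i x * D' j t"])
       (auto intro!: derivative_eq_intros D(2) D'(2) simp: D D')
qed

text \<open>The nearest-point projection onto \<open>{-M..M}\<close>. It provides representatives
  bounded everywhere and measures how far a slice leaves this range.\<close>

definition clip :: "real \<Rightarrow> real \<Rightarrow> real" where
  "clip M y = max (- M) (min M y)"

lemma clip_bound: "0 \<le> M \<Longrightarrow> \<bar>clip M y\<bar> \<le> M"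
  by (auto simp: clip_def)

lemma clip_id: "\<bar>y\<bar> \<le> M \<Longrightarrow> clip M y = y"
  by (auto simp: clip_def)

lemma clip_dist: "\<bar>w\<bar> \<le> M \<Longrightarrow> \<bar>y - clip M y\<bar> \<le> \<bar>y - w\<bar>"
  by (auto simp: clip_def max_def min_def)

lemma clip_measurable: "v \<in> borel_measurable N \<Longrightarrow> (\<lambda>x. clip M (v x)) \<in> borel_measurable N"
  unfolding clip_def by (intro borel_measurable_max borel_measurable_min borel_measurable_const)

lemma integral_lebesgue_on_Icc:
  fixes w :: "real \<Rightarrow> real"
  assumes "bdd_meas K w"
  shows "integrable (lebesgue_on {a..b}) w" "integral\<^sup>L (lebesgue_on {a..b}) w = integral {a..b} w"
proof -
  have "finite_measure (lebesgue_on {a..b})" by (intro finite_measure_lebesgue_on) auto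
  then interpret finite_measure "lebesgue_on {a..b}" .
  show i: "integrable (lebesgue_on {a..b}) w"
    by (rule integrable_const_bound[where B = K])
       (use assms in \<open>auto simp: bdd_meas_def intro: measurable_restrict_space1\<close>)
  show "integral\<^sup>L (lebesgue_on {a..b}) w = integral {a..b} w"
    using i by (intro lebesgue_integral_eq_integral) auto
qed

lemma AE_lebesgue_on_iff:
  "S \<in> sets lebesgue \<Longrightarrow> (AE x in lebesgue_on S. P x) \<longleftrightarrow> (AE x in lebesgue. x \<in> S \<longrightarrow> P x)"
  by (subst AE_restrict_space_iff) auto

lemma AE_lebesgue_exhaust:
  fixes P :: "real \<Rightarrow> bool"
  assumes "\<And>n::nat. AE x in lebesgue. x \<in> {- real (Suc n)..real (Suc n)} \<longrightarrow> P x"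
  shows "AE x in lebesgue. P x"
proof -
  have "AE x in lebesgue. \<forall>n::nat. x \<in> {- real (Suc n)..real (Suc n)} \<longrightarrow> P x"
    using assms by (simp only: AE_all_countable) blast
  then show ?thesis
  proof eventually_elim
    case (elim x)
    obtain n :: nat where "\<bar>x\<bar> \<le> real n" using real_arch_simple by blast
    then have "x \<in> {- real (Suc n)..real (Suc n)}" by auto
    then show ?case using elim by blast
  qed
qed

lemma AE_lebesgue_shift:
  fixes P :: "real \<Rightarrow> bool"
  assumes "AE x in lebesgue. P x"
  shows "AE x in lebesgue. P (x + a)"
proof -
  have "AE x in lborel. P x" using assms by (simp add: AE_completion_iff)
  then have "AE x in distr lborel borel (\<lambda>x. a + x). P x" by (subst lborel_distr_plus)
  then obtain N where N: "{x. \<not> P x} \<subseteq> N" "N \<in> null_sets (distr lborel borel (\<lambda>x. a + x))"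
    by (auto simp: eventually_ae_filter)
  then have "emeasure lborel ((\<lambda>x. a + x) -` N) = 0" "N \<in> sets borel"
    by (auto simp: null_sets_def emeasure_distr)
  then have "(\<lambda>x. a + x) -` N \<in> null_sets lborel"
    by (auto simp: null_sets_def intro: measurable_sets_borel[of "\<lambda>x. a + x" borel, simplified])
  then have "AE x in lborel. x \<notin> (\<lambda>x. a + x) -` N" by (rule AE_not_in)
  then have "AE x in lborel. P (x + a)"
    by eventually_elim (use N(1) in \<open>auto simp: add.commute\<close>)
  then show ?thesis by (rule AE_completion)
qed

text \<open>A bound on the half-plane passes only to almost every slice. Time continuity carries it
  to every \<open>t\<close>: the \<open>L^1\<close> distance \<open>c\<close> from the slice at
  \<open>t\<close> to its clipped version is at most its distance to any bounded slice, and bounded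
  slices occur arbitrarily close to \<open>t\<close>.\<close>

lemma slice_AE_bound:
  assumes sl: "\<And>t. 0 < t \<Longrightarrow> Linfty_on UNIV (\<lambda>x. u x t)"
    and cont: "L1loc_time_continuous u"
    and good: "AE \<tau> in lborel. 0 < \<tau> \<longrightarrow> (AE x in lebesgue. \<bar>u x \<tau>\<bar> \<le> M)"
    and M: "0 \<le> M" and t: "0 < t"
  shows "AE x in lebesgue. \<bar>u x t\<bar> \<le> M"
proof (rule AE_lebesgue_exhaust)
  fix n :: nat
  define R where "R = real (Suc n)"
  have R: "0 < R" by (simp add: R_def)
  define X where "X = lebesgue_on {-R..R}"
  have "finite_measure X" unfolding X_def by (intro finite_measure_lebesgue_on) auto
  then interpret finite_measure X .
  have um: "(\<lambda>x. u x \<tau>) \<in> borel_measurable X" if "0 < \<tau>" for \<tau>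
    using sl[OF that] unfolding Linfty_on_def X_def
    by (auto intro: measurable_restrict_space1)
  have ub: "\<exists>K. AE x in X. \<bar>u x \<tau>\<bar> \<le> K" if "0 < \<tau>" for \<tau>
    using sl[OF that] unfolding Linfty_on_def X_def by (auto simp: AE_lebesgue_on_iff elim: eventually_mono)
  have di: "integrable X (\<lambda>x. \<bar>u x \<tau> - u x t\<bar>)" if \<tau>: "0 < \<tau>" for \<tau>
  proof -
    obtain K1 where "AE x in X. \<bar>u x \<tau>\<bar> \<le> K1" using ub[OF \<tau>] by blast
    moreover obtain K2 where "AE x in X. \<bar>u x t\<bar> \<le> K2" using ub[OF t] by blast
    ultimately have "AE x in X. norm \<bar>u x \<tau> - u x t\<bar> \<le> K1 + K2" by eventually_elim auto
    then show ?thesis using um[OF that] um[OF t] by (intro integrable_const_bound) auto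
  qed
  have ci: "integrable X (\<lambda>x. \<bar>u x t - clip M (u x t)\<bar>)"
  proof -
    obtain K2 where "AE x in X. \<bar>u x t\<bar> \<le> K2" using ub t by blast
    then have "AE x in X. norm \<bar>u x t - clip M (u x t)\<bar> \<le> K2 + M"
    proof eventually_elim
      case (elim x) then show ?case using clip_bound[OF M, of "u x t"] by auto
    qed
    then show ?thesis using um[OF t] clip_measurable[OF um[OF t]] by (intro integrable_const_bound) auto
  qed
  define c where "c = integral\<^sup>L X (\<lambda>x. \<bar>u x t - clip M (u x t)\<bar>)"
  have c0: "0 \<le> c" unfolding c_def by (intro integral_nonneg_AE) auto
  have le: "c \<le> integral\<^sup>L X (\<lambda>x. \<bar>u x \<tau> - u x t\<bar>)"
    if "0 < \<tau>" "AE x in lebesgue. \<bar>u x \<tau>\<bar> \<le> M" for \<tau>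
    unfolding c_def
  proof (rule integral_mono_AE[OF ci di[OF that(1)]])
    have "AE x in X. \<bar>u x \<tau>\<bar> \<le> M"
      using that(2) unfolding X_def by (auto simp: AE_lebesgue_on_iff elim: eventually_mono)
    then show "AE x in X. \<bar>u x t - clip M (u x t)\<bar> \<le> \<bar>u x \<tau> - u x t\<bar>"
    proof eventually_elim
      case (elim x) then show ?case using clip_dist[of "u x \<tau>" M "u x t"] by (simp add: abs_minus_commute)
    qed
  qed
  have "c = 0"
  proof (rule ccontr)
    assume "c \<noteq> 0"
    with c0 have "0 < c" by simp
    have "((\<lambda>\<tau>. integral\<^sup>L X (\<lambda>x. \<bar>u x \<tau> - u x t\<bar>)) \<longlongrightarrow> 0) (at t)"
      using cont t R unfolding L1loc_time_continuous_def X_def by blast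
    then have "\<forall>\<^sub>F \<tau> in at t. integral\<^sup>L X (\<lambda>x. \<bar>u x \<tau> - u x t\<bar>) < c"
      using \<open>0 < c\<close> by (rule order_tendstoD)
    then obtain d where d: "0 < d" "\<And>\<tau>. \<tau> \<noteq> t \<Longrightarrow> dist \<tau> t < d \<Longrightarrow> integral\<^sup>L X (\<lambda>x. \<bar>u x \<tau> - u x t\<bar>) < c"
      unfolding eventually_at by auto
    \<comment> \<open>If \<open>c\<close> were positive, no time in this interval could have a
      bounded slice, although almost every time has one; but an interval of length
      \<open>d > 0\<close> is not null.\<close>
    have "AE \<tau> in lborel. \<tau> \<notin> {t<..<t + d}"
      using good
    proof eventually_elim
      case (elim \<tau>)
      show ?case
      proof
        assume \<tau>: "\<tau> \<in> {t<..<t + d}"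
        then have "c \<le> integral\<^sup>L X (\<lambda>x. \<bar>u x \<tau> - u x t\<bar>)" using elim t by (intro le) auto
        then show False using d(2)[of \<tau>] \<tau> by (auto simp: dist_real_def)
      qed
    qed
    then have "{t<..<t + d} \<in> null_sets lborel" by (subst AE_iff_null_sets) auto
    then show False using d(1) by (auto simp: null_sets_def)
  qed
  then have "AE x in X. \<bar>u x t - clip M (u x t)\<bar> = 0"
    unfolding c_def using integral_nonneg_eq_0_iff_AE[OF ci] by simp
  then have "AE x in X. \<bar>u x t\<bar> \<le> M"
  proof eventually_elim
    case (elim x) then show ?case using clip_bound[OF M, of "u x t"] by simp
  qed
  then show "AE x in lebesgue. x \<in> {- real (Suc n)..real (Suc n)} \<longrightarrow> \<bar>u x t\<bar> \<le> M"
    unfolding X_def R_def by (simp add: AE_lebesgue_on_iff)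
qed

text \<open>This is the only place where the weak formulation is unfolded. Product test functions
  \<open>e(x) \<kappa>(t)\<close> reduce it to an identity in time, to which
  \<open>weak_moment\<close> applies; the result is stated for a representative bounded at every
  point.\<close>

lemma entropy_solution_slices:
  fixes u :: "real \<Rightarrow> real \<Rightarrow> real"
  assumes fd: "\<And>x. (f has_real_derivative f' x) (at x)" and f'c: "continuous_on UNIV f'"
    and ent: "entropy_solution f u0 u" and u0: "Linfty_on UNIV u0"
  obtains M L E v where "weak_slices f v M L" "0 < E"
    "\<And>t. 0 < t \<Longrightarrow> AE x in lebesgue. v x t = u x t" "AE x in lebesgue. v x 0 = u0 x"
    "\<And>t a. 0 < t \<Longrightarrow> 0 < a \<Longrightarrow> AE x in lebesgue. v (x + a) t - v x t \<le> E * a / t"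
    "\<And>R e t. 0 < R \<Longrightarrow> csmooth R e \<Longrightarrow> 0 \<le> t \<Longrightarrow>
      integral {-R..R} (\<lambda>x. v x t * e x) = integral {-R..R} (\<lambda>x. v x 0 * e x)
      + integral {0..t} (\<lambda>\<tau>. integral {-R..R} (\<lambda>x. f (v x \<tau>) * deriv e x))"
proof -
  define H where "H = (UNIV :: real set) \<times> {0::real<..}"
  have H: "H \<in> sets lebesgue" unfolding H_def by (intro lmeasurable_open borel_open open_Times sets_completionI_sets) (auto simp: open_Times)
  from ent have um: "(\<lambda>(x, t). u x t) \<in> borel_measurable (lebesgue_on H)"
    and ub: "\<exists>M. AE z in lebesgue_on H. \<bar>case_prod u z\<bar> \<le> M"
    and sl: "\<And>t. 0 < t \<Longrightarrow> Linfty_on UNIV (\<lambda>x. u x t)" and cont: "L1loc_time_continuous u"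
    and weak: "weak_solution f u0 u"
    unfolding entropy_solution_def Linfty_on_def H_def by (auto simp: case_prod_beta')
  obtain E where E: "0 < E" "\<And>t a. 0 < t \<Longrightarrow> 0 < a \<Longrightarrow> AE x in lebesgue. u (x + a) t - u x t \<le> E * a / t"
    using ent unfolding entropy_solution_def by blast
  obtain M1 where M1: "AE z in lebesgue_on H. \<bar>case_prod u z\<bar> \<le> M1" using ub by blast
  obtain M2 where M2: "AE x in lebesgue. \<bar>u0 x\<bar> \<le> M2"
    using u0 unfolding Linfty_on_def by (auto simp: AE_lebesgue_on_iff)
  define M where "M = max 0 (max M1 M2)"
  have M: "0 \<le> M" "M1 \<le> M" "M2 \<le> M" by (auto simp: M_def)
  have uM: "AE z in lebesgue. z \<in> H \<longrightarrow> \<bar>case_prod u z\<bar> \<le> M"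
    using M1 H M(2) by (auto simp: AE_lebesgue_on_iff elim!: eventually_mono)
  have good: "AE \<tau> in lborel. 0 < \<tau> \<longrightarrow> (AE x in lebesgue. \<bar>u x \<tau>\<bar> \<le> M)"
    using AE_lebesgue_slices[OF uM]
  proof eventually_elim
    case (elim \<tau>)
    show ?case
    proof
      assume "0 < \<tau>"
      then have "AE x in lborel. \<bar>u x \<tau>\<bar> \<le> M" using elim by (auto simp: H_def)
      then show "AE x in lebesgue. \<bar>u x \<tau>\<bar> \<le> M" by (rule AE_completion)
    qed
  qed
  have uMt: "AE x in lebesgue. \<bar>u x t\<bar> \<le> M" if "0 < t" for t
    by (rule slice_AE_bound[OF _ cont good M(1) that]) (rule sl)
  \<comment> \<open>The slot \<open>t = 0\<close> stores the initial data, so that they can be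
    treated like the other slices.\<close>
  define v where "v x t = clip M (if 0 < t then u x t else u0 x)" for x t
  have vu: "AE x in lebesgue. v x t = u x t" if "0 < t" for t
    using uMt[OF that] by eventually_elim (use that in \<open>simp add: v_def clip_id\<close>)
  have v0: "AE x in lebesgue. v x 0 = u0 x"
    using M2 by eventually_elim (use M in \<open>simp add: v_def clip_id\<close>)
  have slm: "(\<lambda>x. u x t) \<in> borel_measurable lebesgue" if "0 < t" for t
    using sl[OF that] by (simp add: Linfty_on_def lebesgue_on_UNIV_eq)
  have u0m: "u0 \<in> borel_measurable lebesgue" using u0 by (simp add: Linfty_on_def lebesgue_on_UNIV_eq)
  have vb: "bdd_meas M (\<lambda>x. v x t)" for t
    unfolding bdd_meas_def v_def using slm u0m clip_bound[OF M(1)]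
    by (cases "0 < t") (auto intro: clip_measurable)
  have fcont: "continuous_on UNIV f"
    using DERIV_isCont[OF fd] by (simp add: continuous_at_imp_continuous_on)
  obtain L where L: "\<And>y. y \<in> {-M..M} \<Longrightarrow> \<bar>f' y\<bar> \<le> L"
    by (rule continuous_on_Icc_bound[OF continuous_on_subset[OF f'c subset_UNIV]]) blast
  have flip: "\<bar>f a - f b\<bar> \<le> L * \<bar>a - b\<bar>" if "\<bar>a\<bar> \<le> M" "\<bar>b\<bar> \<le> M" for a b
  proof -
    have "norm (f a - f b) \<le> L * norm (a - b)"
      by (rule field_differentiable_bound[of "{-M..M}" f f' L])
         (use that L fd in \<open>auto intro: has_field_derivative_at_within\<close>)
    then show ?thesis by simp
  qed
  have tc: "((\<lambda>\<tau>. integral {-R..R} (\<lambda>x. \<bar>v x \<tau> - v x t\<bar>)) \<longlongrightarrow> 0) (at t)" if t: "0 < t" and R: "0 < R" for t R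
  proof -
    have lim: "((\<lambda>\<tau>. integral\<^sup>L (lebesgue_on {-R..R}) (\<lambda>x. \<bar>u x \<tau> - u x t\<bar>)) \<longlongrightarrow> 0) (at t)"
      using cont t R unfolding L1loc_time_continuous_def by blast
    have "\<forall>\<^sub>F \<tau> in at t. \<tau> \<in> {0<..}" using t by (intro eventually_at_in_open') auto
    then have ev: "\<forall>\<^sub>F \<tau> in at t. integral\<^sup>L (lebesgue_on {-R..R}) (\<lambda>x. \<bar>u x \<tau> - u x t\<bar>) = integral {-R..R} (\<lambda>x. \<bar>v x \<tau> - v x t\<bar>)"
    proof (rule eventually_mono)
      fix \<tau> :: real assume \<tau>: "\<tau> \<in> {0<..}"
      have b: "bdd_meas (M + M) (\<lambda>x. \<bar>v x \<tau> - v x t\<bar>)" by (intro bdd_meas_abs_diff vb)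
      have um': "(\<lambda>x. u x \<sigma>) \<in> borel_measurable (lebesgue_on {-R..R})" if "0 < \<sigma>" for \<sigma>
        using slm[OF that] by (rule measurable_restrict_space1)
      have vm': "(\<lambda>x. v x \<sigma>) \<in> borel_measurable (lebesgue_on {-R..R})" for \<sigma>
        using vb[of \<sigma>] unfolding bdd_meas_def by (auto intro: measurable_restrict_space1)
      have "AE x in lebesgue_on {-R..R}. \<bar>u x \<tau> - u x t\<bar> = \<bar>v x \<tau> - v x t\<bar>"
        using vu[OF t] vu[of \<tau>] \<tau> by (subst AE_lebesgue_on_iff) (auto elim: eventually_elim2)
      then have "integral\<^sup>L (lebesgue_on {-R..R}) (\<lambda>x. \<bar>u x \<tau> - u x t\<bar>) = integral\<^sup>L (lebesgue_on {-R..R}) (\<lambda>x. \<bar>v x \<tau> - v x t\<bar>)"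
        using um' vm' t \<tau> by (intro integral_cong_AE) auto
      also have "\<dots> = integral {-R..R} (\<lambda>x. \<bar>v x \<tau> - v x t\<bar>)" by (rule integral_lebesgue_on_Icc(2)[OF b])
      finally show "integral\<^sup>L (lebesgue_on {-R..R}) (\<lambda>x. \<bar>u x \<tau> - u x t\<bar>) = integral {-R..R} (\<lambda>x. \<bar>v x \<tau> - v x t\<bar>)" .
    qed
    show ?thesis by (rule Lim_transform_eventually[OF lim ev])
  qed
  interpret weak_slices f v M L
    by standard (use vb fcont flip tc in auto)
  have osl: "AE x in lebesgue. v (x + a) t - v x t \<le> E * a / t" if "0 < t" "0 < a" for t a
  proof -
    have "AE x in lebesgue. v (x + a) t = u (x + a) t"
      using vu[OF that(1)] by (rule AE_lebesgue_shift)
    with vu[OF that(1)] E(2)[OF that] show ?thesis by eventually_elim simp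
  qed
  have mom: "integral {-R..R} (\<lambda>x. v x t * e x) = integral {-R..R} (\<lambda>x. v x 0 * e x)
      + integral {0..t} (\<lambda>\<tau>. integral {-R..R} (\<lambda>x. f (v x \<tau>) * deriv e x))"
    if R: "0 < R" and e: "csmooth R e" and t: "0 \<le> t" for R e t
  proof (rule weak_moment[OF R e _ t])
    fix S \<kappa> assume S: "0 < S" and k: "csmooth S (\<kappa> :: real \<Rightarrow> real)"
    \<comment> \<open>Clipping makes the integrand of the weak formulation bounded everywhere, and
      \<open>F1\<close> extends it by zero from the half-plane, as the Fubini lemma requires. The
      unclipped \<open>F2\<close> below agrees with it almost everywhere.\<close>
    define F0 where "F0 z = clip M (case_prod u z) * (e (fst z) * deriv \<kappa> (snd z))
        + f (clip M (case_prod u z)) * (deriv e (fst z) * \<kappa> (snd z))" for z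
    define F1 where "F1 z = (if z \<in> H then F0 z else 0)" for z
    have e': "csmooth R (deriv e)" and k': "csmooth S (deriv \<kappa>)"
      using e k csmooth_deriv by auto
    have cc: "continuous_on UNIV (\<lambda>z::real \<times> real. g (fst z) * h (snd z))" if "csmooth R g" "csmooth S h" for g h
      by (intro continuous_on_mult continuous_on_compose2[OF csmooth_continuous[OF that(1), of UNIV]]
          continuous_on_compose2[OF csmooth_continuous[OF that(2), of UNIV]] continuous_intros) auto
    have ccm: "(\<lambda>z::real \<times> real. g (fst z) * h (snd z)) \<in> borel_measurable (lebesgue_on H)"
      if "csmooth R g" "csmooth S h" for g h
      by (rule continuous_imp_measurable_on_sets_lebesgue[OF continuous_on_subset[OF cc[OF that]] H]) simp
    have cm: "(\<lambda>z. clip M (case_prod u z)) \<in> borel_measurable (lebesgue_on H)"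
      using um by (intro clip_measurable) (simp add: case_prod_beta')
    have F0m: "F0 \<in> borel_measurable (lebesgue_on H)"
      unfolding F0_def
      by (intro borel_measurable_add borel_measurable_times[OF _ ccm[OF e k']]
          borel_measurable_times[OF _ ccm[OF e' k]] cm
          measurable_compose[OF cm borel_measurable_continuous_onI[OF fcont]])
    have F1m: "F1 \<in> borel_measurable lebesgue"
      unfolding F1_def using F0m H by (subst borel_measurable_if) auto
    obtain G1 where G1: "0 \<le> G1" "\<And>x. \<bar>e x\<bar> \<le> G1" by (rule csmooth_bounded[OF e]) blast
    obtain G2 where G2: "0 \<le> G2" "\<And>x. \<bar>deriv e x\<bar> \<le> G2" by (rule csmooth_bounded[OF e']) blast
    obtain G3 where G3: "0 \<le> G3" "\<And>x. \<bar>\<kappa> x\<bar> \<le> G3" by (rule csmooth_bounded[OF k]) blast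
    obtain G4 where G4: "0 \<le> G4" "\<And>x. \<bar>deriv \<kappa> x\<bar> \<le> G4" by (rule csmooth_bounded[OF k']) blast
    have eb: "e \<in> borel_measurable lebesgue"
      using borel_measurable_continuous_onI[OF csmooth_continuous[OF e]] by (intro measurable_completion) simp
    have em: "(\<lambda>x. e x * \<kappa> 0) \<in> borel_measurable lebesgue"
      by (intro borel_measurable_times eb borel_measurable_const)
    have F0b: "\<bar>F0 z\<bar> \<le> M * (G1 * G4) + F * (G2 * G3)" for z
      unfolding F0_def
    proof (intro order_trans[OF abs_triangle_ineq] add_mono)
      show "\<bar>clip M (case_prod u z) * (e (fst z) * deriv \<kappa> (snd z))\<bar> \<le> M * (G1 * G4)"
        unfolding abs_mult by (intro mult_mono clip_bound M G1 G4) (auto simp: G1 G4 M)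
      show "\<bar>f (clip M (case_prod u z)) * (deriv e (fst z) * \<kappa> (snd z))\<bar> \<le> F * (G2 * G3)"
        unfolding abs_mult by (intro mult_mono f_bound clip_bound M G2 G3) (auto simp: G2 G3 F_nonneg)
    qed
    have F1b: "\<bar>F1 z\<bar> \<le> M * (G1 * G4) + F * (G2 * G3)" for z
      using F0b[of z] unfolding F1_def by (auto intro: order_trans[OF abs_ge_zero])
    define Q where "Q = max R S"
    have F1s: "F1 (x, t) = 0" if "\<not> (\<bar>x\<bar> \<le> R \<and> \<bar>t\<bar> \<le> S)" for x t
      using that csmooth_zero[OF e, of x] csmooth_zero[OF e', of x] csmooth_zero[OF k, of t] csmooth_zero[OF k', of t]
      by (auto simp: F1_def F0_def)
    have "((\<lambda>t. integral {-Q..Q} (\<lambda>x. F1 (x, t))) has_integral integral\<^sup>L lebesgue F1) UNIV"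
      by (rule lebesgue_Fubini_has_integral[OF F1m F1b F1s]) (auto simp: Q_def)
    moreover have "integral {-Q..Q} (\<lambda>x. F1 (x, t)) = integral {-R..R} (\<lambda>x. F1 (x, t))" for t
    proof (rule integral_supset_eq)
      show "F1 (x, t) = 0" if "x \<in> {-Q..Q} - {-R..R}" for x
        using that by (intro F1s) auto
    qed (auto simp: Q_def)
    ultimately have hi: "((\<lambda>t. integral {-R..R} (\<lambda>x. F1 (x, t))) has_integral integral\<^sup>L lebesgue F1) UNIV" by simp
    have z: "integral {-R..R} (\<lambda>x. F1 (x, t)) = 0" if "t \<notin> {0..S}" for t
    proof -
      have "F1 (x, t) = 0" for x
        using that F1s[of x t] by (cases "t < 0") (auto simp: F1_def H_def)
      then show ?thesis by simp
    qed
    have "(\<lambda>t. integral {-R..R} (\<lambda>x. F1 (x, t))) =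
        (\<lambda>t. if t \<in> {0..S} then integral {-R..R} (\<lambda>x. F1 (x, t)) else 0)"
      using z by (auto simp: fun_eq_iff)
    with hi have hi2: "((\<lambda>t. integral {-R..R} (\<lambda>x. F1 (x, t))) has_integral integral\<^sup>L lebesgue F1) {0..S}"
      using has_integral_restrict_UNIV[of "{0..S}" "\<lambda>t. integral {-R..R} (\<lambda>x. F1 (x, t))"] by simp
    have val: "integral {-R..R} (\<lambda>x. F1 (x, t)) = integral {-R..R} (\<lambda>x. v x t * e x) * deriv \<kappa> t
          + integral {-R..R} (\<lambda>x. f (v x t) * deriv e x) * \<kappa> t" if "0 < t" for t
    proof -
      have "integral {-R..R} (\<lambda>x. F1 (x, t)) = integral {-R..R} (\<lambda>x. (v x t * e x) * deriv \<kappa> t + (f (v x t) * deriv e x) * \<kappa> t)"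
        using that by (simp add: F1_def F0_def H_def v_def algebra_simps)
      also have "\<dots> = integral {-R..R} (\<lambda>x. v x t * e x) * deriv \<kappa> t
          + integral {-R..R} (\<lambda>x. f (v x t) * deriv e x) * \<kappa> t"
        by (intro integral_unique has_integral_add has_integral_mult_left integrable_integral
            bdd_meas_mult_integrable[OF vb] bdd_meas_mult_integrable[OF flux_slice] csmooth_continuous[OF e] csmooth_continuous[OF e'])
           (use that in auto)
      finally show ?thesis .
    qed
    have "integral\<^sup>L lebesgue F1 = - (\<kappa> 0 * integral {-R..R} (\<lambda>x. v x 0 * e x))"
    proof -
      define \<phi> where "\<phi> x t = e x * \<kappa> t" for x t
      have tf: "test_function \<phi>" using test_function_product[OF e k] by (simp add: \<phi>_def[abs_def])
      have d1: "deriv (\<lambda>\<tau>. \<phi> x \<tau>) t = e x * deriv \<kappa> t" for x t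
        unfolding \<phi>_def by (intro DERIV_imp_deriv) (auto intro!: derivative_eq_intros csmooth_deriv(2)[OF k])
      have d2: "deriv (\<lambda>y. \<phi> y t) x = deriv e x * \<kappa> t" for x t
        unfolding \<phi>_def by (intro DERIV_imp_deriv) (auto intro!: derivative_eq_intros csmooth_deriv(2)[OF e])
      define F2 where "F2 z = case_prod u z * (e (fst z) * deriv \<kappa> (snd z)) + f (case_prod u z) * (deriv e (fst z) * \<kappa> (snd z))" for z
      have w: "integral\<^sup>L (lebesgue_on H) F2 + (\<integral>x. u0 x * \<phi> x 0 \<partial>lebesgue) = 0"
        using weak tf unfolding weak_solution_def H_def F2_def by (auto simp: d1 d2 case_prod_beta')
      have F2m: "F2 \<in> borel_measurable (lebesgue_on H)"
        unfolding F2_def using um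
        by (intro borel_measurable_add borel_measurable_times[OF _ ccm[OF e k']]
            borel_measurable_times[OF _ ccm[OF e' k]] 
            measurable_compose[OF _ borel_measurable_continuous_onI[OF fcont]]) (auto simp: case_prod_beta')
      have "AE z in lebesgue_on H. F2 z = F0 z"
        unfolding AE_lebesgue_on_iff[OF H] using uM
        by eventually_elim (auto simp: F2_def F0_def clip_id)
      then have "integral\<^sup>L (lebesgue_on H) F2 = integral\<^sup>L (lebesgue_on H) F0"
        by (intro integral_cong_AE F2m F0m)
      also have "\<dots> = integral\<^sup>L lebesgue F1"
        using H by (subst integral_restrict_space) (auto simp: F1_def indicator_def intro!: Bochner_Integration.integral_cong)
      finally have A: "integral\<^sup>L (lebesgue_on H) F2 = integral\<^sup>L lebesgue F1" .
      have "(\<integral>x. u0 x * \<phi> x 0 \<partial>lebesgue) = (\<integral>x. indicator {-R..R} x *\<^sub>R (v x 0 * (e x * \<kappa> 0)) \<partial>lebesgue)"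
      proof (rule integral_cong_AE)
        show "AE x in lebesgue. u0 x * \<phi> x 0 = indicator {-R..R} x *\<^sub>R (v x 0 * (e x * \<kappa> 0))"
          using v0
        proof eventually_elim
          case (elim x)
          then show ?case using csmooth_zero[OF e, of x] by (cases "R < \<bar>x\<bar>") (auto simp: \<phi>_def indicator_def)
        qed
        show "(\<lambda>x. u0 x * \<phi> x 0) \<in> borel_measurable lebesgue"
          unfolding \<phi>_def by (intro borel_measurable_times u0m em)
        show "(\<lambda>x. indicator {-R..R} x *\<^sub>R (v x 0 * (e x * \<kappa> 0))) \<in> borel_measurable lebesgue"
          using vb[of 0] em eb unfolding bdd_meas_def
          by (intro borel_measurable_scaleR borel_measurable_indicator borel_measurable_times) auto
      qed
      also have "\<dots> = integral\<^sup>L (lebesgue_on {-R..R}) (\<lambda>x. v x 0 * (e x * \<kappa> 0))"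
        by (subst integral_restrict_space) auto
      also have "\<dots> = integral {-R..R} (\<lambda>x. v x 0 * (e x * \<kappa> 0))"
      proof (rule integral_lebesgue_on_Icc(2)[where K = "M * (G1 * G3)"], unfold bdd_meas_def, intro conjI allI)
        show "(\<lambda>x. v x 0 * (e x * \<kappa> 0)) \<in> borel_measurable lebesgue"
          using vb[of 0] unfolding bdd_meas_def
          by (intro borel_measurable_times[OF _ em]) auto
        show "\<bar>v x 0 * (e x * \<kappa> 0)\<bar> \<le> M * (G1 * G3)" for x
          unfolding abs_mult by (intro mult_mono v_bound G1 G3) (auto simp: G1 G3 M)
      qed
      also have "\<dots> = integral {-R..R} (\<lambda>x. \<kappa> 0 * (v x 0 * e x))" by (simp add: algebra_simps)
      also have "\<dots> = \<kappa> 0 * integral {-R..R} (\<lambda>x. v x 0 * e x)" by simp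
      finally show ?thesis using A w by simp
    qed
    with hi2 have "((\<lambda>t. integral {-R..R} (\<lambda>x. F1 (x, t))) has_integral - (\<kappa> 0 * integral {-R..R} (\<lambda>x. v x 0 * e x))) {0..S}"
      by simp
    then show "((\<lambda>t. integral {-R..R} (\<lambda>x. v x t * e x) * deriv \<kappa> t
          + integral {-R..R} (\<lambda>x. f (v x t) * deriv e x) * \<kappa> t)
        has_integral - (\<kappa> 0 * integral {-R..R} (\<lambda>x. v x 0 * e x))) {0..S}"
      by (rule has_integral_spike[of "{0}", rotated 2]) (use val in auto)
  qed
  show ?thesis
    by (rule that[OF weak_slices_axioms E(1) vu v0 osl mom])
qed

section \<open>The potential of an entropy solution\<close>

text \<open>Replace \<open>g\<close> by \<open>min g h\<close>: this changes it only on a null set,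
  hence not its integral, and makes the inequality hold everywhere.\<close>

lemma integral_mono_lebesgue_AE:
  fixes g h :: "real \<Rightarrow> real"
  assumes g: "g integrable_on S" and h: "h integrable_on S"
    and ae: "AE x in lebesgue. x \<in> S \<longrightarrow> g x \<le> h x"
  shows "integral S g \<le> integral S h"
proof -
  have "AE x in lborel. x \<in> S \<longrightarrow> g x = min (g x) (h x)"
    using ae unfolding AE_completion_iff by eventually_elim auto
  from has_integral_AE[OF this]
  have "((\<lambda>x. min (g x) (h x)) has_integral integral S g) S"
    using g by (auto simp: has_integral_integral)
  then show ?thesis
    using h by (intro has_integral_le[of _ "integral S g" S h]) (auto simp: has_integral_integral)
qed

text \<open>In the assumption the null set depends on \<open>a\<close>. For a Borel representative
  the set of good pairs is measurable, so Fubini exchanges the quantifiers: for almost every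
  \<open>x\<close>, the bound holds for almost every \<open>a\<close>, hence for almost every
  \<open>y = x + a\<close>. A second exchange gives the other order.\<close>

lemma one_sided_pairs:
  fixes w :: "real \<Rightarrow> real"
  assumes w: "w \<in> borel_measurable lebesgue"
    and osl: "\<And>a. 0 < a \<Longrightarrow> AE x in lebesgue. w (x + a) - w x \<le> C * a"
  shows "AE x in lebesgue. AE y in lebesgue. x < y \<longrightarrow> w y - w x \<le> C * (y - x)"
    and "AE y in lebesgue. AE x in lebesgue. x < y \<longrightarrow> w y - w x \<le> C * (y - x)"
proof -
  obtain g where g: "g \<in> borel_measurable lborel" "AE x in lborel. w x = g x"
    using completion_ex_borel_measurable_real[OF w] by blast
  have wg: "AE x in lebesgue. w x = g x" using g(2) by (rule AE_completion)
  define P where "P x a \<longleftrightarrow> (0 < a \<longrightarrow> g (x + a) - g x \<le> C * a)" for x a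
  define Q where "Q x y \<longleftrightarrow> (x < y \<longrightarrow> g y - g x \<le> C * (y - x))" for x y
  have gm [measurable]: "g \<in> borel_measurable borel" using g(1) by simp
  have Pa: "AE x in lborel. P x a" for a
  proof (cases "0 < a")
    case True
    have "AE x in lebesgue. w (x + a) = g (x + a)" using wg by (rule AE_lebesgue_shift)
    with wg osl[OF True] have "AE x in lebesgue. P x a" unfolding P_def by eventually_elim auto
    then show ?thesis by (simp add: AE_completion_iff)
  qed (simp add: P_def)
  have "{z \<in> space (lborel \<Otimes>\<^sub>M lborel). P (fst z) (snd z)} \<in> sets (lborel \<Otimes>\<^sub>M lborel)"
    unfolding P_def by measurable
  then have "AE x in lborel. AE a in lborel. P x a"
    using Pa by (subst lborel_pair.AE_commute) auto
  then have Q1: "AE x in lborel. AE y in lborel. Q x y"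
  proof eventually_elim
    case (elim x)
    have "AE a in lebesgue. P x (a + - x)" by (rule AE_lebesgue_shift[OF AE_completion[OF elim]])
    then show ?case unfolding AE_completion_iff by eventually_elim (auto simp: P_def Q_def)
  qed
  have "{z \<in> space (lborel \<Otimes>\<^sub>M lborel). Q (fst z) (snd z)} \<in> sets (lborel \<Otimes>\<^sub>M lborel)"
    unfolding Q_def by measurable
  then have Q2: "AE y in lborel. AE x in lborel. Q x y"
    using Q1 by (subst (asm) lborel_pair.AE_commute) auto
  show "AE x in lebesgue. AE y in lebesgue. x < y \<longrightarrow> w y - w x \<le> C * (y - x)"
    using wg AE_completion[OF Q1]
  proof eventually_elim
    case (elim x)
    show ?case using wg AE_completion[OF elim(2)] by eventually_elim (use elim(1) in \<open>auto simp: Q_def\<close>)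
  qed
  show "AE y in lebesgue. AE x in lebesgue. x < y \<longrightarrow> w y - w x \<le> C * (y - x)"
    using wg AE_completion[OF Q2]
  proof eventually_elim
    case (elim x)
    show ?case using wg AE_completion[OF elim(2)] by eventually_elim (use elim(1) in \<open>auto simp: Q_def\<close>)
  qed
qed

text \<open>Integrate the inequality for pairs over \<open>y\<close> in the interval of length
  \<open>l\<close> to the right, respectively to the left, of the fixed point.\<close>

lemma one_sided_average:
  assumes w: "bdd_meas K w" and osl: "\<And>a. 0 < a \<Longrightarrow> AE x in lebesgue. w (x + a) - w x \<le> C * a"
    and "0 \<le> C" "0 < l"
  shows "AE x in lebesgue. integral {x..x + l} w \<le> l * (w x + C * l)"
    and "AE x in lebesgue. l * (w x - C * l) \<le> integral {x - l..x} w"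
proof -
  have wm: "w \<in> borel_measurable lebesgue" using w by (simp add: bdd_meas_def)
  have pt: "AE x in lebesgue. x \<noteq> c" for c :: real
    by (rule AE_completion) (rule AE_lborel_singleton)
  have pairs: "AE x in lebesgue. AE y in lebesgue. x < y \<longrightarrow> w y - w x \<le> C * (y - x)"
    "AE y in lebesgue. AE x in lebesgue. x < y \<longrightarrow> w y - w x \<le> C * (y - x)"
    by (rule one_sided_pairs[OF wm], rule osl, assumption)+
  show "AE x in lebesgue. integral {x..x + l} w \<le> l * (w x + C * l)"
    using pairs(1)
  proof eventually_elim
    case (elim x)
    have "integral {x..x + l} w \<le> integral {x..x + l} (\<lambda>_. w x + C * l)"
    proof (rule integral_mono_lebesgue_AE[OF bdd_meas_integrable[OF w]])
      show "AE y in lebesgue. y \<in> {x..x + l} \<longrightarrow> w y \<le> w x + C * l"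
        using elim pt[of x]
      proof eventually_elim
        case (elim y)
        have "C * (y - x) \<le> C * l" if "y \<in> {x..x + l}"
          using that assms(3) by (intro mult_left_mono) auto
        then show ?case using elim by force
      qed
    qed (intro integrable_continuous_real continuous_on_const)
    then show ?case using assms(4) by simp
  qed
  show "AE x in lebesgue. l * (w x - C * l) \<le> integral {x - l..x} w"
    using pairs(2)
  proof eventually_elim
    case (elim x)
    have "integral {x - l..x} (\<lambda>_. w x - C * l) \<le> integral {x - l..x} w"
    proof (rule integral_mono_lebesgue_AE[OF _ bdd_meas_integrable[OF w]])
      show "AE y in lebesgue. y \<in> {x - l..x} \<longrightarrow> w x - C * l \<le> w y"
        using elim pt[of x]
      proof eventually_elim
        case (elim y)
        have "C * (x - y) \<le> C * l" if "y \<in> {x - l..x}"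
          using that assms(3) by (intro mult_left_mono) auto
        then show ?case using elim by force
      qed
    qed (intro integrable_continuous_real continuous_on_const)
    then show ?case using assms(4) by simp
  qed
qed

section \<open>Convex fluxes and subsolutions\<close>

locale convex_flux =
  fixes f f' f'' :: "real \<Rightarrow> real"
  assumes f': "\<And>x. (f has_real_derivative f' x) (at x)"
    and f'': "\<And>x. (f' has_real_derivative f'' x) (at x)"
    and f''_cont: "continuous_on UNIV f''"
    and f''_pos: "\<And>x. 0 < f'' x"
begin

lemma f'_cont: "continuous_on S f'"
  using DERIV_isCont[OF f''] by (simp add: continuous_at_imp_continuous_on)

lemma f_cont': "continuous_on S f"
  using DERIV_isCont[OF f'] by (simp add: continuous_at_imp_continuous_on)

lemma f'_strict: "a < b \<Longrightarrow> f' a < f' b"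
  using DERIV_pos_imp_increasing[of a b f'] f'' f''_pos by blast

lemma f'_mono: "a \<le> b \<Longrightarrow> f' a \<le> f' b"
  using f'_strict[of a b] by (cases "a = b") auto

lemma f_mvt: obtains \<xi> where "min a b \<le> \<xi>" "\<xi> \<le> max a b" "f a - f b = f' \<xi> * (a - b)"
proof (cases a b rule: linorder_cases)
  case less
  obtain z where "a < z" "z < b" "f b - f a = (b - a) * f' z" using MVT2[OF less, of f f'] f' by blast
  then show ?thesis by (intro that[of z]) (auto simp: algebra_simps)
next
  case greater
  obtain z where "b < z" "z < a" "f a - f b = (a - b) * f' z" using MVT2[OF greater, of f f'] f' by blast
  then show ?thesis by (intro that[of z]) (auto simp: algebra_simps)
qed (use that[of a] in simp)

lemma tangent: "f m + f' m * (a - m) \<le> f a"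
proof -
  obtain \<xi> where x: "min a m \<le> \<xi>" "\<xi> \<le> max a m" "f a - f m = f' \<xi> * (a - m)" by (rule f_mvt)
  have "f' m * (a - m) \<le> f' \<xi> * (a - m)"
  proof (cases "m \<le> a")
    case True
    then show ?thesis using x by (intro mult_right_mono f'_mono) auto
  next
    case False
    then show ?thesis using x by (intro mult_right_mono_neg f'_mono) auto
  qed
  then show ?thesis using x by linarith
qed

text \<open>Subsolutions of the Hamilton--Jacobi equation \<open>V\<^sub>t + f(V\<^sub>x) = 0\<close>, stated through the Legendre
  transform of \<open>f\<close>, whose value at \<open>f' m\<close> is \<open>m f' m - f m\<close>.\<close>

definition subsolution :: "(real \<Rightarrow> real \<Rightarrow> real) \<Rightarrow> bool" where
  "subsolution V \<longleftrightarrow> (\<forall>x t h m. 0 \<le> t \<longrightarrow> 0 \<le> h \<longrightarrow>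
     V (x + h * f' m) (t + h) \<le> V x t + h * (m * f' m - f m))"

text \<open>Planes solve the equation exactly, and the claim is the tangent inequality at
  \<open>m\<close> multiplied by \<open>h\<close>.\<close>

lemma subsolution_plane: "subsolution (\<lambda>x t. a * x - f a * t + c)"
  unfolding subsolution_def
proof (intro allI impI)
  fix x t h m :: real assume "0 \<le> h"
  have "h * (f m + f' m * (a - m)) \<le> h * f a" using tangent \<open>0 \<le> h\<close> by (intro mult_left_mono)
  then show "a * (x + h * f' m) - f a * (t + h) + c \<le> a * x - f a * t + c + h * (m * f' m - f m)"
    by (simp add: algebra_simps)
qed

lemma subsolutionD:
  "subsolution V \<Longrightarrow> 0 \<le> t \<Longrightarrow> 0 \<le> h \<Longrightarrow> V (x + h * f' m) (t + h) \<le> V x t + h * (m * f' m - f m)"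
  unfolding subsolution_def by blast

lemma subsolution_min:
  assumes "subsolution V" "subsolution W"
  shows "subsolution (\<lambda>x t. min (V x t) (W x t))"
  unfolding subsolution_def
proof (intro allI impI)
  fix x t h m :: real assume "0 \<le> t" "0 \<le> h"
  from subsolutionD[OF assms(1) this, of x m] subsolutionD[OF assms(2) this, of x m]
  show "min (V (x + h * f' m) (t + h)) (W (x + h * f' m) (t + h)) \<le> min (V x t) (W x t) + h * (m * f' m - f m)"
    by linarith
qed

lemma subsolution_add: "subsolution V \<Longrightarrow> subsolution (\<lambda>x t. V x t + c)"
  unfolding subsolution_def by (simp add: algebra_simps)

lemma subsolution_translate:
  assumes "subsolution V" shows "subsolution (\<lambda>x t. V (x + p) t + c)"
  unfolding subsolution_def
proof (intro allI impI)
  fix x t h m :: real assume "0 \<le> t" "0 \<le> h"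
  then show "V (x + h * f' m + p) (t + h) + c \<le> V (x + p) t + c + h * (m * f' m - f m)"
    using subsolutionD[OF assms, of t h "x + p" m] by (simp add: algebra_simps)
qed

end

section \<open>The potential and its Hamilton-Jacobi inequality\<close>

locale osl_solution = convex_flux f f' f'' + weak_slices f v M L
  for f f' f'' v M L +
  fixes E :: real
  assumes E: "0 < E"
    and osl: "\<And>t a. 0 < t \<Longrightarrow> 0 < a \<Longrightarrow> AE x in lebesgue. v (x + a) t - v x t \<le> E * a / t"
    and moment: "\<And>R e t. 0 < R \<Longrightarrow> csmooth R e \<Longrightarrow> 0 \<le> t \<Longrightarrow>
      integral {-R..R} (\<lambda>x. v x t * e x) = integral {-R..R} (\<lambda>x. v x 0 * e x)
      + integral {0..t} (\<lambda>\<tau>. integral {-R..R} (\<lambda>x. f (v x \<tau>) * deriv e x))"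
begin

definition \<rho> :: "real \<Rightarrow> real" where
  "\<rho> = (SOME \<rho>. csmooth 1 \<rho> \<and> integral {-1..1} \<rho> = 1)"

lemma \<rho>: "csmooth 1 \<rho>" "integral {-1..1} \<rho> = 1"
proof -
  have "\<exists>\<rho>. csmooth 1 \<rho> \<and> integral {-1..1} \<rho> = 1" by (rule csmooth_unit) blast
  then have "csmooth 1 \<rho> \<and> integral {-1..1} \<rho> = 1" unfolding \<rho>_def by (rule someI_ex)
  then show "csmooth 1 \<rho>" "integral {-1..1} \<rho> = 1" by auto
qed

definition U0 :: "real \<Rightarrow> real \<Rightarrow> real" where
  "U0 x t = prim (\<lambda>x. v x t) x"

text \<open>The function of time that has to be added to the primitive of \<open>u(\<cdot>, t)\<close> so that
  the equation for the potential holds when tested against \<open>\<rho>\<close>, and hence against all test functions.\<close>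

definition drift :: "real \<Rightarrow> real" where
  "drift t = integral {-1..1} (\<lambda>x. U0 x 0 * \<rho> x) - integral {-1..1} (\<lambda>x. U0 x t * \<rho> x)
     - integral {0..t} (\<lambda>\<tau>. integral {-1..1} (\<lambda>x. f (v x \<tau>) * \<rho> x))"

definition U :: "real \<Rightarrow> real \<Rightarrow> real" where
  "U x t = U0 x t + drift t"

lemma U_diff: "0 \<le> t \<Longrightarrow> x \<le> y \<Longrightarrow> U y t - U x t = integral {x..y} (\<lambda>x. v x t)"
  unfolding U_def U0_def by (simp add: prim_diff[OF bdd_meas_integrable[OF slice], of t x y])

lemma U0_diff: "0 \<le> t \<Longrightarrow> x \<le> y \<Longrightarrow> U0 y t - U0 x t = integral {x..y} (\<lambda>x. v x t)"
  unfolding U0_def by (simp add: prim_diff[OF bdd_meas_integrable[OF slice], of t x y])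

lemma U_initial: "U x 0 = prim (\<lambda>x. v x 0) x"
  by (simp add: U_def drift_def U0_def)

lemma U_lip: assumes "0 \<le> t" shows "\<bar>U x t - U y t\<bar> \<le> M * \<bar>x - y\<bar>"
proof -
  have *: "\<bar>U y t - U x t\<bar> \<le> M * (y - x)" if "x \<le> y" for x y
    unfolding U_diff[OF assms that] using v_bound[OF assms] that
    by (intro integral_bound_linear bdd_meas_integrable[OF slice] assms) auto
  show ?thesis using *[of x y] *[of y x] by (cases "x \<le> y") (auto simp: abs_minus_commute)
qed

lemma U_cont: "0 \<le> t \<Longrightarrow> continuous_on S (\<lambda>x. U x t)"
  by (rule lipschitz_on_continuous_on[where L = M], rule lipschitz_onI)
     (use U_lip M_nonneg in \<open>auto simp: dist_real_def\<close>)

lemma U0_cont: "0 \<le> t \<Longrightarrow> continuous_on S (\<lambda>x. U0 x t)"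
  using continuous_on_diff[OF U_cont continuous_on_const[of S "drift t"], of t] by (simp add: U_def)

lemma slice_by_parts:
  assumes t: "0 \<le> t" and g: "csmooth R g" and "R < S" "0 \<le> S"
  shows "integral {-S..S} (\<lambda>x. v x t * g x) = - integral {-S..S} (\<lambda>x. U0 x t * deriv g x)"
    and "integral {-S..S} (\<lambda>x. v x t * g x) = - integral {-S..S} (\<lambda>x. U x t * deriv g x)"
proof -
  have z: "g S = 0" "g (- S) = 0" using assms by (auto intro!: csmooth_zero[OF g])
  have c: "continuous_on UNIV (deriv g)" using csmooth_deriv(1)[OF g] csmooth_continuous by blast
  have "integral {-S..S} (\<lambda>x. v x t * g x)
      = U0 S t * g S - U0 (- S) t * g (- S) - integral {-S..S} (\<lambda>x. U0 x t * deriv g x)"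
    by (rule integration_by_parts_ae[OF slice[OF t]])
       (use assms c in \<open>auto intro: U0_diff[OF t] csmooth_deriv(2)[OF g]\<close>)
  then show "integral {-S..S} (\<lambda>x. v x t * g x) = - integral {-S..S} (\<lambda>x. U0 x t * deriv g x)"
    using z by simp
  have "integral {-S..S} (\<lambda>x. v x t * g x)
      = U S t * g S - U (- S) t * g (- S) - integral {-S..S} (\<lambda>x. U x t * deriv g x)"
    by (rule integration_by_parts_ae[OF slice[OF t]])
       (use assms c in \<open>auto intro: U_diff[OF t] csmooth_deriv(2)[OF g]\<close>)
  then show "integral {-S..S} (\<lambda>x. v x t * g x) = - integral {-S..S} (\<lambda>x. U x t * deriv g x)"
    using z by simp
qed

text \<open>Split \<open>g = h + c \<rho>\<close> with \<open>c\<close> the integral of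
  \<open>g\<close>. As \<open>h\<close> has mean zero, it is the derivative of a compactly supported
  \<open>e\<close>, and the moment identity for \<open>e\<close> combined with integration by parts
  settles this part. The multiple of \<rho> is what \<open>drift\<close> was built for.\<close>

lemma U_tested_initial:
  assumes R: "0 < R" and g: "csmooth R g" and t: "0 \<le> t"
  shows "integral {-R..R} (\<lambda>x. U x t * g x) = integral {-R..R} (\<lambda>x. U x 0 * g x)
    - integral {0..t} (\<lambda>\<tau>. integral {-R..R} (\<lambda>x. f (v x \<tau>) * g x))"
proof -
  \<comment> \<open>Both supports lie in \<open>{-(S-1)..S-1}\<close>, so all boundary terms at
    \<open>S\<close> and \<open>-S\<close> vanish.\<close>
  define S where "S = max R 1 + 1"
  have S: "0 < S" "R \<le> S - 1" "1 \<le> S - 1" "0 < S - 1" using R by (auto simp: S_def)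
  define c where "c = integral {-S..S} g"
  have g1: "csmooth (S - 1) g" and \<rho>1: "csmooth (S - 1) \<rho>"
    using csmooth_mono[OF g] csmooth_mono[OF \<rho>(1)] S by auto
  have cg: "continuous_on X g" and c\<rho>: "continuous_on X \<rho>" for X using g \<rho>(1) csmooth_continuous by blast+
  have exg: "integral {-S..S} (\<lambda>x. k x * g x) = integral {-R..R} (\<lambda>x. k x * g x)" for k
    by (rule integral_supset_eq) (use S csmooth_zero[OF g] in auto)
  have ex\<rho>: "integral {-S..S} (\<lambda>x. k x * \<rho> x) = integral {-1..1} (\<lambda>x. k x * \<rho> x)" for k
    by (rule integral_supset_eq) (use S csmooth_zero[OF \<rho>(1)] in auto)
  have \<rho>S: "integral {-S..S} \<rho> = 1" using ex\<rho>[of "\<lambda>_. 1"] \<rho>(2) by simp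
  define h where "h x = 1 * g x + (- c) * \<rho> x" for x
  have h: "csmooth (S - 1) h" unfolding h_def by (intro csmooth_lin g1 \<rho>1)
  have lin: "integral {-S..S} (\<lambda>x. k x * h x) = integral {-R..R} (\<lambda>x. k x * g x) - c * integral {-1..1} (\<lambda>x. k x * \<rho> x)"
    if "(\<lambda>x. k x * g x) integrable_on {-S..S}" "(\<lambda>x. k x * \<rho> x) integrable_on {-S..S}" for k
  proof -
    have "((\<lambda>x. k x * g x - c * (k x * \<rho> x)) has_integral
        (integral {-S..S} (\<lambda>x. k x * g x) - c * integral {-S..S} (\<lambda>x. k x * \<rho> x))) {-S..S}"
      using that by (intro has_integral_diff has_integral_mult_right integrable_integral)
    moreover have "(\<lambda>x. k x * g x - c * (k x * \<rho> x)) = (\<lambda>x. k x * h x)" by (auto simp: h_def algebra_simps)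
    ultimately show ?thesis using exg ex\<rho> by (simp add: integral_unique)
  qed
  have "integral {-(S-1)..S-1} h = integral {-S..S} (\<lambda>x. 1 * h x)"
    using S csmooth_zero[OF h] by (auto intro!: integral_supset_eq[symmetric])
  also have "\<dots> = integral {-R..R} (\<lambda>x. 1 * g x) - c * integral {-1..1} (\<lambda>x. 1 * \<rho> x)"
    by (rule lin) (auto intro!: integrable_continuous_real cg c\<rho>)
  also have "\<dots> = 0" using exg[of "\<lambda>_. 1"] \<rho>(2) by (simp add: c_def)
  finally obtain e where e: "csmooth (S - 1) e" "\<And>x. (e has_real_derivative h x) (at x)"
    using csmooth_antideriv[OF h] S by blast
  have de: "deriv e = h" using e(2) by (auto intro: DERIV_imp_deriv)
  have parts: "integral {-S..S} (\<lambda>x. v x t * e x) = - integral {-S..S} (\<lambda>x. U0 x t * h x)" if "0 \<le> t" for t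
    using slice_by_parts(1)[OF that e(1), of S] S by (simp add: de)
  have flux: "integral {-S..S} (\<lambda>x. f (v x \<tau>) * h x)
      = integral {-R..R} (\<lambda>x. f (v x \<tau>) * g x) - c * integral {-1..1} (\<lambda>x. f (v x \<tau>) * \<rho> x)" if "0 \<le> \<tau>" for \<tau>
    using that by (intro lin bdd_meas_mult_integrable[OF flux_slice] cg c\<rho>)
  have UU: "integral {-S..S} (\<lambda>x. U0 x \<tau> * h x)
      = integral {-R..R} (\<lambda>x. U0 x \<tau> * g x) - c * integral {-1..1} (\<lambda>x. U0 x \<tau> * \<rho> x)" if "0 \<le> \<tau>" for \<tau>
    using that by (intro lin integrable_continuous_real continuous_on_mult U0_cont cg c\<rho>)
  have "integral {0..t} (\<lambda>\<tau>. integral {-S..S} (\<lambda>x. f (v x \<tau>) * h x))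
      = integral {0..t} (\<lambda>\<tau>. integral {-R..R} (\<lambda>x. f (v x \<tau>) * g x) - c * integral {-1..1} (\<lambda>x. f (v x \<tau>) * \<rho> x))"
    by (rule Henstock_Kurzweil_Integration.integral_cong) (use flux in auto)
  also have "\<dots> = integral {0..t} (\<lambda>\<tau>. integral {-R..R} (\<lambda>x. f (v x \<tau>) * g x))
      - c * integral {0..t} (\<lambda>\<tau>. integral {-1..1} (\<lambda>x. f (v x \<tau>) * \<rho> x))"
    by (intro integral_unique has_integral_diff has_integral_mult_right integrable_integral
        flux_moment_integrable cg c\<rho>) (use R in auto)
  finally have "- integral {-S..S} (\<lambda>x. U0 x t * h x) = - integral {-S..S} (\<lambda>x. U0 x 0 * h x)
      + (integral {0..t} (\<lambda>\<tau>. integral {-R..R} (\<lambda>x. f (v x \<tau>) * g x))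
      - c * integral {0..t} (\<lambda>\<tau>. integral {-1..1} (\<lambda>x. f (v x \<tau>) * \<rho> x)))"
    using moment[OF S(1) csmooth_mono[OF e(1), of S] t] parts[OF t] parts[of 0] by (simp add: de)
  then have key: "integral {-R..R} (\<lambda>x. U0 x t * g x) + c * drift t = integral {-R..R} (\<lambda>x. U0 x 0 * g x)
      - integral {0..t} (\<lambda>\<tau>. integral {-R..R} (\<lambda>x. f (v x \<tau>) * g x))"
    unfolding UU[OF t] UU[OF order_refl] drift_def by (simp add: algebra_simps)
  have "integral {-R..R} (\<lambda>x. U x t * g x) = integral {-R..R} (\<lambda>x. U0 x t * g x + drift t * g x)"
    by (simp add: U_def algebra_simps)
  also have "\<dots> = integral {-R..R} (\<lambda>x. U0 x t * g x) + drift t * integral {-R..R} g"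
    by (intro integral_unique has_integral_add has_integral_mult_right integrable_integral
        integrable_continuous_real continuous_on_mult U0_cont cg t)
  also have "integral {-R..R} g = c" using exg[of "\<lambda>_. 1"] by (simp add: c_def)
  finally have "integral {-R..R} (\<lambda>x. U x t * g x) = integral {-R..R} (\<lambda>x. U0 x t * g x) + drift t * c" .
  moreover have "U x 0 = U0 x 0" for x by (simp add: U_def drift_def)
  ultimately show ?thesis using key by (simp only: mult.commute[of c])
qed

lemma U_tested:
  assumes R: "0 < R" and g: "csmooth R g" and st: "0 \<le> s" "s \<le> t"
  shows "integral {-R..R} (\<lambda>x. (U x t - U x s) * g x)
    = - integral {s..t} (\<lambda>\<tau>. integral {-R..R} (\<lambda>x. f (v x \<tau>) * g x))"
proof -
  have t: "0 \<le> t" using st by simp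
  have cg: "continuous_on X g" for X using g csmooth_continuous by blast
  have "integral {-R..R} (\<lambda>x. (U x t - U x s) * g x) = integral {-R..R} (\<lambda>x. U x t * g x - U x s * g x)"
    by (simp add: algebra_simps)
  also have "\<dots> = integral {-R..R} (\<lambda>x. U x t * g x) - integral {-R..R} (\<lambda>x. U x s * g x)"
    by (intro integral_unique has_integral_diff integrable_integral
        integrable_continuous_real continuous_on_mult U_cont cg t st(1))
  also have "\<dots> = integral {0..s} (\<lambda>\<tau>. integral {-R..R} (\<lambda>x. f (v x \<tau>) * g x))
      - integral {0..t} (\<lambda>\<tau>. integral {-R..R} (\<lambda>x. f (v x \<tau>) * g x))"
    using U_tested_initial[OF R g t] U_tested_initial[OF R g st(1)] by linarith
  also have "\<dots> = - integral {s..t} (\<lambda>\<tau>. integral {-R..R} (\<lambda>x. f (v x \<tau>) * g x))"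
    using Henstock_Kurzweil_Integration.integral_combine[OF st
        flux_moment_integrable[OF cg R order_refl]] by simp
  finally show ?thesis .
qed

text \<open>Test the equation \<open>U_t = - f(v)\<close> against a bump, use the bound at each
  time, and remove the bump by localization. As \<Psi> does not depend on time, the time integral
  only contributes the factor \<open>t - s\<close>. Taking \<open>k = 1\<close> bounds the decrease
  of \<open>U\<close>, and \<open>k = -1\<close> its increase.\<close>

lemma flux_bound:
  assumes st: "0 \<le> s" "s \<le> t" and \<Psi>: "continuous_on UNIV \<Psi>"
    and le: "\<And>\<tau>. s < \<tau> \<Longrightarrow> \<tau> \<le> t \<Longrightarrow> AE x in lebesgue. k * f (v x \<tau>) \<le> \<Psi> x"
  shows "0 \<le> k * (U x t - U x s) + (t - s) * \<Psi> x"
proof (rule localize_nonneg[OF zero_less_one, where \<psi> = "\<lambda>x. k * (U x t - U x s) + (t - s) * \<Psi> x"])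
    show "continuous_on {x - 1<..<x + 1} (\<lambda>x. k * (U x t - U x s) + (t - s) * \<Psi> x)"
      using st by (intro continuous_intros U_cont continuous_on_subset[OF \<Psi>]) auto
    fix r b assume r: "0 < r" and b: "csmooth (\<bar>x\<bar> + r) b" "\<And>x. 0 \<le> b x" "\<And>y. r \<le> \<bar>y - x\<bar> \<Longrightarrow> b y = 0"
    define R where "R = \<bar>x\<bar> + r"
    have R: "0 < R" "csmooth R b" using r b by (auto simp: R_def)
    have cb: "continuous_on X b" for X using b(1) csmooth_continuous by blast
    have c\<Psi>: "continuous_on X \<Psi>" for X using \<Psi> continuous_on_subset by blast
    have "integral {s..t} (\<lambda>\<tau>. k * integral {-R..R} (\<lambda>x. f (v x \<tau>) * b x)) \<le> integral {s..t} (\<lambda>_. integral {-R..R} (\<lambda>x. \<Psi> x * b x))"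
    proof (rule integral_mono_lebesgue_AE)
      show "(\<lambda>\<tau>. k * integral {-R..R} (\<lambda>x. f (v x \<tau>) * b x)) integrable_on {s..t}"
        by (intro integrable_on_mult_right flux_moment_integrable cb R st)
      have "AE \<tau> in lebesgue. \<tau> \<noteq> s" by (rule AE_completion) (rule AE_lborel_singleton)
      then show "AE \<tau> in lebesgue. \<tau> \<in> {s..t} \<longrightarrow> k * integral {-R..R} (\<lambda>x. f (v x \<tau>) * b x) \<le> integral {-R..R} (\<lambda>x. \<Psi> x * b x)"
      proof eventually_elim
        case (elim \<tau>)
        show ?case
        proof
          assume \<tau>: "\<tau> \<in> {s..t}"
          then have a: "AE x in lebesgue. k * f (v x \<tau>) \<le> \<Psi> x" using elim by (intro le) auto
          have "integral {-R..R} (\<lambda>x. k * (f (v x \<tau>) * b x)) \<le> integral {-R..R} (\<lambda>x. \<Psi> x * b x)"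
          proof (rule integral_mono_lebesgue_AE)
            show "(\<lambda>x. k * (f (v x \<tau>) * b x)) integrable_on {-R..R}"
              using st \<tau> by (intro integrable_on_mult_right bdd_meas_mult_integrable[OF flux_slice] cb) auto
            show "(\<lambda>x. \<Psi> x * b x) integrable_on {-R..R}"
              by (intro integrable_continuous_real continuous_on_mult cb c\<Psi>)
            show "AE x in lebesgue. x \<in> {-R..R} \<longrightarrow> k * (f (v x \<tau>) * b x) \<le> \<Psi> x * b x"
              using a by eventually_elim (use b(2) in \<open>auto intro: mult_right_mono simp: mult.assoc[symmetric]\<close>)
          qed
          then show "k * integral {-R..R} (\<lambda>x. f (v x \<tau>) * b x) \<le> integral {-R..R} (\<lambda>x. \<Psi> x * b x)"
            by simp
        qed
      qed
    qed (intro integrable_continuous_real continuous_on_const)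
    then have flux: "k * integral {s..t} (\<lambda>\<tau>. integral {-R..R} (\<lambda>x. f (v x \<tau>) * b x)) \<le> (t - s) * integral {-R..R} (\<lambda>x. \<Psi> x * b x)"
      using st by simp
    have "integral {x - r..x + r} (\<lambda>x. (k * (U x t - U x s) + (t - s) * \<Psi> x) * b x)
        = integral {-R..R} (\<lambda>x. (k * (U x t - U x s) + (t - s) * \<Psi> x) * b x)"
      using b(3) by (intro integral_supset_eq[symmetric]) (auto simp: R_def)
    also have "\<dots> = integral {-R..R} (\<lambda>x. k * ((U x t - U x s) * b x) + (t - s) * (\<Psi> x * b x))"
      by (simp add: algebra_simps)
    also have "\<dots> = k * integral {-R..R} (\<lambda>x. (U x t - U x s) * b x) + (t - s) * integral {-R..R} (\<lambda>x. \<Psi> x * b x)"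
      by (intro integral_unique has_integral_add has_integral_mult_right integrable_integral
        integrable_continuous_real continuous_on_mult continuous_on_diff U_cont cb c\<Psi> order_trans[OF st] st(1))
    also have "\<dots> \<ge> 0" using U_tested[OF R st] flux by simp
    finally show "0 \<le> integral {x - r..x + r} (\<lambda>x. (k * (U x t - U x s) + (t - s) * \<Psi> x) * b x)" .
  qed


lemma U_time_lip:
  assumes "0 \<le> s" "0 \<le> t"
  shows "\<bar>U x t - U x s\<bar> \<le> F * \<bar>t - s\<bar>"
proof -
  have "\<bar>U x t - U x s\<bar> \<le> F * (t - s)" if "0 \<le> s" "s \<le> t" for s t
  proof -
    have b: "\<bar>f (v x \<tau>)\<bar> \<le> F" if "s < \<tau>" for x \<tau>
      using that \<open>0 \<le> s\<close> by (intro f_bound v_bound) auto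
    have "0 \<le> 1 * (U x t - U x s) + (t - s) * F"
      by (rule flux_bound[OF that continuous_on_const]) (use b in \<open>auto simp: abs_le_iff\<close>)
    moreover have "0 \<le> (-1) * (U x t - U x s) + (t - s) * F"
      by (rule flux_bound[OF that continuous_on_const]) (use b in \<open>auto simp: abs_le_iff minus_le_iff\<close>)
    ultimately show ?thesis by (simp add: abs_le_iff algebra_simps)
  qed
  from this[of s t] this[of t s] assms show ?thesis
    by (cases "s \<le> t") (auto simp: abs_minus_commute)
qed

text \<open>Let the bump move with speed \<open>w = f' m\<close>. Formally the derivative of the
  moving integral is the integral of \<open>w v - f(v)\<close> against the bump, and the tangent
  inequality bounds this integrand by \<open>m w - f m\<close>. Differentiability is avoided by
  estimating increments up to second order.\<close>

lemma U_tested_translate: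
  assumes R: "0 < R" and b: "csmooth R b" "\<And>x. 0 \<le> b x" and t: "0 \<le> t" and h: "0 \<le> h"
    and S: "R + \<bar>f' m\<bar> * h < S"
  shows "integral {-S..S} (\<lambda>z. U z (t + h) * b (z - h * f' m))
    \<le> integral {-S..S} (\<lambda>z. U z t * b z) + h * (m * f' m - f m) * integral {-S..S} b"
proof -
  define w where "w = f' m"
  define \<phi> where "\<phi> \<sigma> = integral {-S..S} (\<lambda>z. U z (t + \<sigma>) * b (z - \<sigma> * w))" for \<sigma>
  define B where "B = integral {-S..S} b"
  have S0: "0 < S" using R S h by (smt (verit) mult_nonneg_nonneg abs_ge_zero)
  have cb: "continuous_on X b" and cb': "continuous_on X (deriv b)" for X
    using b csmooth_deriv csmooth_continuous by blast+
  have shift_cont: "continuous_on X (\<lambda>z. b (z - c))" "continuous_on X (\<lambda>z. deriv b (z - c))" for X c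
    by (intro continuous_on_compose2[OF cb[of UNIV]] continuous_on_compose2[OF cb'[of UNIV]] continuous_intros; simp)+
  obtain C1 where C1: "0 \<le> C1" "\<And>x. \<bar>deriv b x\<bar> \<le> C1"
    by (rule csmooth_bounded[OF csmooth_deriv(1)[OF b(1)]]) blast
  obtain C2 where C2: "0 \<le> C2" "\<And>x. \<bar>deriv (deriv b) x\<bar> \<le> C2"
    by (rule csmooth_bounded[OF csmooth_deriv(1)[OF csmooth_deriv(1)[OF b(1)]]]) blast
  have b'lip: "\<bar>deriv b x - deriv b y\<bar> \<le> C2 * \<bar>x - y\<bar>" for x y
    using field_differentiable_bound[of UNIV "deriv b" "deriv (deriv b)" C2 x y]
      csmooth_deriv(2)[OF csmooth_deriv(1)[OF b(1)]] C2 by auto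
  \<comment> \<open>Second order accuracy for the translation of the bump; it comes from the
    Lipschitz bound \<open>C2\<close> on its derivative.\<close>
  have taylor: "\<bar>b (q + d) - b q - d * deriv b q\<bar> \<le> C2 * d\<^sup>2" for q d
  proof -
    have "norm (b (q + d) - q * 0 - d * deriv b q - (b q - 0)) \<le> C2 * \<bar>d\<bar> * norm (q + d - q)"
    proof -
      have "norm ((\<lambda>x. b x - (x - q) * deriv b q) (q + d) - (\<lambda>x. b x - (x - q) * deriv b q) q)
          \<le> C2 * \<bar>d\<bar> * norm (q + d - q)"
      proof (rule field_differentiable_bound[of "{min q (q + d)..max q (q + d)}" _ "\<lambda>x. deriv b x - deriv b q"])
        show "((\<lambda>x. b x - (x - q) * deriv b q) has_field_derivative deriv b z - deriv b q)
            (at z within {min q (q + d)..max q (q + d)})" for z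
          by (auto intro!: derivative_eq_intros has_field_derivative_at_within[OF csmooth_deriv(2)[OF b(1)]])
        show "norm (deriv b z - deriv b q) \<le> C2 * \<bar>d\<bar>" if "z \<in> {min q (q + d)..max q (q + d)}" for z
        proof -
          have "C2 * \<bar>z - q\<bar> \<le> C2 * \<bar>d\<bar>" using that C2(1) by (intro mult_left_mono) auto
          then show ?thesis using b'lip[of z q] by simp
        qed
      qed auto
      then show ?thesis by simp
    qed
    then show ?thesis by (simp add: power2_eq_square mult.assoc algebra_simps)
  qed
  obtain CU where CU: "0 \<le> CU" "\<And>z \<sigma>. z \<in> {-S..S} \<Longrightarrow> 0 \<le> \<sigma> \<Longrightarrow> \<sigma> \<le> h \<Longrightarrow> \<bar>U z (t + \<sigma>)\<bar> \<le> CU"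
  proof
    show "0 \<le> \<bar>U 0 t\<bar> + M * S + F * h" using M_nonneg F_nonneg S0 h by simp
    fix z \<sigma> assume z: "z \<in> {-S..S}" and \<sigma>: "0 \<le> \<sigma>" "\<sigma> \<le> h"
    have "\<bar>U z (t + \<sigma>) - U z t\<bar> \<le> F * \<bar>(t + \<sigma>) - t\<bar>" using t \<sigma> by (intro U_time_lip) auto
    moreover have "F * \<bar>(t + \<sigma>) - t\<bar> \<le> F * h" using \<sigma> F_nonneg by (intro mult_left_mono) auto
    moreover have "M * \<bar>z - 0\<bar> \<le> M * S" using z M_nonneg by (intro mult_left_mono) auto
    moreover have "\<bar>U z t - U 0 t\<bar> \<le> M * \<bar>z - 0\<bar>" by (rule U_lip[OF t])
    ultimately show "\<bar>U z (t + \<sigma>)\<bar> \<le> \<bar>U 0 t\<bar> + M * S + F * h" by linarith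
  qed
  \<comment> \<open>The first summand pays for replacing \<open>U\<close> at intermediate times by
    \<open>U\<close> at the beginning of the step, the second for the Taylor remainder of the
    translated bump.\<close>
  define C where "C = \<bar>w\<bar> * (F * C1 * (2 * S)) + CU * (C2 * w\<^sup>2) * (2 * S)"
  have "\<phi> h - \<phi> 0 \<le> ((m * w - f m) * B) * (h - 0)"
  proof (rule increment_le_linear[OF h, where C = C])
    fix \<sigma>1 \<sigma>2 assume \<sigma>: "0 \<le> \<sigma>1" "\<sigma>1 \<le> \<sigma>2" "\<sigma>2 \<le> h"
    define \<eta> where "\<eta> = \<sigma>2 - \<sigma>1"
    have \<eta>: "0 \<le> \<eta>" using \<sigma> by (simp add: \<eta>_def)
    define b2 where "b2 z = b (z - \<sigma>2 * w)" for z
    define T where "T = R + \<bar>\<sigma>2 * w\<bar>"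
    have TS: "T < S" "0 < T"
    proof -
      have "\<bar>\<sigma>2 * w\<bar> \<le> \<bar>w\<bar> * h"
        unfolding abs_mult using \<sigma> by (subst mult.commute) (intro mult_left_mono, auto)
      then show "T < S" using S by (simp add: T_def w_def)
      show "0 < T" using R by (simp add: T_def add_pos_nonneg)
    qed
    have b2: "csmooth T b2" unfolding b2_def T_def by (rule csmooth_shift[OF b(1)])
    have b2S: "csmooth S b2" using csmooth_mono[OF b2] TS by simp
    have cb2: "continuous_on X b2" for X using b2 csmooth_continuous by blast
    have db2: "deriv b2 z = deriv b (z - \<sigma>2 * w)" for z
      unfolding b2_def
      by (rule DERIV_imp_deriv) (use csmooth_deriv(2)[OF b(1), of "z - \<sigma>2 * w"] DERIV_shift[of b _ z "- (\<sigma>2 * w)"] in simp)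
    have cdb2: "continuous_on X (deriv b2)" for X unfolding db2[abs_def] by (rule shift_cont)
    have B2: "integral {-S..S} b2 = B"
    proof -
      have a: "\<bar>\<sigma>2 * w\<bar> < S - R" using TS by (simp add: T_def)
      have "integral {-S..S} b2 = integral {-R + \<sigma>2 * w..R + \<sigma>2 * w} b2"
        using a by (intro integral_supset_eq) (auto simp: b2_def intro!: csmooth_zero[OF b(1)])
      also have "\<dots> = integral {-R..R} b"
        using integral_shift_real_ivl[of "-R" "- (\<sigma>2 * w)" R b] by (simp add: b2_def[abs_def])
      also have "\<dots> = B" unfolding B_def
        using a csmooth_zero[OF b(1)] by (intro integral_supset_eq[symmetric]) auto
      finally show ?thesis .
    qed
    define s1 where "s1 = t + \<sigma>1"
    have s1: "0 \<le> s1" using t \<sigma> by (simp add: s1_def)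
    \<comment> \<open>The first order terms with \<open>w * J\<close> enter \<open>first\<close> and
      \<open>second\<close> with opposite signs and cancel; \<open>J\<close> is frozen at the
      initial time of the step for this purpose.\<close>
    define J where "J = integral {-S..S} (\<lambda>z. U z s1 * deriv b2 z)"
    have iU: "(\<lambda>z. U z s * g z) integrable_on {-S..S}" if "0 \<le> s" "continuous_on {-S..S} g" for s g
      using that by (intro integrable_continuous_real continuous_on_mult U_cont)
    have first: "integral {-S..S} (\<lambda>z. (U z (t + \<sigma>2) - U z s1) * b2 z)
        \<le> \<eta> * ((m * w - f m) * B + w * J + \<bar>w\<bar> * (F * C1 * (2 * S)) * \<eta>)"
    proof -
      let ?k = "(f m - w * m) * B - w * J - \<bar>w\<bar> * (F * C1 * (2 * S)) * \<eta>"
      have lower: "?k \<le> integral {-S..S} (\<lambda>x. f (v x \<tau>) * b2 x)" if \<tau>: "\<tau> \<in> {s1..t + \<sigma>2}" for \<tau>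
      proof -
        have \<tau>0: "0 \<le> \<tau>" using \<tau> s1 by simp
        have iv: "(\<lambda>x. v x \<tau> * b2 x) integrable_on {-S..S}" by (rule bdd_meas_mult_integrable[OF slice[OF \<tau>0] cb2])
        have ib: "b2 integrable_on {-S..S}" by (rule integrable_continuous_real[OF cb2])
        have "(f m - w * m) * B + w * integral {-S..S} (\<lambda>x. v x \<tau> * b2 x)
            = integral {-S..S} (\<lambda>x. (f m - w * m) * b2 x + w * (v x \<tau> * b2 x))"
          unfolding B2[symmetric]
          by (intro integral_unique[symmetric] has_integral_add has_integral_mult_right integrable_integral iv ib)
        also have "\<dots> \<le> integral {-S..S} (\<lambda>x. f (v x \<tau>) * b2 x)"
        proof (rule integral_le)
          show "(\<lambda>x. (f m - w * m) * b2 x + w * (v x \<tau> * b2 x)) integrable_on {-S..S}"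
            by (intro integrable_add integrable_on_mult_right iv ib)
          show "(\<lambda>x. f (v x \<tau>) * b2 x) integrable_on {-S..S}"
            by (rule bdd_meas_mult_integrable[OF flux_slice[OF \<tau>0] cb2])
          fix x
          have "(f m + w * (v x \<tau> - m)) * b2 x \<le> f (v x \<tau>) * b2 x"
            unfolding w_def b2_def by (intro mult_right_mono tangent b(2))
          then show "(f m - w * m) * b2 x + w * (v x \<tau> * b2 x) \<le> f (v x \<tau>) * b2 x"
            by (simp add: algebra_simps)
        qed
        finally have A: "(f m - w * m) * B + w * integral {-S..S} (\<lambda>x. v x \<tau> * b2 x) \<le> integral {-S..S} (\<lambda>x. f (v x \<tau>) * b2 x)" .
        have P: "integral {-S..S} (\<lambda>x. v x \<tau> * b2 x) = - integral {-S..S} (\<lambda>x. U x \<tau> * deriv b2 x)"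
          using slice_by_parts(2)[OF \<tau>0 b2 TS(1)] S0 by simp
        have "\<bar>integral {-S..S} (\<lambda>x. (U x \<tau> - U x s1) * deriv b2 x)\<bar> \<le> (F * \<eta> * C1) * (S - - S)"
        proof (rule integral_bound_linear)
          show "(\<lambda>x. (U x \<tau> - U x s1) * deriv b2 x) integrable_on {-S..S}"
            using \<tau>0 s1 by (intro integrable_continuous_real continuous_on_mult continuous_on_diff U_cont cdb2)
          fix x
          have "\<bar>U x \<tau> - U x s1\<bar> \<le> F * \<bar>\<tau> - s1\<bar>" by (rule U_time_lip[OF s1 \<tau>0])
          also have "\<dots> \<le> F * \<eta>" using \<tau> F_nonneg by (intro mult_left_mono) (auto simp: \<eta>_def s1_def)
          finally show "\<bar>(U x \<tau> - U x s1) * deriv b2 x\<bar> \<le> F * \<eta> * C1"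
            unfolding abs_mult db2 using C1 F_nonneg \<eta> by (intro mult_mono) auto
        qed (use S0 in auto)
        moreover have "integral {-S..S} (\<lambda>x. (U x \<tau> - U x s1) * deriv b2 x) = integral {-S..S} (\<lambda>x. U x \<tau> * deriv b2 x) - J"
          unfolding J_def left_diff_distrib using \<tau>0 s1 by (intro Henstock_Kurzweil_Integration.integral_diff iU cdb2)
        ultimately have "\<bar>integral {-S..S} (\<lambda>x. U x \<tau> * deriv b2 x) - J\<bar> \<le> F * C1 * (2 * S) * \<eta>"
          by (simp add: algebra_simps)
        then have "\<bar>w\<bar> * \<bar>integral {-S..S} (\<lambda>x. U x \<tau> * deriv b2 x) - J\<bar> \<le> \<bar>w\<bar> * (F * C1 * (2 * S) * \<eta>)"
          by (intro mult_left_mono) auto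
        then have "w * (integral {-S..S} (\<lambda>x. U x \<tau> * deriv b2 x) - J) \<le> \<bar>w\<bar> * (F * C1 * (2 * S) * \<eta>)"
          unfolding abs_mult[symmetric] by linarith
        then show ?thesis using A unfolding P by (simp add: algebra_simps)
      qed
      have "integral {s1..t + \<sigma>2} (\<lambda>_. ?k) \<le> integral {s1..t + \<sigma>2} (\<lambda>\<tau>. integral {-S..S} (\<lambda>x. f (v x \<tau>) * b2 x))"
        by (rule integral_le) (use lower in \<open>auto intro!: flux_moment_integrable cb2 S0 s1\<close>)
      moreover have "t + \<sigma>2 - s1 = \<eta>" "s1 \<le> t + \<sigma>2" using \<sigma> by (auto simp: s1_def \<eta>_def)
      ultimately have "\<eta> * ?k \<le> integral {s1..t + \<sigma>2} (\<lambda>\<tau>. integral {-S..S} (\<lambda>x. f (v x \<tau>) * b2 x))" by simp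
      moreover have "integral {-S..S} (\<lambda>z. (U z (t + \<sigma>2) - U z s1) * b2 z)
          = - integral {s1..t + \<sigma>2} (\<lambda>\<tau>. integral {-S..S} (\<lambda>x. f (v x \<tau>) * b2 x))"
        by (rule U_tested[OF S0 b2S s1]) (use \<sigma> in \<open>simp add: s1_def\<close>)
      ultimately show ?thesis by (simp add: algebra_simps)
    qed
    have second: "integral {-S..S} (\<lambda>z. U z s1 * (b2 z - b (z - \<sigma>1 * w))) \<le> - \<eta> * w * J + CU * (C2 * w\<^sup>2) * (2 * S) * \<eta>\<^sup>2"
    proof -
      have "\<bar>integral {-S..S} (\<lambda>z. U z s1 * (b2 z - b (z - \<sigma>1 * w) + \<eta> * w * deriv b2 z))\<bar> \<le> (CU * (C2 * (\<eta> * w)\<^sup>2)) * (S - - S)"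
      proof (rule integral_bound_linear)
        show "(\<lambda>z. U z s1 * (b2 z - b (z - \<sigma>1 * w) + \<eta> * w * deriv b2 z)) integrable_on {-S..S}"
          by (intro iU s1 continuous_intros cb2 cdb2 shift_cont)
        fix z assume z: "z \<in> {-S..S}"
        have "\<bar>b2 z - b (z - \<sigma>1 * w) + \<eta> * w * deriv b2 z\<bar> \<le> C2 * (\<eta> * w)\<^sup>2"
          using taylor[of "z - \<sigma>2 * w" "\<eta> * w"] unfolding db2 b2_def \<eta>_def by (simp add: algebra_simps)
        then show "\<bar>U z s1 * (b2 z - b (z - \<sigma>1 * w) + \<eta> * w * deriv b2 z)\<bar> \<le> CU * (C2 * (\<eta> * w)\<^sup>2)"
          unfolding abs_mult using CU(2)[OF z \<sigma>(1)] \<sigma> CU(1) by (intro mult_mono) (auto simp: s1_def)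
      qed (use S0 in auto)
      moreover have "integral {-S..S} (\<lambda>z. U z s1 * (b2 z - b (z - \<sigma>1 * w) + \<eta> * w * deriv b2 z))
          = integral {-S..S} (\<lambda>z. U z s1 * (b2 z - b (z - \<sigma>1 * w))) + \<eta> * w * J"
      proof -
        have "integral {-S..S} (\<lambda>z. U z s1 * (b2 z - b (z - \<sigma>1 * w) + \<eta> * w * deriv b2 z))
          = integral {-S..S} (\<lambda>z. U z s1 * (b2 z - b (z - \<sigma>1 * w)) + \<eta> * w * (U z s1 * deriv b2 z))"
          by (simp add: algebra_simps)
        also have "\<dots> = integral {-S..S} (\<lambda>z. U z s1 * (b2 z - b (z - \<sigma>1 * w))) + \<eta> * w * J"
          unfolding J_def by (intro integral_unique has_integral_add has_integral_mult_right integrable_integral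
              iU s1 continuous_on_diff cb2 cdb2 shift_cont)
        finally show ?thesis .
      qed
      ultimately show ?thesis by (simp add: algebra_simps power_mult_distrib)
    qed
    have "\<phi> \<sigma>2 - \<phi> \<sigma>1 = integral {-S..S} (\<lambda>z. U z (t + \<sigma>2) * b2 z - U z s1 * b (z - \<sigma>1 * w))"
      unfolding \<phi>_def b2_def s1_def using t \<sigma>
      by (intro Henstock_Kurzweil_Integration.integral_diff[symmetric] iU shift_cont) auto
    also have "\<dots> = integral {-S..S} (\<lambda>z. (U z (t + \<sigma>2) - U z s1) * b2 z + U z s1 * (b2 z - b (z - \<sigma>1 * w)))"
      by (simp add: algebra_simps)
    also have "\<dots> = integral {-S..S} (\<lambda>z. (U z (t + \<sigma>2) - U z s1) * b2 z)
        + integral {-S..S} (\<lambda>z. U z s1 * (b2 z - b (z - \<sigma>1 * w)))"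
      using s1 t \<sigma>
      by (intro Henstock_Kurzweil_Integration.integral_add iU integrable_continuous_real continuous_on_mult
          continuous_on_diff U_cont cb2 shift_cont) auto
    also have "\<dots> \<le> ((m * w - f m) * B) * \<eta> + C * \<eta>\<^sup>2"
      using add_mono[OF first second] by (simp add: C_def algebra_simps power2_eq_square)
    finally show "\<phi> \<sigma>2 - \<phi> \<sigma>1 \<le> ((m * w - f m) * B) * (\<sigma>2 - \<sigma>1) + C * (\<sigma>2 - \<sigma>1)\<^sup>2"
      by (simp add: \<eta>_def)
  qed
  then show ?thesis by (simp add: \<phi>_def w_def B_def algebra_simps)
qed

text \<open>The bump is removed from \<open>U_tested_translate\<close> by localization, after a
  change of variables that moves the translation from the bump to \<open>U\<close>.\<close>

lemma U_subsolution: "subsolution U"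
  unfolding subsolution_def
proof (intro allI impI)
  fix x t h m :: real assume t: "0 \<le> t" and h: "0 \<le> h"
  define c where "c = m * f' m - f m"
  define w where "w = h * f' m"
  have cU: "continuous_on X (\<lambda>z. U (z + w) (t + h))" for X
    using t h by (intro continuous_on_compose2[OF U_cont[of "t + h" UNIV]] continuous_intros) auto
  have "0 \<le> U x t + h * c - U (x + w) (t + h)"
  proof (rule localize_nonneg[OF zero_less_one, where \<psi> = "\<lambda>z. U z t + h * c - U (z + w) (t + h)"])
    show "continuous_on {x - 1<..<x + 1} (\<lambda>z. U z t + h * c - U (z + w) (t + h))"
      by (intro continuous_intros U_cont t cU)
    fix r b assume r: "0 < r" and b: "csmooth (\<bar>x\<bar> + r) b" "\<And>x. 0 \<le> b x" "\<And>y. r \<le> \<bar>y - x\<bar> \<Longrightarrow> b y = 0"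
    define R where "R = \<bar>x\<bar> + r"
    have R: "0 < R" "csmooth R b" using r b by (auto simp: R_def)
    have cb: "continuous_on X b" for X using b(1) csmooth_continuous by blast
    define S where "S = R + \<bar>w\<bar> + 1"
    have S: "R + \<bar>f' m\<bar> * h < S" using h by (simp add: S_def w_def abs_mult mult.commute)
    have ex: "integral {-S..S} (\<lambda>z. k z * b z) = integral {x - r..x + r} (\<lambda>z. k z * b z)" for k
      by (rule integral_supset_eq) (use b(3) in \<open>auto simp: S_def R_def abs_if split: if_splits\<close>)
    have "integral {-S..S} (\<lambda>z. U z (t + h) * b (z - w)) = integral {x - r + w..x + r + w} (\<lambda>z. U z (t + h) * b (z - w))"
      by (rule integral_supset_eq) (use b(3) in \<open>auto simp: S_def R_def abs_if split: if_splits\<close>)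
    also have "\<dots> = integral {x - r..x + r} (\<lambda>z. U (z + w) (t + h) * b z)"
      using integral_shift_real_ivl[of "x - r + w" w "x + r + w" "\<lambda>z. U z (t + h) * b (z - w)"] by simp
    finally have eq: "integral {-S..S} (\<lambda>z. U z (t + h) * b (z - w)) = integral {x - r..x + r} (\<lambda>z. U (z + w) (t + h) * b z)" .
    have main: "integral {x - r..x + r} (\<lambda>z. U (z + w) (t + h) * b z)
        \<le> integral {x - r..x + r} (\<lambda>z. U z t * b z) + h * c * integral {x - r..x + r} b"
      using U_tested_translate[OF R b(2) t h S] eq ex[of "\<lambda>z. U z t"] ex[of "\<lambda>_. 1"] by (simp add: w_def c_def)
    have "integral {x - r..x + r} (\<lambda>z. (U z t + h * c - U (z + w) (t + h)) * b z)
        = integral {x - r..x + r} (\<lambda>z. U z t * b z + h * c * b z - U (z + w) (t + h) * b z)"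
      by (simp add: algebra_simps)
    also have "\<dots> = integral {x - r..x + r} (\<lambda>z. U z t * b z) + h * c * integral {x - r..x + r} b
        - integral {x - r..x + r} (\<lambda>z. U (z + w) (t + h) * b z)"
      by (intro integral_unique has_integral_add has_integral_diff has_integral_mult_right integrable_integral
          integrable_continuous_real continuous_on_mult U_cont cb cU t)
    finally show "0 \<le> integral {x - r..x + r} (\<lambda>z. (U z t + h * c - U (z + w) (t + h)) * b z)"
      using main by simp
  qed
  then show "U (x + h * f' m) (t + h) \<le> U x t + h * (m * f' m - f m)" by (simp add: c_def w_def)
qed

end

section \<open>Averages of the slices and the comparison principle\<close>

context osl_solution
begin

text \<open>The average of \<open>v\<close> over \<open>{x..x + l}\<close>, written through the
  potential so that it is continuous in \<open>x\<close> and Lipschitz in time.\<close>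

definition slope :: "real \<Rightarrow> real \<Rightarrow> real \<Rightarrow> real" where
  "slope l x t = (U (x + l) t - U x t) / l"

lemma slope_cont: "0 \<le> t \<Longrightarrow> continuous_on S (\<lambda>x. slope l x t)"
  unfolding slope_def divide_inverse
  by (intro continuous_intros continuous_on_compose2[OF U_cont[of t UNIV]] U_cont) auto

lemma slope_shift_cont: "0 \<le> t \<Longrightarrow> continuous_on S (\<lambda>x. slope l (x + c) t)"
  by (intro continuous_on_compose2[OF slope_cont[of t UNIV]] continuous_intros) auto

lemma slope_abs: assumes "0 \<le> t" "0 < l" shows "\<bar>slope l x t\<bar> \<le> M"
  using U_lip[OF assms(1), of "x + l" x] assms by (simp add: slope_def abs_div pos_divide_le_eq)

text \<open>An upper bound on increments makes \<open>v\<close>, up to \<open>E l / t\<close>, at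
  least its average to the right and at most its average to the left. This is the only way in which
  pointwise values of \<open>v\<close> are controlled.\<close>

lemma v_between_slopes:
  assumes "0 < t" "0 < l"
  shows "AE x in lebesgue. slope l x t - E * l / t \<le> v x t \<and> v x t \<le> slope l (x - l) t + E * l / t"
proof -
  have o: "AE x in lebesgue. v (x + a) t - v x t \<le> E / t * a" if "0 < a" for a
    using osl[OF assms(1) that] by simp
  have E0: "0 \<le> E / t" using E assms by simp
  have "AE x in lebesgue. integral {x..x + l} (\<lambda>x. v x t) \<le> l * (v x t + E / t * l)"
    by (rule one_sided_average(1)[OF slice o E0 assms(2)]) (use assms in auto)
  moreover have "AE x in lebesgue. l * (v x t - E / t * l) \<le> integral {x - l..x} (\<lambda>x. v x t)"
    by (rule one_sided_average(2)[OF slice o E0 assms(2)]) (use assms in auto)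
  ultimately show ?thesis
  proof eventually_elim
    case (elim x)
    have 1: "U (x + l) t - U x t = integral {x..x + l} (\<lambda>x. v x t)"
      using assms by (intro U_diff) auto
    have 2: "U x t - U (x - l) t = integral {x - l..x} (\<lambda>x. v x t)"
      using assms by (intro U_diff) auto
    have 3: "slope l x t \<le> v x t + E / t * l"
      using elim(1) assms(2) unfolding slope_def 1 by (simp add: pos_divide_le_eq mult.commute)
    have "v x t - E / t * l \<le> slope l (x - l) t"
      using elim(2) assms(2) 2 unfolding slope_def by (simp add: pos_le_divide_eq mult.commute)
    with 3 show ?case by simp
  qed
qed

text \<open>The averages inherit the one-sided bound, by integrating it over
  \<open>{x..x + l}\<close>; unlike the original it holds at every point.\<close>

lemma slope_increment:
  assumes t: "0 < t" and l: "0 < l" and xy: "x \<le> y"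
  shows "slope l y t - slope l x t \<le> E * (y - x) / t"
proof (cases "x = y")
  case False
  define a where "a = y - x"
  have a: "0 < a" "y = x + a" using xy False by (auto simp: a_def)
  have t0: "0 \<le> t" using t by simp
  have i: "(\<lambda>z. v z t) integrable_on {p..r}" for p r by (rule bdd_meas_integrable[OF slice[OF t0]])
  have sh: "((\<lambda>z. v (z + a) t) has_integral integral {x + a..x + a + l} (\<lambda>z. v z t)) {x..x + l}"
    using has_integral_shift_real_ivl[OF integrable_integral[OF i[of "x + a" "x + a + l"]], of a] by (simp add: algebra_simps)
  have "integral {x..x + l} (\<lambda>z. v (z + a) t) \<le> integral {x..x + l} (\<lambda>z. v z t + E * a / t)"
  proof (rule integral_mono_lebesgue_AE)
    show "(\<lambda>z. v (z + a) t) integrable_on {x..x + l}" using sh by blast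
    show "(\<lambda>z. v z t + E * a / t) integrable_on {x..x + l}"
      by (intro integrable_add i integrable_continuous_real continuous_on_const)
    show "AE z in lebesgue. z \<in> {x..x + l} \<longrightarrow> v (z + a) t \<le> v z t + E * a / t"
      using osl[OF t a(1)] by eventually_elim auto
  qed
  moreover have "integral {x..x + l} (\<lambda>z. v z t + E * a / t) = integral {x..x + l} (\<lambda>z. v z t) + l * (E * a / t)"
    using l by (subst Henstock_Kurzweil_Integration.integral_add)
      (auto intro!: i integrable_continuous_real)
  ultimately have "integral {x + a..x + a + l} (\<lambda>z. v z t) \<le> integral {x..x + l} (\<lambda>z. v z t) + l * (E * a / t)"
    using integral_unique[OF sh] by simp
  then have "U (y + l) t - U y t \<le> U (x + l) t - U x t + l * (E * a / t)"
    using U_diff[OF t0, of y "y + l"] U_diff[OF t0, of x "x + l"] l a by simp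
  then have "(U (y + l) t - U y t) / l \<le> (U (x + l) t - U x t + l * (E * a / t)) / l"
    using l by (intro divide_right_mono) auto
  then show ?thesis using l by (simp add: slope_def a_def add_divide_distrib)
qed simp

lemma slope_time:
  assumes "0 \<le> s" "0 \<le> t" "0 < l"
  shows "\<bar>slope l x t - slope l x s\<bar> \<le> 2 * F * \<bar>t - s\<bar> / l"
proof -
  have "slope l x t - slope l x s = ((U (x + l) t - U (x + l) s) - (U x t - U x s)) / l"
    by (simp add: slope_def diff_divide_distrib)
  moreover have "\<bar>(U (x + l) t - U (x + l) s) - (U x t - U x s)\<bar> \<le> 2 * F * \<bar>t - s\<bar>"
    using U_time_lip[OF assms(1,2), of x] U_time_lip[OF assms(1,2), of "x + l"] by linarith
  ultimately show ?thesis using assms(3) by (simp add: abs_div divide_right_mono)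
qed

text \<open>Moving left, \<open>slope\<close> drops by at most \<open>E z / t\<close>, and
  \<open>v\<close> lies at most \<open>E l / t\<close> below it. The one-sided estimate gives a
  lower bound to the left and, in \<open>slope_right\<close>, an upper bound to the right: the
  directions of backward steps with positive and negative speed.\<close>

lemma slope_left:
  assumes t: "0 < t" and l: "0 < l" and z: "0 \<le> z"
  shows "z * (slope l x t - E * (z + l) / t) \<le> U x t - U (x - z) t"
proof -
  have t0: "0 \<le> t" using t by simp
  have "integral {x - z..x} (\<lambda>_. slope l x t - E * (z + l) / t) \<le> integral {x - z..x} (\<lambda>y. v y t)"
  proof (rule integral_mono_lebesgue_AE)
    show "AE y in lebesgue. y \<in> {x - z..x} \<longrightarrow> slope l x t - E * (z + l) / t \<le> v y t"
      using v_between_slopes[OF t l]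
    proof eventually_elim
      case (elim y)
      show ?case
      proof
        assume y: "y \<in> {x - z..x}"
        have "slope l x t - slope l y t \<le> E * (x - y) / t" using y by (intro slope_increment t l) auto
        also have "\<dots> \<le> E * z / t" using y E t by (intro divide_right_mono mult_left_mono) auto
        finally show "slope l x t - E * (z + l) / t \<le> v y t"
          using elim by (simp add: distrib_left add_divide_distrib)
      qed
    qed
  qed (intro integrable_continuous_real continuous_on_const bdd_meas_integrable[OF slice[OF t0]])+
  then show ?thesis using U_diff[OF t0, of "x - z" x] z by simp
qed

lemma slope_right:
  assumes t: "0 < t" and l: "0 < l" and z: "0 \<le> z"
  shows "U (x + z) t - U x t \<le> z * (slope l (x - l) t + E * (z + l) / t)"
proof -
  have t0: "0 \<le> t" using t by simp
  have "integral {x..x + z} (\<lambda>y. v y t) \<le> integral {x..x + z} (\<lambda>_. slope l (x - l) t + E * (z + l) / t)"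
  proof (rule integral_mono_lebesgue_AE)
    show "AE y in lebesgue. y \<in> {x..x + z} \<longrightarrow> v y t \<le> slope l (x - l) t + E * (z + l) / t"
      using v_between_slopes[OF t l]
    proof eventually_elim
      case (elim y)
      show ?case
      proof
        assume y: "y \<in> {x..x + z}"
        have "slope l (y - l) t - slope l (x - l) t \<le> E * ((y - l) - (x - l)) / t" using y by (intro slope_increment t l) auto
        also have "\<dots> \<le> E * z / t" using y E t by (intro divide_right_mono mult_left_mono) auto
        finally show "v y t \<le> slope l (x - l) t + E * (z + l) / t"
          using elim by (simp add: distrib_left add_divide_distrib)
      qed
    qed
  qed (intro integrable_continuous_real continuous_on_const bdd_meas_integrable[OF slice[OF t0]])+
  then show ?thesis using U_diff[OF t0, of x "x + z"] z by simp
qed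

text \<open>A second average over \<open>{x..x + l}\<close>. It is differentiable, and its
  derivative is a difference quotient of \<open>slope\<close>, hence at most \<open>E / t\<close>;
  this makes it suitable as a transport state.\<close>

definition avg :: "real \<Rightarrow> real \<Rightarrow> real \<Rightarrow> real" where
  "avg l x t = (prim (\<lambda>y. slope l y t) (x + l) - prim (\<lambda>y. slope l y t) x) / l"

lemma avg_DERIV:
  assumes "0 \<le> t"
  shows "((\<lambda>x. avg l x t) has_real_derivative (slope l (x + l) t - slope l x t) / l) (at x)"
proof -
  have p: "(prim (\<lambda>y. slope l y t) has_real_derivative slope l z t) (at z)" for z
    by (rule prim_DERIV[OF slope_cont[OF assms]])
  have "((\<lambda>x. prim (\<lambda>y. slope l y t) (x + l)) has_real_derivative slope l (x + l) t) (at x)"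
    using p[of "x + l"] DERIV_shift[of "prim (\<lambda>y. slope l y t)" _ x l] by simp
  then show ?thesis unfolding avg_def divide_inverse using p[of x] by (auto intro!: derivative_eq_intros)
qed

lemma avg_cont: "0 \<le> t \<Longrightarrow> continuous_on S (\<lambda>x. avg l x t)"
  using DERIV_isCont[OF avg_DERIV] by (simp add: continuous_at_imp_continuous_on)

lemma avg_ge_le:
  assumes "0 \<le> t" "0 < l" "\<And>y. y \<in> {x..x + l} \<Longrightarrow> a \<le> slope l y t" "\<And>y. y \<in> {x..x + l} \<Longrightarrow> slope l y t \<le> b"
  shows "a \<le> avg l x t" "avg l x t \<le> b"
proof -
  have i: "(\<lambda>y. slope l y t) integrable_on {p..r}" for p r
    using assms(1) by (intro integrable_continuous_real slope_cont)
  have e: "prim (\<lambda>y. slope l y t) (x + l) - prim (\<lambda>y. slope l y t) x = integral {x..x + l} (\<lambda>y. slope l y t)"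
    using assms(2) by (intro prim_diff i) auto
  have "integral {x..x + l} (\<lambda>_. a) \<le> integral {x..x + l} (\<lambda>y. slope l y t)"
    by (rule integral_le) (use assms i in auto)
  then show "a \<le> avg l x t" unfolding avg_def e using assms(2) by (simp add: pos_le_divide_eq mult.commute)
  have "integral {x..x + l} (\<lambda>y. slope l y t) \<le> integral {x..x + l} (\<lambda>_. b)"
    by (rule integral_le) (use assms i in auto)
  then show "avg l x t \<le> b" unfolding avg_def e using assms(2) by (simp add: pos_divide_le_eq mult.commute)
qed

lemma avg_abs: assumes "0 \<le> t" "0 < l" shows "\<bar>avg l x t\<bar> \<le> M"
  using avg_ge_le[OF assms, of x "- M" M] slope_abs[OF assms] by (auto simp: abs_le_iff minus_le_iff)

lemma avg_between:
  assumes t: "0 < t" and l: "0 < l"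
  shows "slope l (x + l) t - E * l / t \<le> avg l x t" "avg l x t \<le> slope l x t + E * l / t"
proof -
  have lo: "slope l (x + l) t - E * l / t \<le> slope l y t" if "y \<in> {x..x + l}" for y
  proof -
    have "slope l (x + l) t - slope l y t \<le> E * (x + l - y) / t" using that by (intro slope_increment t l) auto
    also have "\<dots> \<le> E * l / t" using that E t by (intro divide_right_mono mult_left_mono) auto
    finally show ?thesis by simp
  qed
  have up: "slope l y t \<le> slope l x t + E * l / t" if "y \<in> {x..x + l}" for y
  proof -
    have "slope l y t - slope l x t \<le> E * (y - x) / t" using that by (intro slope_increment t l) auto
    also have "\<dots> \<le> E * l / t" using that E t by (intro divide_right_mono mult_left_mono) auto
    finally show ?thesis by simp
  qed
  show "slope l (x + l) t - E * l / t \<le> avg l x t" "avg l x t \<le> slope l x t + E * l / t"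
    using avg_ge_le[OF _ l lo up] t by auto
qed

text \<open>Up to an error of order \<open>l\<close>, the spread dominates the oscillation of \<open>u(\<cdot>, t)\<close> at scale \<open>l\<close>;
  its integral telescopes.\<close>

definition spread :: "real \<Rightarrow> real \<Rightarrow> real \<Rightarrow> real" where
  "spread l x t = slope l (x - l) t - slope l (x + l) t"

lemma spread_cont: "0 \<le> t \<Longrightarrow> continuous_on S (\<lambda>x. spread l x t)"
  unfolding spread_def using slope_shift_cont[of t S l "- l"] slope_shift_cont[of t S l l]
  by (intro continuous_on_diff) auto

lemma spread_ge: assumes "0 < t" "0 < l" shows "- (2 * E * l / t) \<le> spread l x t"
  using slope_increment[OF assms, of "x - l" "x + l"] assms(2) by (simp add: spread_def)

text \<open>After cancellation of the two translates only two windows of length \<open>2 l\<close>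
  remain, on which \<open>slope\<close> is bounded by \<open>M\<close>.\<close>

lemma integral_spread:
  assumes t: "0 \<le> t" and l: "0 < l" and ab: "a \<le> b"
  shows "integral {a..b} (\<lambda>x. spread l x t) \<le> 4 * M * l"
proof -
  define Q where "Q = prim (\<lambda>y. slope l y t)"
  have i: "(\<lambda>y. slope l y t) integrable_on {p..r}" for p r
    using t by (intro integrable_continuous_real slope_cont)
  have Q: "Q r - Q p = integral {p..r} (\<lambda>y. slope l y t)" if "p \<le> r" for p r
    unfolding Q_def using that by (intro prim_diff i)
  have sh: "integral {a..b} (\<lambda>x. slope l (x + c) t) = Q (b + c) - Q (a + c)" for c
    using integral_shift_real_ivl[of "a + c" c "b + c" "\<lambda>x. slope l x t"] Q[of "a + c" "b + c"] ab by simp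
  have "integral {a..b} (\<lambda>x. spread l x t) = integral {a..b} (\<lambda>x. slope l (x + (- l)) t - slope l (x + l) t)"
    by (simp add: spread_def)
  also have "\<dots> = integral {a..b} (\<lambda>x. slope l (x + (- l)) t) - integral {a..b} (\<lambda>x. slope l (x + l) t)"
    by (intro Henstock_Kurzweil_Integration.integral_diff integrable_continuous_real slope_shift_cont t)
  also have "\<dots> = (Q (a + l) - Q (a - l)) - (Q (b + l) - Q (b - l))"
    unfolding sh by simp
  also have "\<dots> \<le> \<bar>Q (a + l) - Q (a - l)\<bar> + \<bar>Q (b + l) - Q (b - l)\<bar>" by linarith
  also have "\<dots> \<le> 2 * M * l + 2 * M * l"
  proof (rule add_mono)
    have *: "\<bar>Q (c + l) - Q (c - l)\<bar> \<le> 2 * M * l" for c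
    proof -
      have "\<bar>integral {c - l..c + l} (\<lambda>y. slope l y t)\<bar> \<le> M * ((c + l) - (c - l))"
        by (rule integral_bound_linear[OF i]) (use l slope_abs[OF t l] in auto)
      then show ?thesis using Q[of "c - l" "c + l"] l by (simp add: algebra_simps)
    qed
    show "\<bar>Q (a + l) - Q (a - l)\<bar> \<le> 2 * M * l" "\<bar>Q (b + l) - Q (b - l)\<bar> \<le> 2 * M * l" using * by auto
  qed
  finally show ?thesis by simp
qed

text \<open>Apply \<open>flux_bound\<close> with \<Psi> equal to \<open>f (avg)\<close> plus the
  Lipschitz constant times a bound for \<open>v - avg\<close>. The times stay above \<delta>, so
  \<open>E / t\<close> may be replaced by \<open>E / \<delta>\<close>.\<close>

lemma one_step_time:
  assumes \<delta>: "0 < \<delta>" "\<delta> \<le> \<tau>" and h: "0 \<le> h" and l: "0 < l"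
  shows "U x \<tau> - h * (f (avg l x \<tau>) + \<bar>L\<bar> * (spread l x \<tau> + 4 * E * l / \<delta> + 2 * F * h / l)) \<le> U x (\<tau> + h)"
proof -
  define \<Psi> where "\<Psi> x = f (avg l x \<tau>) + \<bar>L\<bar> * (spread l x \<tau> + 4 * E * l / \<delta> + 2 * F * h / l)" for x
  have \<tau>: "0 < \<tau>" "0 \<le> \<tau>" using \<delta> by auto
  have El: "E * l / \<sigma> \<le> E * l / \<delta>" if "\<delta> \<le> \<sigma>" for \<sigma>
    using that \<delta> E l by (intro divide_left_mono) auto
  have "0 \<le> 1 * (U x (\<tau> + h) - U x \<tau>) + (\<tau> + h - \<tau>) * \<Psi> x"
  proof (rule flux_bound[OF \<tau>(2)])
    show "continuous_on UNIV \<Psi>" unfolding \<Psi>_def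
      by (intro continuous_intros continuous_on_compose2[OF f_cont'[of UNIV]] avg_cont spread_cont \<tau>) auto
    fix \<sigma> assume \<sigma>: "\<tau> < \<sigma>" "\<sigma> \<le> \<tau> + h"
    then have \<sigma>0: "0 < \<sigma>" "\<delta> \<le> \<sigma>" "0 \<le> \<sigma>" using \<delta> by auto
    show "AE x in lebesgue. 1 * f (v x \<sigma>) \<le> \<Psi> x"
      using v_between_slopes[OF \<sigma>0(1) l]
    proof eventually_elim
      case (elim x)
      have T: "\<bar>slope l y \<sigma> - slope l y \<tau>\<bar> \<le> 2 * F * h / l" for y
      proof -
        have "2 * F * \<bar>\<sigma> - \<tau>\<bar> / l \<le> 2 * F * h / l"
          using \<sigma> F_nonneg l by (intro divide_right_mono mult_left_mono) auto
        then show ?thesis using slope_time[OF \<tau>(2) \<sigma>0(3) l, of y] by linarith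
      qed
      have s1: "slope l (x + l) \<sigma> - slope l x \<sigma> \<le> E * l / \<sigma>" using slope_increment[OF \<sigma>0(1) l, of x "x + l"] l by simp
      have s2: "slope l x \<tau> - slope l (x - l) \<tau> \<le> E * l / \<tau>" using slope_increment[OF \<tau>(1) l, of "x - l" x] l by simp
      note av = avg_between[OF \<tau>(1) l, of x]
      \<comment> \<open>Both quantities lie between \<open>slope\<close> at \<open>x + l\<close> and
        at \<open>x - l\<close>, up to multiples of \<open>E l / \<delta>\<close>; comparing the
        slopes at the two times costs \<open>2 F h / l\<close>. The constant \<open>4\<close> comes
        from the lower bound for \<open>v\<close>, which also moves both slopes from
        \<open>x\<close> to the ends.\<close>
      have "\<bar>v x \<sigma> - avg l x \<tau>\<bar> \<le> spread l x \<tau> + 4 * (E * l / \<delta>) + 2 * F * h / l"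
      proof -
        have e0: "0 \<le> E * l / \<delta>" using E l \<delta> by simp
        note t1 = T[of "x - l", unfolded abs_le_iff] and t2 = T[of "x + l", unfolded abs_le_iff]
        have "v x \<sigma> - avg l x \<tau> \<le> spread l x \<tau> + 4 * (E * l / \<delta>) + 2 * F * h / l"
          unfolding spread_def using e0 elim[THEN conjunct2] av(1) t1[THEN conjunct1] El[OF \<sigma>0(2)] El[OF \<delta>(2)]
          by linarith
        moreover have "avg l x \<tau> - v x \<sigma> \<le> spread l x \<tau> + 4 * (E * l / \<delta>) + 2 * F * h / l"
          unfolding spread_def
          using e0 elim[THEN conjunct1] av(2) t2[THEN conjunct2] El[OF \<sigma>0(2)] El[OF \<delta>(2)] s1 s2
          by linarith
        ultimately show ?thesis by linarith
      qed
      then have "\<bar>L\<bar> * \<bar>v x \<sigma> - avg l x \<tau>\<bar> \<le> \<bar>L\<bar> * (spread l x \<tau> + 4 * E * l / \<delta> + 2 * F * h / l)"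
        by (intro mult_left_mono) (auto simp: mult.assoc)
      moreover have "f (v x \<sigma>) - f (avg l x \<tau>) \<le> \<bar>L\<bar> * \<bar>v x \<sigma> - avg l x \<tau>\<bar>"
      proof -
        have "\<bar>f (v x \<sigma>) - f (avg l x \<tau>)\<bar> \<le> L * \<bar>v x \<sigma> - avg l x \<tau>\<bar>"
          by (rule f_lip[OF v_bound[OF \<sigma>0(3)] avg_abs[OF \<tau>(2) l]])
        also have "\<dots> \<le> \<bar>L\<bar> * \<bar>v x \<sigma> - avg l x \<tau>\<bar>" by (intro mult_right_mono) auto
        finally show ?thesis by simp
      qed
      ultimately show ?case by (simp add: \<Psi>_def)
    qed
  qed (use h in simp)
  then show ?thesis by (simp add: \<Psi>_def)
qed

text \<open>The sign of the speed decides between \<open>slope_left\<close> and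
  \<open>slope_right\<close>. The displacement is at most \<open>h B\<close>, which accounts for the
  last error term.\<close>

lemma one_step_space:
  assumes \<delta>: "0 < \<delta>" "\<delta> \<le> \<tau>" and h: "0 \<le> h" and l: "0 < l"
    and b: "\<bar>b\<bar> \<le> B"
  shows "h * b * avg l x \<tau> - h * B * (spread l x \<tau> + 4 * E * l / \<delta> + E * h * B / \<delta>) \<le> U x \<tau> - U (x - h * b) \<tau>"
proof -
  have \<tau>: "0 < \<tau>" using \<delta> by auto
  have B: "0 \<le> B" using b by linarith
  have El: "E * l / \<tau> \<le> E * l / \<delta>" using \<delta> E l by (intro divide_left_mono) auto
  have sp: "0 \<le> spread l x \<tau> + 2 * (E * l / \<delta>)" using spread_ge[OF \<tau> l, of x] El by simp
  have Ez: "E * z / \<tau> \<le> E * h * B / \<delta>" if "0 \<le> z" "z \<le> h * B" for z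
  proof -
    have "E * z / \<tau> \<le> E * (h * B) / \<tau>" using that E \<tau> by (intro divide_right_mono mult_left_mono) auto
    also have "\<dots> \<le> E * (h * B) / \<delta>" using \<delta> E h B by (intro divide_left_mono) auto
    finally show ?thesis by (simp add: mult.assoc)
  qed
  have El0: "0 \<le> E * l / \<delta>" using E l \<delta> by simp
  have Eh0: "0 \<le> E * h * B / \<delta>" using E h B \<delta> by simp
  note av = avg_between[OF \<tau> l, of x]
  let ?W = "spread l x \<tau> + 4 * (E * l / \<delta>) + E * h * B / \<delta>"
  have W: "0 \<le> ?W" using sp El0 Eh0 by linarith
  have "h * b * avg l x \<tau> - h * B * ?W \<le> U x \<tau> - U (x - h * b) \<tau>"
  proof (cases "0 \<le> b")
    case True
    define z where "z = h * b"
    have z: "0 \<le> z" "z \<le> h * B" using True h b by (auto simp: z_def intro: mult_left_mono)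
    have "avg l x \<tau> - ?W \<le> slope l x \<tau> - E * (z + l) / \<tau>"
      using av(2) Ez[OF z] El sp El0 by (simp add: distrib_left add_divide_distrib)
    then have "z * (avg l x \<tau> - ?W) \<le> z * (slope l x \<tau> - E * (z + l) / \<tau>)"
      using z by (intro mult_left_mono) auto
    also have "\<dots> \<le> U x \<tau> - U (x - z) \<tau>" by (rule slope_left[OF \<tau> l z(1)])
    finally have "z * avg l x \<tau> - z * ?W \<le> U x \<tau> - U (x - z) \<tau>" by (simp add: right_diff_distrib)
    moreover have "z * ?W \<le> h * B * ?W" using z W by (intro mult_right_mono)
    ultimately show ?thesis by (simp add: z_def)
  next
    case False
    define z where "z = h * - b"
    have "h * - b \<le> h * B" using h b by (intro mult_left_mono) auto
    moreover have "0 \<le> h * - b" using False h by (intro mult_nonneg_nonneg) auto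
    ultimately have z: "0 \<le> z" "z \<le> h * B" by (auto simp: z_def)
    have "slope l (x - l) \<tau> + E * (z + l) / \<tau> \<le> avg l x \<tau> + ?W"
      using av(1) Ez[OF z] El El0 unfolding spread_def by (simp add: distrib_left add_divide_distrib)
    then have "z * (slope l (x - l) \<tau> + E * (z + l) / \<tau>) \<le> z * (avg l x \<tau> + ?W)"
      using z by (intro mult_left_mono) auto
    with slope_right[OF \<tau> l z(1), of x] have "U (x + z) \<tau> - U x \<tau> \<le> z * avg l x \<tau> + z * ?W"
      by (simp add: distrib_left)
    moreover have "z * ?W \<le> h * B * ?W" using z W by (intro mult_right_mono)
    ultimately show ?thesis by (simp add: z_def)
  qed
  then show ?thesis by (simp add: mult.assoc)
qed

text \<open>\<open>V\<close> is followed along the speed \<open>f' m\<close> with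
  \<open>m = avg l x \<tau>\<close>, and \<open>U\<close> is bounded below by a time step and a
  space step with the same \<open>m\<close>. The Legendre term of \<open>V\<close> cancels the main
  terms of \<open>U\<close>, leaving only averaging errors.\<close>

lemma one_step_difference:
  assumes V: "subsolution V" and \<delta>: "0 < \<delta>" "\<delta> \<le> \<tau>" and h: "0 \<le> h" and l: "0 < l"
    and B: "\<And>y. \<bar>y\<bar> \<le> M \<Longrightarrow> \<bar>f' y\<bar> \<le> B"
  defines "g \<equiv> \<lambda>x. x - h * f' (avg l x \<tau>)"
  shows "V x (\<tau> + h) - U x (\<tau> + h) \<le> V (g x) \<tau> - U (g x) \<tau>
    + h * (\<bar>L\<bar> + B) * (spread l x \<tau> + 4 * E * l / \<delta> + 2 * F * h / l + E * h * B / \<delta>)"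
proof -
  have \<tau>: "0 < \<tau>" "0 \<le> \<tau>" using \<delta> by auto
  define m where "m = avg l x \<tau>"
  have bB: "\<bar>f' m\<bar> \<le> B" unfolding m_def by (intro B avg_abs \<tau> l)
  have B0: "0 \<le> B" using bB by linarith
  have 1: "V x (\<tau> + h) \<le> V (g x) \<tau> + h * (m * f' m - f m)"
    using subsolutionD[OF V \<tau>(2) h, of "g x" m] by (simp add: g_def m_def)
  have 2: "U x \<tau> - h * (f m + \<bar>L\<bar> * (spread l x \<tau> + 4 * E * l / \<delta> + 2 * F * h / l)) \<le> U x (\<tau> + h)"
    unfolding m_def by (rule one_step_time[OF \<delta> h l])
  have 3: "h * f' m * m - h * B * (spread l x \<tau> + 4 * E * l / \<delta> + E * h * B / \<delta>) \<le> U x \<tau> - U (g x) \<tau>"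
    using one_step_space[OF \<delta> h l bB, of x] by (simp add: g_def m_def)
  have 4: "0 \<le> h * \<bar>L\<bar> * (E * h * B / \<delta>)" "0 \<le> h * B * (2 * F * h / l)"
    using h E B0 \<delta> F_nonneg l by auto
  define p q r where "p = 4 * E * l / \<delta>" and "q = 2 * F * h / l" and "r = E * h * B / \<delta>"
  have "V x (\<tau> + h) - U x (\<tau> + h) \<le> V (g x) \<tau> - U (g x) \<tau>
      + h * (\<bar>L\<bar> + B) * (spread l x \<tau> + p + q + r)"
    using 1 2[folded p_def q_def] 3[folded p_def r_def] 4[folded q_def r_def] by (simp add: algebra_simps)
  then show ?thesis by (simp add: p_def q_def r_def)
qed

text \<open>The backward step \<open>x \<mapsto> x - h f'(avg l x \<tau>)\<close> contracts lengths at most by the factor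
  \<open>1 - O(h)\<close>, because \<open>avg\<close> inherits the one-sided Lipschitz bound.\<close>

lemma one_step_integral:
  fixes c :: real
  assumes V: "subsolution V" and Vc: "\<And>t. 0 \<le> t \<Longrightarrow> continuous_on UNIV (\<lambda>x. V x t)"
    and \<delta>: "0 < \<delta>" "\<delta> \<le> \<tau>" and h: "0 < h" and l: "0 < l" and ab: "a \<le> b"
    and B: "\<And>y. \<bar>y\<bar> \<le> M \<Longrightarrow> \<bar>f' y\<bar> \<le> B" and K: "\<And>y. \<bar>y\<bar> \<le> M \<Longrightarrow> f'' y \<le> K"
    and small: "h * (K * E / \<delta>) \<le> 1 / 2"
  defines "D \<equiv> \<lambda>t x. max 0 (V x t - U x t - c)"
  shows "integral {a..b} (D (\<tau> + h)) \<le> (1 + 2 * (h * (K * E / \<delta>))) * integral {a - h * B..b + h * B} (D \<tau>)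
    + h * (\<bar>L\<bar> + B) * (4 * M * l + (b - a) * (4 * E * l / \<delta> + 2 * F * h / l + E * h * B / \<delta>))"
proof -
  have \<tau>: "0 < \<tau>" "0 \<le> \<tau>" using \<delta> by auto
  define k where "k = h * (K * E / \<delta>)"
  have K0: "0 < K" using K[of 0] f''_pos[of 0] M_nonneg by force
  have B0: "0 \<le> B" using B[of 0] M_nonneg by force
  have k0: "0 \<le> k" using h K0 E \<delta> by (simp add: k_def)
  define g where "g x = x - h * f' (avg l x \<tau>)" for x
  define g' where "g' x = 1 - h * (f'' (avg l x \<tau>) * ((slope l (x + l) \<tau> - slope l x \<tau>) / l))" for x
  have cD: "continuous_on X (D t)" if "0 \<le> t" for X t
    unfolding D_def by (intro continuous_intros continuous_on_subset[OF Vc[OF that]] U_cont that) auto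
  have gD: "(g has_real_derivative g' x) (at x)" for x
    unfolding g_def g'_def
    by (intro DERIV_diff DERIV_ident DERIV_cmult DERIV_chain2[OF f'' avg_DERIV[OF \<tau>(2)]])
  have cg: "continuous_on X g" for X
    using DERIV_isCont[OF gD] by (simp add: continuous_at_imp_continuous_on)
  have g'lo: "1 - k \<le> g' x" for x
  proof -
    have "slope l (x + l) \<tau> - slope l x \<tau> \<le> E * (x + l - x) / \<tau>"
      using l by (intro slope_increment[OF \<tau>(1) l]) auto
    then have "(slope l (x + l) \<tau> - slope l x \<tau>) / l \<le> E * l / \<tau> / l"
      using l by (intro divide_right_mono) auto
    also have "\<dots> = E / \<tau>" using l by simp
    also have "\<dots> \<le> E / \<delta>" using E \<delta> by (intro divide_left_mono) auto
    finally have "f'' (avg l x \<tau>) * ((slope l (x + l) \<tau> - slope l x \<tau>) / l) \<le> f'' (avg l x \<tau>) * (E / \<delta>)"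
      using less_imp_le[OF f''_pos] by (intro mult_left_mono)
    also have "\<dots> \<le> K * (E / \<delta>)"
      using K[OF avg_abs[OF \<tau>(2) l]] E \<delta> by (intro mult_right_mono) auto
    finally have "h * (f'' (avg l x \<tau>) * ((slope l (x + l) \<tau> - slope l x \<tau>) / l)) \<le> h * (K * (E / \<delta>))"
      using h by (intro mult_left_mono) auto
    then show ?thesis by (simp add: g'_def k_def)
  qed
  have gx: "\<bar>g x - x\<bar> \<le> h * B" for x
    unfolding g_def using B[OF avg_abs[OF \<tau>(2) l], of x] h by (simp add: abs_mult)
  have gmono: "g a \<le> g b"
  proof (rule DERIV_nonneg_imp_nondecreasing[OF ab])
    show "\<exists>y. (g has_real_derivative y) (at x) \<and> 0 \<le> y" for x
      using gD[of x] g'lo[of x] small by (auto simp: k_def intro!: exI[of _ "g' x"])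
  qed
  have img: "g ` {a..b} \<subseteq> {a - h * B..b + h * B}"
  proof
    fix y assume "y \<in> g ` {a..b}"
    then obtain x where "x \<in> {a..b}" "y = g x" by blast
    then show "y \<in> {a - h * B..b + h * B}" using gx[of x] by (auto simp: abs_le_iff)
  qed
  have cDg: "continuous_on X (\<lambda>x. D \<tau> (g x))" for X
    by (rule continuous_on_compose2[OF cD[OF \<tau>(2), of UNIV] cg]) auto
  \<comment> \<open>The substitution \<open>g\<close> may be used because
    \<open>g' \<ge> 1 - k\<close>, and this bound also lets the Jacobian be discarded.\<close>
  have sub: "((\<lambda>x. g' x *\<^sub>R D \<tau> (g x)) has_integral integral {g a..g b} (D \<tau>)) {a..b}"
    by (rule has_integral_substitution_strong[of "{}", OF _ ab gmono img cD[OF \<tau>(2)] cg])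
       (use gD in \<open>auto intro: has_field_derivative_at_within\<close>)
  have D0: "0 \<le> D t x" for t x by (simp add: D_def)
  have "(1 - k) * integral {a..b} (\<lambda>x. D \<tau> (g x)) = integral {a..b} (\<lambda>x. (1 - k) * D \<tau> (g x))" by simp
  also have "\<dots> \<le> integral {g a..g b} (D \<tau>)"
  proof (rule has_integral_le[OF _ sub])
    show "((\<lambda>x. (1 - k) * D \<tau> (g x)) has_integral integral {a..b} (\<lambda>x. (1 - k) * D \<tau> (g x))) {a..b}"
      by (intro integrable_integral integrable_continuous_real continuous_on_mult continuous_on_const cDg)
    show "(1 - k) * D \<tau> (g x) \<le> g' x *\<^sub>R D \<tau> (g x)" for x
      unfolding real_scaleR_def by (rule mult_right_mono[OF g'lo D0])
  qed
  also have "\<dots> \<le> integral {a - h * B..b + h * B} (D \<tau>)"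
  proof (rule integral_subset_le)
    show "{g a..g b} \<subseteq> {a - h * B..b + h * B}" using gx[of a] gx[of b] by (auto simp: abs_le_iff)
    show "D \<tau> integrable_on {g a..g b}" "D \<tau> integrable_on {a - h * B..b + h * B}"
      by (intro integrable_continuous_real cD[OF \<tau>(2)])+
    show "\<forall>x\<in>{a - h * B..b + h * B}. 0 \<le> D \<tau> x" using D0 by blast
  qed
  finally have A: "(1 - k) * integral {a..b} (\<lambda>x. D \<tau> (g x)) \<le> integral {a - h * B..b + h * B} (D \<tau>)" .
  have Ig: "integral {a..b} (\<lambda>x. D \<tau> (g x)) \<le> (1 + 2 * k) * integral {a - h * B..b + h * B} (D \<tau>)"
  proof -
    have I0: "0 \<le> integral {a..b} (\<lambda>x. D \<tau> (g x))"
      by (intro Henstock_Kurzweil_Integration.integral_nonneg integrable_continuous_real cDg D0)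
    have "k * (1 - 2 * k) \<ge> 0" using k0 small[folded k_def] by (intro mult_nonneg_nonneg) auto
    \<comment> \<open>Here \<open>k \<le> 1 / 2\<close> enters: it replaces division by
      \<open>1 - k\<close> by the factor \<open>1 + 2 k\<close>, which is convenient for
      iteration.\<close>
    then have "1 \<le> (1 + 2 * k) * (1 - k)" by (simp add: algebra_simps)
    then have "1 * integral {a..b} (\<lambda>x. D \<tau> (g x)) \<le> ((1 + 2 * k) * (1 - k)) * integral {a..b} (\<lambda>x. D \<tau> (g x))"
      using I0 by (intro mult_right_mono)
    also have "\<dots> \<le> (1 + 2 * k) * integral {a - h * B..b + h * B} (D \<tau>)"
      unfolding mult.assoc using A k0 by (intro mult_left_mono) auto
    finally show ?thesis by simp
  qed
  define Z where "Z = 4 * E * l / \<delta> + 2 * F * h / l + E * h * B / \<delta>"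
  have pw: "D (\<tau> + h) x \<le> D \<tau> (g x) + h * (\<bar>L\<bar> + B) * (spread l x \<tau> + Z)" for x
  proof -
    have "V x (\<tau> + h) - U x (\<tau> + h) \<le> V (g x) \<tau> - U (g x) \<tau> + h * (\<bar>L\<bar> + B) * (spread l x \<tau> + Z)"
      using one_step_difference[OF V \<delta> _ l B, of h x] h by (simp add: g_def Z_def add.assoc)
    \<comment> \<open>The error must be nonnegative to pass from \<open>V - U - c\<close> to its
      positive part. \<open>spread\<close> may be slightly negative, and the
      \<open>E l / \<delta>\<close> contribution to \<open>Z\<close> compensates for this.\<close>
    moreover have "0 \<le> spread l x \<tau> + Z"
    proof -
      have "E * l / \<tau> \<le> E * l / \<delta>" using \<delta> E l by (intro divide_left_mono) auto
      moreover have "0 \<le> E * l / \<delta>" "0 \<le> 2 * F * h / l" "0 \<le> E * h * B / \<delta>"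
        using E l \<delta> F_nonneg h B0 by auto
      ultimately show ?thesis using spread_ge[OF \<tau>(1) l, of x] by (simp add: Z_def)
    qed
    then have "0 \<le> h * (\<bar>L\<bar> + B) * (spread l x \<tau> + Z)" using h B0 by simp
    ultimately show ?thesis unfolding D_def by linarith
  qed
  have "integral {a..b} (D (\<tau> + h)) \<le> integral {a..b} (\<lambda>x. D \<tau> (g x) + h * (\<bar>L\<bar> + B) * (spread l x \<tau> + Z))"
  proof (rule integral_le)
    show "D (\<tau> + h) integrable_on {a..b}"
      using \<tau> h by (intro integrable_continuous_real cD) auto
    show "(\<lambda>x. D \<tau> (g x) + h * (\<bar>L\<bar> + B) * (spread l x \<tau> + Z)) integrable_on {a..b}"
      by (intro integrable_continuous_real continuous_intros cDg spread_cont \<tau>)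
  qed (rule pw)
  also have "\<dots> = integral {a..b} (\<lambda>x. D \<tau> (g x)) + h * (\<bar>L\<bar> + B) * (integral {a..b} (\<lambda>x. spread l x \<tau>) + Z * (b - a))"
  proof (intro integral_unique has_integral_add has_integral_mult_right)
    show "((\<lambda>x. D \<tau> (g x)) has_integral integral {a..b} (\<lambda>x. D \<tau> (g x))) {a..b}"
      by (intro integrable_integral integrable_continuous_real cDg)
    show "((\<lambda>x. spread l x \<tau>) has_integral integral {a..b} (\<lambda>x. spread l x \<tau>)) {a..b}"
      by (intro integrable_integral integrable_continuous_real spread_cont \<tau>)
    show "((\<lambda>x. Z) has_integral Z * (b - a)) {a..b}"
      using has_integral_const_real[of Z a b] ab by (simp add: mult.commute)
  qed
  also have "\<dots> \<le> (1 + 2 * k) * integral {a - h * B..b + h * B} (D \<tau>) + h * (\<bar>L\<bar> + B) * (4 * M * l + (b - a) * Z)"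
  proof (rule add_mono[OF Ig], rule mult_left_mono)
    show "integral {a..b} (\<lambda>x. spread l x \<tau>) + Z * (b - a) \<le> 4 * M * l + (b - a) * Z"
      using integral_spread[OF \<tau>(2) l ab] by (simp add: mult.commute)
    show "0 \<le> h * (\<bar>L\<bar> + B)" using h B0 by simp
  qed
  finally show ?thesis by (simp add: k_def Z_def)
qed


text \<open>Starting at \<delta> keeps the one-sided constant bounded. Iterating the step on a
  backward cone of slope \<open>B\<close> gives a discrete Gronwall inequality whose accumulated
  error is \<open>O(l)\<close>; as the step tends to zero, the positive part of
  \<open>V - U - c\<close> has integral zero and vanishes by continuity.\<close>

lemma comparison_after:
  assumes V: "subsolution V" and Vc: "\<And>t. 0 \<le> t \<Longrightarrow> continuous_on UNIV (\<lambda>x. V x t)"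
    and \<delta>: "0 < \<delta>" "\<delta> \<le> T" and init: "\<And>x. V x \<delta> - U x \<delta> \<le> c"
  shows "V x T - U x T \<le> c"
proof (cases "\<delta> = T")
  case False
  with \<delta> have T: "0 < T - \<delta>" by simp
  define D where "D t x = max 0 (V x t - U x t - c)" for t x
  have cD: "continuous_on X (D t)" if "0 \<le> t" for X t
    unfolding D_def by (intro continuous_intros continuous_on_subset[OF Vc[OF that]] U_cont that) auto
  have D0: "0 \<le> D t x" for t x by (simp add: D_def)
  obtain B where B: "\<And>y. \<bar>y\<bar> \<le> M \<Longrightarrow> \<bar>f' y\<bar> \<le> B"
    by (rule continuous_on_Icc_bound[of "- M" M, OF f'_cont]) (auto simp: abs_le_iff minus_le_iff)
  obtain K where K: "\<And>y. \<bar>y\<bar> \<le> M \<Longrightarrow> \<bar>f'' y\<bar> \<le> K"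
    by (rule continuous_on_Icc_bound[of "- M" M, OF continuous_on_subset[OF f''_cont subset_UNIV]]) (auto simp: abs_le_iff minus_le_iff)
  have B0: "0 \<le> B" using B[of 0] M_nonneg by force
  have K': "f'' y \<le> K" if "\<bar>y\<bar> \<le> M" for y using K[OF that] by simp
  have K0: "0 \<le> K" using K[of 0] M_nonneg by force
  define \<kappa> where "\<kappa> = K * E / \<delta>"
  have \<kappa>0: "0 \<le> \<kappa>" using K0 E \<delta> by (simp add: \<kappa>_def)
  \<comment> \<open>An upper bound for the width of the cone over \<open>{x - 1..x + 1}\<close> at
    all times between \<delta> and \<open>T\<close>.\<close>
  define \<Lambda> where "\<Lambda> = 2 + 2 * B * (T - \<delta>)"
  define C where "C = (\<bar>L\<bar> + B) * (4 * M + \<Lambda> * (4 * E / \<delta> + 2 * F + E * B / \<delta>))"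
  have \<Lambda>0: "0 \<le> \<Lambda>" using B0 T by (simp add: \<Lambda>_def)
  have C0: "0 \<le> C" unfolding C_def using B0 M_nonneg \<Lambda>0 E \<delta> F_nonneg by simp
  define I where "I = integral {x - 1..x + 1} (D T)"
  define J where "J = exp (2 * \<kappa> * (T - \<delta>)) * (T - \<delta>) * C"
  have est: "I \<le> J * sqrt ((T - \<delta>) / real n)"
    if n: "0 < n" "(T - \<delta>) / real n \<le> 1" "(T - \<delta>) / real n * \<kappa> \<le> 1 / 2" for n
  proof -
    define h where "h = (T - \<delta>) / real n"
    have h: "0 < h" "h \<le> 1" "h * \<kappa> \<le> 1 / 2" and nh: "real n * h = T - \<delta>" using n T by (auto simp: h_def)
    \<comment> \<open>The errors per unit time are of orders \<open>l\<close>, \<open>h / l\<close>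
      and \<open>h\<close>. With \<open>h = l * l\<close> the second equals \<open>l\<close>, and
      the third is at most \<open>l\<close> because \<open>l \<le> 1\<close>.\<close>
    define l where "l = sqrt h"
    have l: "0 < l" "l \<le> 1" "h = l * l" using h by (auto simp: l_def)
    \<comment> \<open>The interval shrinks by \<open>h * B\<close> on each side in every step,
      exactly what the backward step may reach, and has become \<open>{x - 1..x + 1}\<close> at
      \<open>k = n\<close>.\<close>
    define e where "e k = integral {x - 1 - (T - \<delta> - real k * h) * B..x + 1 + (T - \<delta> - real k * h) * B} (D (\<delta> + real k * h))" for k
    have step: "e (Suc k) \<le> (1 + 2 * (h * \<kappa>)) * e k + h * (C * l)" if k: "k < n" for k
    proof -
      define a b where "a = x - 1 - (T - \<delta> - real (Suc k) * h) * B" and "b = x + 1 + (T - \<delta> - real (Suc k) * h) * B"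
      define \<tau> where "\<tau> = \<delta> + real k * h"
      have kn: "real (Suc k) * h \<le> T - \<delta>"
        unfolding nh[symmetric] using k h by (intro mult_right_mono) auto
      have k0: "0 \<le> real (Suc k) * h" using h by simp
      have "0 \<le> (T - \<delta> - real (Suc k) * h) * B" using kn B0 by (intro mult_nonneg_nonneg) auto
      then have ab: "a \<le> b" unfolding a_def b_def by linarith
      have bma: "b - a \<le> \<Lambda>"
      proof -
        have "(T - \<delta> - real (Suc k) * h) * B \<le> (T - \<delta>) * B" using k0 B0 by (intro mult_right_mono) auto
        then show ?thesis unfolding a_def b_def \<Lambda>_def by (simp add: algebra_simps)
      qed
      have \<tau>: "\<delta> \<le> \<tau>" using h by (simp add: \<tau>_def)
      have "integral {a..b} (D (\<tau> + h)) \<le> (1 + 2 * (h * \<kappa>)) * integral {a - h * B..b + h * B} (D \<tau>)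
        + h * (\<bar>L\<bar> + B) * (4 * M * l + (b - a) * (4 * E * l / \<delta> + 2 * F * h / l + E * h * B / \<delta>))"
        using one_step_integral[OF V Vc \<delta>(1) \<tau> h(1) l(1) ab B K', of c] h(3)
        unfolding \<kappa>_def D_def[abs_def] by simp
      also have "4 * M * l + (b - a) * (4 * E * l / \<delta> + 2 * F * h / l + E * h * B / \<delta>)
          \<le> 4 * M * l + \<Lambda> * (4 * E * l / \<delta> + 2 * F * l + E * l * B / \<delta>)"
      proof (intro add_left_mono mult_mono bma add_mono)
        show "2 * F * h / l \<le> 2 * F * l" using l by simp
        have "E * h * B \<le> E * l * B"
          using l E B0 mult_left_mono[of l 1 l] by (intro mult_right_mono mult_left_mono) auto
        then show "E * h * B / \<delta> \<le> E * l * B / \<delta>" using \<delta> by (intro divide_right_mono) auto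
        show "0 \<le> 4 * E * l / \<delta> + 2 * F * h / l + E * h * B / \<delta>"
          using E l \<delta> F_nonneg h B0 by simp
      qed (use \<Lambda>0 in auto)
      finally have "integral {a..b} (D (\<tau> + h)) \<le> (1 + 2 * (h * \<kappa>)) * integral {a - h * B..b + h * B} (D \<tau>)
        + h * (\<bar>L\<bar> + B) * (4 * M * l + \<Lambda> * (4 * E * l / \<delta> + 2 * F * l + E * l * B / \<delta>))"
        using h B0 by (simp add: mult_left_mono)
      also have "h * (\<bar>L\<bar> + B) * (4 * M * l + \<Lambda> * (4 * E * l / \<delta> + 2 * F * l + E * l * B / \<delta>)) = h * (C * l)"
        unfolding C_def by (simp add: algebra_simps)
      also have "integral {a - h * B..b + h * B} (D \<tau>) = e k"
        unfolding e_def a_def b_def \<tau>_def by (simp add: algebra_simps)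
      also have "integral {a..b} (D (\<tau> + h)) = e (Suc k)"
        unfolding e_def a_def b_def \<tau>_def by (simp add: algebra_simps)
      finally show ?thesis .
    qed
    \<comment> \<open>The induction starts from \<open>e 0 = 0\<close>, since the positive part
      vanishes at time \<delta> by the choice of \<open>c\<close>.\<close>
    have gron: "k \<le> n \<Longrightarrow> e k \<le> (1 + 2 * (h * \<kappa>)) ^ k * (real k * (h * (C * l)))" for k
    proof (induction k)
      case 0
      have "D \<delta> = (\<lambda>_. 0)" using init by (auto simp: D_def fun_eq_iff)
      then have "e 0 = 0" by (simp add: e_def)
      then show ?case by simp
    next
      case (Suc k)
      let ?q = "1 + 2 * (h * \<kappa>)"
      have q: "1 \<le> ?q" using h \<kappa>0 by simp
      have w0: "0 \<le> h * (C * l)" using h C0 l by simp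
      have "e (Suc k) \<le> ?q * e k + h * (C * l)" using Suc.prems by (intro step) simp
      also have "\<dots> \<le> ?q * (?q ^ k * (real k * (h * (C * l)))) + ?q ^ Suc k * (h * (C * l))"
        using Suc q w0 mult_right_mono[OF one_le_power[OF q, of "Suc k"] w0] by (intro add_mono mult_left_mono) auto
      also have "\<dots> = ?q ^ Suc k * (real (Suc k) * (h * (C * l)))" by (simp add: algebra_simps)
      finally show ?case .
    qed
    have "(1 + 2 * (h * \<kappa>)) ^ n \<le> exp (2 * \<kappa> * (T - \<delta>))"
    proof -
      have "(1 + 2 * (h * \<kappa>)) ^ n \<le> exp (2 * (h * \<kappa>)) ^ n"
        using h \<kappa>0 by (intro power_mono exp_ge_add_one_self) simp
      also have "\<dots> = exp (2 * \<kappa> * (real n * h))" by (simp add: exp_of_nat_mult[symmetric] algebra_simps)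
      finally show ?thesis by (simp add: nh)
    qed
    then have "(1 + 2 * (h * \<kappa>)) ^ n * (real n * (h * (C * l))) \<le> exp (2 * \<kappa> * (T - \<delta>)) * (real n * (h * (C * l)))"
      using h C0 l by (intro mult_right_mono) auto
    also have "\<dots> = J * l" unfolding J_def nh[symmetric] by (simp add: algebra_simps)
    finally have "e n \<le> J * l" using gron[of n] by simp
    moreover have "e n = I" unfolding e_def I_def nh by simp
    ultimately show ?thesis by (simp add: l_def h_def)
  qed
  have lim: "(\<lambda>n. (T - \<delta>) / real n) \<longlonglongrightarrow> 0" by (rule lim_const_over_n)
  have lim2: "(\<lambda>n. (T - \<delta>) / real n * \<kappa>) \<longlonglongrightarrow> 0" using tendsto_mult_left_zero[OF lim] .
  have "\<forall>\<^sub>F n in sequentially. I \<le> J * sqrt ((T - \<delta>) / real n)"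
  proof -
    have "\<forall>\<^sub>F n in sequentially. (T - \<delta>) / real n < 1" by (rule order_tendstoD(2)[OF lim]) simp
    moreover have "\<forall>\<^sub>F n in sequentially. (T - \<delta>) / real n * \<kappa> < 1 / 2" by (rule order_tendstoD(2)[OF lim2]) simp
    moreover have "\<forall>\<^sub>F n::nat in sequentially. 0 < n" by (rule eventually_gt_at_top)
    ultimately show ?thesis by eventually_elim (rule est; simp)
  qed
  moreover have "(\<lambda>n. J * sqrt ((T - \<delta>) / real n)) \<longlonglongrightarrow> J * sqrt 0"
    by (intro tendsto_intros lim)
  ultimately have "I \<le> 0" using tendsto_lowerbound[of _ "J * sqrt 0" sequentially I] by simp
  moreover have "0 \<le> I" unfolding I_def
    by (intro Henstock_Kurzweil_Integration.integral_nonneg integrable_continuous_real cD D0) (use \<delta> in auto)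
  ultimately have "integral {x - 1..x + 1} (D T) = 0" by (simp add: I_def)
  then have "(D T has_integral 0) (cbox (x - 1) (x + 1))"
    using integrable_continuous_real[OF cD, of T "x - 1" "x + 1"] \<delta> by (simp add: has_integral_integral)
  then have "D T x = 0"
    by (rule has_integral_0_cbox_imp_0[rotated 2]) (use cD[of T] D0 \<delta> in auto)
  then show ?thesis by (simp add: D_def)
qed (use init in simp)

theorem comparison:
  assumes V: "subsolution V" and Vc: "\<And>t. 0 \<le> t \<Longrightarrow> continuous_on UNIV (\<lambda>x. V x t)"
    and init: "\<And>x. V x 0 \<le> U x 0" and t: "0 \<le> t"
  shows "V x t \<le> U x t"
proof (cases "t = 0")
  case False
  with t have t: "0 < t" by simp
  \<comment> \<open>The subsolution inequality with \<open>m = 0\<close> carries \<open>V\<close>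
    from time \<delta> back to the data along the speed \<open>f' 0\<close>; the Lipschitz bounds of
    \<open>U\<close> in space and time return to the same point. Only this controls \<open>V\<close>
    at small times.\<close>
  define C where "C = M * \<bar>f' 0\<bar> + F + \<bar>f 0\<bar>"
  have start: "V y \<delta> - U y \<delta> \<le> \<delta> * C" if "0 < \<delta>" for y \<delta>
  proof -
    have "V y \<delta> \<le> V (y - \<delta> * f' 0) 0 + \<delta> * (0 * f' 0 - f 0)"
      using subsolutionD[OF V order_refl, of \<delta> "y - \<delta> * f' 0" 0] that by simp
    also have "\<dots> \<le> U (y - \<delta> * f' 0) 0 + \<delta> * \<bar>f 0\<bar>"
      using init[of "y - \<delta> * f' 0"] mult_left_mono[of "- f 0" "\<bar>f 0\<bar>" \<delta>, OF abs_ge_minus_self] that by simp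
    also have "U (y - \<delta> * f' 0) 0 \<le> U y 0 + M * (\<delta> * \<bar>f' 0\<bar>)"
      using U_lip[of 0 "y - \<delta> * f' 0" y] that by (simp add: abs_mult)
    also have "U y 0 \<le> U y \<delta> + F * \<delta>"
      using U_time_lip[of 0 \<delta> y] that by (simp add: abs_le_iff)
    finally show ?thesis by (simp add: C_def algebra_simps)
  qed
  have "V x t - U x t \<le> \<delta> * C" if "0 < \<delta>" "\<delta> < t" for \<delta>
    by (rule comparison_after[OF V Vc that(1) less_imp_le[OF that(2)] start[OF that(1)]])
  then have ev: "\<forall>\<^sub>F \<delta> in at_right 0. V x t - U x t \<le> \<delta> * C"
    unfolding eventually_at_right_field using t by blast
  have lim: "((\<lambda>\<delta>. \<delta> * C) \<longlongrightarrow> 0 * C) (at_right 0)" by (intro tendsto_intros)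
  have "V x t - U x t \<le> 0 * C"
    by (rule tendsto_lowerbound[OF lim ev]) simp
  then show ?thesis by simp
qed (use init in simp)

end

section \<open>Almost everywhere equality and oriented integrals\<close>

lemma integral_cong_lebesgue_AE:
  fixes g h :: "real \<Rightarrow> real"
  assumes "AE x in lebesgue. g x = h x"
  shows "integral S g = integral S h" and "g integrable_on S \<longleftrightarrow> h integrable_on S"
proof -
  have *: "(g has_integral i) S \<longleftrightarrow> (h has_integral i) S" for i
  proof (rule has_integral_AE)
    show "AE x in lborel. x \<in> S \<longrightarrow> g x = h x"
      using assms unfolding AE_completion_iff by eventually_elim simp
  qed
  show "g integrable_on S \<longleftrightarrow> h integrable_on S" unfolding integrable_on_def * ..
  then show "integral S g = integral S h"
    by (metis * has_integral_integral integral_unique not_integrable_integral)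
qed

text \<open>A measure with density \<open>1 + g / (K + 1)\<close>, where \<open>g\<close> is a Borel
  version of \<open>h\<close>, gives every interval its length and is therefore Lebesgue measure.
  Uniqueness of densities then forces \<open>g = 0\<close> almost everywhere.\<close>

lemma AE_zero_if_interval_integrals_zero:
  assumes h: "bdd_meas K h" and z: "\<And>x y. x \<le> y \<Longrightarrow> integral {x..y} h = 0"
  shows "AE x in lebesgue. h x = 0"
proof -
  have K: "0 \<le> K" using bdd_meas_nonneg[OF h] .
  obtain g0 where g0: "g0 \<in> borel_measurable lborel" "AE x in lborel. h x = g0 x"
    using completion_ex_borel_measurable_real[of h lborel] h unfolding bdd_meas_def by blast
  define g where "g x = clip K (g0 x)" for x
  have gm [measurable]: "g \<in> borel_measurable borel"
    unfolding g_def using clip_measurable[OF g0(1)] by simp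
  have hg: "AE x in lebesgue. h x = g x"
    unfolding AE_completion_iff using g0(2)
  proof eventually_elim
    case (elim x)
    have "\<bar>h x\<bar> \<le> K" using h by (simp add: bdd_meas_def)
    then show ?case using elim by (simp add: g_def clip_id)
  qed
  have gb: "\<bar>g x\<bar> \<le> K" for x by (simp add: g_def clip_bound K)
  \<comment> \<open>Division by \<open>K + 1\<close> rather than \<open>K\<close> keeps the density
    nonnegative and is meaningful also for \<open>K = 0\<close>.\<close>
  define \<Phi> where "\<Phi> x = 1 + g x / (K + 1)" for x
  have \<Phi>0: "0 \<le> \<Phi> x" for x
  proof -
    have "- (K + 1) \<le> g x" using gb[of x] by (simp add: abs_le_iff)
    then have "- 1 \<le> g x / (K + 1)" using K by (simp add: pos_le_divide_eq)
    then show ?thesis by (simp add: \<Phi>_def)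
  qed
  have \<Phi>m: "\<Phi> \<in> borel_measurable borel" unfolding \<Phi>_def by measurable
  have "lborel = density lborel (\<lambda>x. ennreal (\<Phi> x))"
  proof (rule lborel_eqI)
    fix l u :: real assume "\<And>b. b \<in> Basis \<Longrightarrow> l \<bullet> b \<le> u \<bullet> b"
    then have lu: "l \<le> u" by simp
    have ig: "(g has_integral 0) {l..u}"
      using z[OF lu] integral_cong_lebesgue_AE[OF hg] bdd_meas_integrable[OF h, of l u]
      by (metis integrable_integral)
    have "((\<lambda>x. 1 + g x * inverse (K + 1)) has_integral (u - l) + 0 * inverse (K + 1)) {l..u}"
      using lu has_integral_const_real[of "1::real" l u] by (intro has_integral_add has_integral_mult_left ig) simp
    then have "(\<Phi> has_integral (u - l)) {l..u}" by (simp add: \<Phi>_def[abs_def] divide_inverse)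
    then have "(\<Phi> has_integral (u - l)) {l<..<u}"
      using has_integral_open_interval[of \<Phi> "u - l" l u] by simp
    then have "integral\<^sup>N lborel (\<lambda>x. indicator {l<..<u} x * ennreal (\<Phi> x)) = ennreal (u - l)"
      using nn_integral_has_integral_lebesgue[of "{l<..<u}" \<Phi> "u - l"] \<Phi>0
      by (simp add: ennreal_mult' ennreal_indicator)
    then show "emeasure (density lborel (\<lambda>x. ennreal (\<Phi> x))) (box l u) = (\<Prod>b\<in>Basis. (u - l) \<bullet> b)"
      using \<Phi>m by (simp add: emeasure_density mult.commute)
  qed simp
  then have "density lborel (\<lambda>x. 1) = density lborel (\<lambda>x. ennreal (\<Phi> x))" by (simp add: density_1)
  then have "AE x in lborel. 1 = ennreal (\<Phi> x)"
    using \<Phi>m by (subst (asm) sigma_finite_measure.density_unique_iff[OF sigma_finite_lborel]) auto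
  then have "AE x in lebesgue. 1 = ennreal (\<Phi> x)" by (rule AE_completion)
  with hg show ?thesis
  proof eventually_elim
    case (elim x)
    then have "ennreal (\<Phi> x) = ennreal 1" by simp
    then have "\<Phi> x = 1" using \<Phi>0[of x] by (subst (asm) ennreal_inj) auto
    then show ?case using elim K by (simp add: \<Phi>_def)
  qed
qed

text \<open>\<open>S\<close> will be an open half-line. It cuts a compact interval in another one
  \<open>{p..q}\<close> up to endpoints, hence the formulation with a negligible difference, which
  treats both sides of the shock at once.\<close>

lemma AE_eq_if_interval_integrals_eq:
  assumes w: "bdd_meas K w" "bdd_meas K' w'" and S: "S \<in> sets lebesgue"
    and ex: "\<And>x y. x \<le> y \<Longrightarrow> \<exists>p q. negligible (({x..y} \<inter> S) - {p..q} \<union> ({p..q} - ({x..y} \<inter> S))) \<and>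
        integral {p..q} w = integral {p..q} w'"
  shows "AE x in lebesgue. x \<in> S \<longrightarrow> w x = w' x"
proof -
  define h where "h x = (if x \<in> S then w x - w' x else 0)" for x
  have "bdd_meas (K + K') h" unfolding bdd_meas_def
  proof (intro conjI allI)
    have "(\<lambda>x. w x - w' x) \<in> borel_measurable (lebesgue_on S)"
      using w unfolding bdd_meas_def by (intro borel_measurable_diff measurable_restrict_space1) auto
    then show "h \<in> borel_measurable lebesgue" unfolding h_def using S by (subst borel_measurable_if) auto
    have "\<bar>w x - w' x\<bar> \<le> K + K'" for x
      using w abs_triangle_ineq4[of "w x" "w' x"] unfolding bdd_meas_def by (meson add_mono order_trans)
    then show "\<bar>h x\<bar> \<le> K + K'" for x
      using bdd_meas_nonneg[OF w(1)] bdd_meas_nonneg[OF w(2)] by (simp add: h_def)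
  qed
  moreover have "integral {x..y} h = 0" if xy: "x \<le> y" for x y
  proof -
    obtain p q where pq: "negligible (({x..y} \<inter> S) - {p..q} \<union> ({p..q} - ({x..y} \<inter> S)))"
      "integral {p..q} w = integral {p..q} w'" using ex[OF xy] by blast
    have "integral {x..y} h = integral ({x..y} \<inter> S) (\<lambda>x. w x - w' x)"
      unfolding h_def by (simp add: integral_restrict_Int Int_commute)
    also have "\<dots> = integral {p..q} (\<lambda>x. w x - w' x)"
      by (rule integral_spike_set; rule negligible_subset[OF pq(1)]; auto)
    also have "\<dots> = 0"
      using pq(2) by (subst Henstock_Kurzweil_Integration.integral_diff) (auto intro: bdd_meas_integrable w)
    finally show ?thesis .
  qed
  ultimately have "AE x in lebesgue. h x = 0" by (rule AE_zero_if_interval_integrals_zero)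
  then show ?thesis by eventually_elim (auto simp: h_def split: if_splits)
qed

lemma AE_eq_below:
  assumes w: "bdd_meas K w" "bdd_meas K' w'"
    and eq: "\<And>x y. x \<le> y \<Longrightarrow> y \<le> c \<Longrightarrow> integral {x..y} w = integral {x..y} w'"
  shows "AE x in lebesgue. x < c \<longrightarrow> w x = w' x"
proof -
  have "AE x in lebesgue. x \<in> {..<c} \<longrightarrow> w x = w' x"
  proof (rule AE_eq_if_interval_integrals_eq[OF w])
    fix x y :: real assume "x \<le> y"
    show "\<exists>p q. negligible (({x..y} \<inter> {..<c}) - {p..q} \<union> ({p..q} - ({x..y} \<inter> {..<c}))) \<and>
        integral {p..q} w = integral {p..q} w'"
    proof (intro exI conjI)
      show "negligible (({x..y} \<inter> {..<c}) - {x..min y c} \<union> ({x..min y c} - ({x..y} \<inter> {..<c})))"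
        by (rule negligible_subset[of "{c}"]) auto
      show "integral {x..min y c} w = integral {x..min y c} w'"
        by (cases "x \<le> min y c") (auto intro: eq)
    qed
  qed auto
  then show ?thesis by simp
qed

lemma AE_eq_above:
  assumes w: "bdd_meas K w" "bdd_meas K' w'"
    and eq: "\<And>x y. x \<le> y \<Longrightarrow> c \<le> x \<Longrightarrow> integral {x..y} w = integral {x..y} w'"
  shows "AE x in lebesgue. c < x \<longrightarrow> w x = w' x"
proof -
  have "AE x in lebesgue. x \<in> {c<..} \<longrightarrow> w x = w' x"
  proof (rule AE_eq_if_interval_integrals_eq[OF w])
    fix x y :: real assume "x \<le> y"
    show "\<exists>p q. negligible (({x..y} \<inter> {c<..}) - {p..q} \<union> ({p..q} - ({x..y} \<inter> {c<..}))) \<and>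
        integral {p..q} w = integral {p..q} w'"
    proof (intro exI conjI)
      show "negligible (({x..y} \<inter> {c<..}) - {max x c..y} \<union> ({max x c..y} - ({x..y} \<inter> {c<..})))"
        by (rule negligible_subset[of "{c}"]) auto
      show "integral {max x c..y} w = integral {max x c..y} w'"
        by (cases "max x c \<le> y") (auto intro: eq)
    qed
  qed auto
  then show ?thesis by simp
qed

lemma Linfty_clip:
  fixes g :: "real \<Rightarrow> real"
  assumes "Linfty_on UNIV g"
  obtains K w where "bdd_meas K w" "AE x in lebesgue. w x = g x"
proof -
  obtain M where M: "AE x in lebesgue. \<bar>g x\<bar> \<le> M" and gm: "g \<in> borel_measurable lebesgue"
    using assms unfolding Linfty_on_def lebesgue_on_UNIV_eq by blast
  have "AE x in lebesgue. clip (max 0 M) (g x) = g x"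
    using M by eventually_elim (simp add: clip_id)
  moreover have "bdd_meas (max 0 M) (\<lambda>x. clip (max 0 M) (g x))"
    unfolding bdd_meas_def by (intro conjI allI clip_measurable gm clip_bound) simp
  ultimately show ?thesis by (rule that[rotated])
qed

lemma Linfty_integrable:
  fixes g :: "real \<Rightarrow> real"
  assumes "Linfty_on UNIV g"
  shows "g integrable_on {a..b}"
proof -
  obtain K w where w: "bdd_meas K w" "AE x in lebesgue. w x = g x" by (rule Linfty_clip[OF assms])
  show ?thesis using integral_cong_lebesgue_AE(2)[OF w(2)] bdd_meas_integrable[OF w(1)] by blast
qed

lemma Linfty_lin:
  fixes g h :: "real \<Rightarrow> real"
  assumes "Linfty_on UNIV g" "Linfty_on UNIV h"
  shows "Linfty_on UNIV (\<lambda>x. c + a * g x + b * h x)"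
proof -
  obtain K1 where K1: "AE x in lebesgue. \<bar>g x\<bar> \<le> K1" and gm: "g \<in> borel_measurable lebesgue"
    using assms unfolding Linfty_on_def lebesgue_on_UNIV_eq by blast
  obtain K2 where K2: "AE x in lebesgue. \<bar>h x\<bar> \<le> K2" and hm: "h \<in> borel_measurable lebesgue"
    using assms unfolding Linfty_on_def lebesgue_on_UNIV_eq by blast
  have "AE x in lebesgue. \<bar>c + a * g x + b * h x\<bar> \<le> \<bar>c\<bar> + \<bar>a\<bar> * K1 + \<bar>b\<bar> * K2"
    using K1 K2
  proof eventually_elim
    case (elim x)
    have "\<bar>a * g x\<bar> \<le> \<bar>a\<bar> * K1" "\<bar>b * h x\<bar> \<le> \<bar>b\<bar> * K2"
      unfolding abs_mult using elim by (auto intro: mult_left_mono)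
    then show ?case by linarith
  qed
  then show ?thesis unfolding Linfty_on_def lebesgue_on_UNIV_eq
    using gm hm by (intro conjI exI borel_measurable_add borel_measurable_times borel_measurable_const)
qed

text \<open>Links the Bochner integrals of the statement with the gauge integrals of the proof. The
  last assumption covers open intervals, which differ by endpoints, and half-lines outside a compact
  part of which \<open>g\<close> vanishes.\<close>

lemma set_integral_Linfty:
  fixes g :: "real \<Rightarrow> real"
  assumes g: "Linfty_on UNIV g" and S: "S \<in> sets lebesgue"
    and ae: "AE x in lebesgue. (x \<in> S \<longleftrightarrow> x \<in> {a..b}) \<or> g x = 0"
  shows "set_lebesgue_integral lebesgue S g = integral {a..b} g"
proof -
  obtain K w where w: "bdd_meas K w" "AE x in lebesgue. w x = g x" by (rule Linfty_clip[OF g])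
  have gm: "g \<in> borel_measurable lebesgue" using g unfolding Linfty_on_def lebesgue_on_UNIV_eq by blast
  have wm: "w \<in> borel_measurable lebesgue" using w unfolding bdd_meas_def by blast
  have "set_lebesgue_integral lebesgue S g = (\<integral>x. indicator {a..b} x *\<^sub>R w x \<partial>lebesgue)"
    unfolding set_lebesgue_integral_def
  proof (rule integral_cong_AE)
    show "AE x in lebesgue. indicator S x *\<^sub>R g x = indicator {a..b} x *\<^sub>R w x"
      using ae w(2) by eventually_elim (auto simp: indicator_def)
    show "(\<lambda>x. indicator S x *\<^sub>R g x) \<in> borel_measurable lebesgue"
      by (intro borel_measurable_scaleR borel_measurable_indicator S gm)
    show "(\<lambda>x. indicator {a..b} x *\<^sub>R w x) \<in> borel_measurable lebesgue"
      by (intro borel_measurable_scaleR borel_measurable_indicator wm) simp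
  qed
  also have "\<dots> = integral\<^sup>L (lebesgue_on {a..b}) w"
    by (subst integral_restrict_space) auto
  also have "\<dots> = integral {a..b} w" by (rule integral_lebesgue_on_Icc(2)[OF w(1)])
  also have "\<dots> = integral {a..b} g" by (rule integral_cong_lebesgue_AE(1)[OF w(2)])
  finally show ?thesis .
qed

lemma AE_lebesgue_neq: "AE x in lebesgue. x \<noteq> (c::real)"
  by (rule AE_completion) (rule AE_lborel_singleton)

lemma LINT_Linfty:
  fixes g :: "real \<Rightarrow> real"
  assumes g: "Linfty_on UNIV g" and "a \<le> b"
  shows "(LINT x=ereal a..ereal b|lebesgue. g x) = integral {a..b} g"
proof -
  have "AE x in lebesgue. (x \<in> {a<..<b} \<longleftrightarrow> x \<in> {a..b}) \<or> g x = 0"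
    using AE_lebesgue_neq[of a] AE_lebesgue_neq[of b] by eventually_elim auto
  then show ?thesis using assms
    by (simp add: interval_lebesgue_integral_def set_integral_Linfty)
qed

lemma LINT_prim:
  fixes g :: "real \<Rightarrow> real"
  assumes g: "Linfty_on UNIV g"
  shows "(LINT x=0..ereal b|lebesgue. g x) = prim g b"
proof (cases "0 \<le> b")
  case True
  then have "integral {b..0} g = 0" by (cases "b = 0") auto
  then show ?thesis using LINT_Linfty[OF g, of 0 b] True by (simp add: prim_def zero_ereal_def)
next
  case False
  then have "(LINT x=ereal b..ereal 0|lebesgue. g x) = integral {b..0} g" by (intro LINT_Linfty g) auto
  then show ?thesis using False
    by (simp add: prim_def interval_lebesgue_integral_def zero_ereal_def)
qed

lemma LINT_lower_half_line:
  fixes g :: "real \<Rightarrow> real"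
  assumes g: "Linfty_on UNIV g" and z: "AE x in lebesgue. x < - N \<longrightarrow> g x = 0" and "0 < N"
  shows "(LINT x=-\<infinity>..0|lebesgue. g x) = integral {-N..0} g"
proof -
  have e: "einterval (-\<infinity>) 0 = {..<0::real}" by (auto simp: einterval_def zero_ereal_def)
  have "AE x in lebesgue. (x \<in> {..<0} \<longleftrightarrow> x \<in> {-N..0}) \<or> g x = 0"
    using z AE_lebesgue_neq[of 0] by eventually_elim auto
  then show ?thesis
    by (simp add: interval_lebesgue_integral_def e set_integral_Linfty[OF g])
qed

lemma LINT_upper_half_line:
  fixes g :: "real \<Rightarrow> real"
  assumes g: "Linfty_on UNIV g" and z: "AE x in lebesgue. N < x \<longrightarrow> g x = 0" and "0 < N"
  shows "(LINT x=0..\<infinity>|lebesgue. g x) = integral {0..N} g"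
proof -
  have e: "einterval 0 \<infinity> = {0::real<..}" by (auto simp: einterval_def zero_ereal_def)
  have "AE x in lebesgue. (x \<in> {0<..} \<longleftrightarrow> x \<in> {0..N}) \<or> g x = 0"
    using z AE_lebesgue_neq[of 0] by eventually_elim auto
  then show ?thesis
    by (simp add: interval_lebesgue_integral_def e set_integral_Linfty[OF g])
qed

section \<open>Potentials of entropy solutions with periodic data\<close>

text \<open>What later arguments use of one solution and its potential. The three solutions have
  different constants \<open>M\<close>, \<open>F\<close> and \<open>E\<close>, so the facts are
  collected in an interface that is instantiated three times.\<close>

locale entropy_potential = convex_flux f f' f'' for f f' f'' +
  fixes u v U :: "real \<Rightarrow> real \<Rightarrow> real" and M F E :: real
  assumes E: "0 < E" and F: "0 \<le> F"
    and v: "\<And>t. 0 < t \<Longrightarrow> bdd_meas M (\<lambda>x. v x t)"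
    and vu: "\<And>t. 0 < t \<Longrightarrow> AE x in lebesgue. v x t = u x t"
    and U_diff: "\<And>t x y. 0 < t \<Longrightarrow> x \<le> y \<Longrightarrow> U y t - U x t = integral {x..y} (\<lambda>x. v x t)"
    and U_lip: "\<And>t x y. 0 \<le> t \<Longrightarrow> \<bar>U x t - U y t\<bar> \<le> M * \<bar>x - y\<bar>"
    and U_time_lip: "\<And>s t x. 0 \<le> s \<Longrightarrow> 0 \<le> t \<Longrightarrow> \<bar>U x t - U x s\<bar> \<le> F * \<bar>t - s\<bar>"
    and U_subsolution: "subsolution U"
    and comparison: "\<And>V x t. subsolution V \<Longrightarrow> (\<And>t. 0 \<le> t \<Longrightarrow> continuous_on UNIV (\<lambda>x. V x t)) \<Longrightarrow>
      (\<And>x. V x 0 \<le> U x 0) \<Longrightarrow> 0 \<le> t \<Longrightarrow> V x t \<le> U x t"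
    and between: "\<And>t l. 0 < t \<Longrightarrow> 0 < l \<Longrightarrow> AE x in lebesgue.
      (U (x + l) t - U x t) / l - E * l / t \<le> v x t \<and> v x t \<le> (U x t - U (x - l) t) / l + E * l / t"
begin

lemma U_cont: "0 \<le> t \<Longrightarrow> continuous_on S (\<lambda>x. U x t)"
proof (rule lipschitz_on_continuous_on[where L = M], rule lipschitz_onI)
  show "0 \<le> M" using bdd_meas_nonneg[OF v[OF zero_less_one]] .
qed (use U_lip in \<open>auto simp: dist_real_def\<close>)

end

lemma (in convex_flux) entropy_solution_potential:
  assumes ent: "entropy_solution f u0 u" and u0: "Linfty_on UNIV u0"
  obtains v U M F E where "entropy_potential f f' f'' u v U M F E" "\<And>x. U x 0 = prim u0 x"
proof -
  obtain M L E v where w: "weak_slices f v M L" and E: "0 < E"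
    and vu: "\<And>t. 0 < t \<Longrightarrow> AE x in lebesgue. v x t = u x t" and v0: "AE x in lebesgue. v x 0 = u0 x"
    and osl: "\<And>t a. 0 < t \<Longrightarrow> 0 < a \<Longrightarrow> AE x in lebesgue. v (x + a) t - v x t \<le> E * a / t"
    and mom: "\<And>R e t. 0 < R \<Longrightarrow> csmooth R e \<Longrightarrow> 0 \<le> t \<Longrightarrow>
      integral {-R..R} (\<lambda>x. v x t * e x) = integral {-R..R} (\<lambda>x. v x 0 * e x)
      + integral {0..t} (\<lambda>\<tau>. integral {-R..R} (\<lambda>x. f (v x \<tau>) * deriv e x))"
    by (rule entropy_solution_slices[OF f' f'_cont ent u0]) blast
  interpret S: osl_solution f f' f'' v M L E
    by (intro osl_solution.intro convex_flux_axioms w osl_solution_axioms.intro E osl mom)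
  have "entropy_potential f f' f'' u v S.U M S.F E"
  proof (intro entropy_potential.intro convex_flux_axioms entropy_potential_axioms.intro)
    show "AE x in lebesgue. (S.U (x + l) t - S.U x t) / l - E * l / t \<le> v x t \<and> v x t \<le> (S.U x t - S.U (x - l) t) / l + E * l / t"
      if "0 < t" "0 < l" for t l
      using S.v_between_slopes[OF that] by (simp add: S.slope_def)
    show "V x t \<le> S.U x t" if "subsolution V" "\<And>t. 0 \<le> t \<Longrightarrow> continuous_on UNIV (\<lambda>x. V x t)"
      "\<And>x. V x 0 \<le> S.U x 0" "0 \<le> t" for V x t
      by (rule S.comparison[OF that(1) _ _ that(4)]) (use that in auto)
  qed (use E S.F_nonneg S.slice vu S.U_diff S.U_lip S.U_time_lip S.U_subsolution in auto)
  moreover have "S.U x 0 = prim u0 x" for x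
    unfolding S.U_initial prim_def using integral_cong_lebesgue_AE(1)[OF v0] by simp
  ultimately show ?thesis by (rule that)
qed

locale periodic_potential = entropy_potential f f' f'' u v U M F E
  for f f' f'' u v U M F E +
  fixes a p :: real
  assumes p: "0 < p" and initial_period: "\<And>x. U (x + p) 0 = U x 0 + a * p"
begin

text \<open>The translates by \<open>p\<close> and by \<open>-p\<close>, corrected by
  \<open>a p\<close>, are subsolutions with the same initial values as \<open>U\<close>; comparison
  with \<open>U\<close> gives the two inequalities.\<close>

lemma period: assumes t: "0 \<le> t" shows "U (x + p) t = U x t + a * p"
proof (rule antisym)
  have c: "continuous_on UNIV (\<lambda>x. U (x + q) t + c)" if "0 \<le> t" for q c t
    by (intro continuous_intros continuous_on_compose2[OF U_cont[OF that, of UNIV]]) auto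
  have "U (x + p) t + (- (a * p)) \<le> U x t"
  proof (rule comparison[OF subsolution_translate[OF U_subsolution] c _ t])
    show "U (z + p) 0 + (- (a * p)) \<le> U z 0" for z using initial_period[of z] by simp
  qed
  then show "U (x + p) t \<le> U x t + a * p" by simp
  have "U (y + (- p)) t + a * p \<le> U y t" for y
  proof (rule comparison[OF subsolution_translate[OF U_subsolution] c _ t])
    show "U (z + (- p)) 0 + a * p \<le> U z 0" for z using initial_period[of "z - p"] by simp
  qed
  from this[of "x + p"] show "U x t + a * p \<le> U (x + p) t" by simp
qed

text \<open>Take one full period as averaging length: both difference quotients are then exactly
  \<open>a\<close>.\<close>

lemma slice_near_mean:
  assumes t: "0 < t"
  shows "AE x in lebesgue. \<bar>v x t - a\<bar> \<le> E * p / t"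
  using between[OF t p]
proof eventually_elim
  case (elim x)
  have "U (x + p) t - U x t = p * a" "U x t - U (x - p) t = p * a"
    using period[of t x] period[of t "x - p"] t by auto
  then show ?case using elim p by (simp add: abs_le_iff)
qed

definition low :: real where
  "low = (INF x. U x 0 - a * x)"

text \<open>Without its linear part the initial potential is continuous and periodic, so the minimum
  over one period is global and is attained again at all translates of the minimiser. The translates
  supply a minimum point near any prescribed foot point.\<close>

lemma low:
  obtains y where "U y 0 = a * y + low" "\<And>x. a * x + low \<le> U x 0" "\<And>k::int. U (y + k * p) 0 = a * (y + k * p) + low"
proof -
  define W where "W x = U x 0 - a * x" for x
  have per: "W (x + p) = W x" for x using initial_period[of x] by (simp add: W_def algebra_simps)
  have pern: "W (x + real n * p) = W x" for x n
  proof (induction n)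
    case (Suc n)
    have "x + real (Suc n) * p = (x + real n * p) + p" by (simp add: algebra_simps)
    then show ?case using per[of "x + real n * p"] Suc by (simp only:)
  qed simp
  have perk: "W (x + of_int k * p) = W x" for x and k :: int
  proof (cases "0 \<le> k")
    case True
    then show ?thesis using pern[of x "nat k"] by simp
  next
    case False
    then show ?thesis using pern[of "x + of_int k * p" "nat (- k)"] by simp
  qed
  have "continuous_on {0..p} W" unfolding W_def by (intro continuous_intros U_cont) auto
  then obtain y where y: "y \<in> {0..p}" "\<And>x. x \<in> {0..p} \<Longrightarrow> W y \<le> W x"
    using continuous_attains_inf[of "{0..p}" W] p by auto
  have min: "W y \<le> W x" for x
  proof -
    define k where "k = \<lfloor>x / p\<rfloor>"
    have k1: "of_int k \<le> x / p" "x / p < of_int k + 1" by (auto simp: k_def)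
    have k2: "of_int k * p \<le> x" "x < (of_int k + 1) * p"
      using k1 p by (simp_all add: pos_le_divide_eq pos_divide_less_eq)
    then have "x + of_int (- k) * p \<in> {0..p}" by (simp add: algebra_simps)
    then show ?thesis using y(2)[of "x + of_int (- k) * p"] perk[of x "- k"] by simp
  qed
  have lw: "low = W y"
    unfolding low_def W_def[symmetric] by (rule cInf_eq_minimum) (use min in auto)
  show ?thesis
  proof (rule that[of y])
    show "U y 0 = a * y + low" by (simp add: lw W_def)
    show "a * x + low \<le> U x 0" for x using min[of x] by (simp add: lw W_def)
    show "U (y + k * p) 0 = a * (y + k * p) + low" for k :: int
      using perk[of y k] by (simp add: lw W_def)
  qed
qed

lemma lower_bound:
  assumes "0 \<le> t" shows "a * x - f a * t + low \<le> U x t"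
proof (rule comparison[OF subsolution_plane _ _ assms])
  obtain y where "\<And>x. a * x + low \<le> U x 0" by (rule low) blast
  then show "a * x - f a * 0 + low \<le> U x 0" for x by simp
qed (intro continuous_intros)

text \<open>The Hopf--Lax bound, evaluated at a minimum point of the initial perturbation whose distance from
  the foot of the characteristic of speed \<open>f' a\<close> is at most one period.\<close>

lemma upper_bound:
  obtains C T where "0 \<le> C" "0 < T" "\<And>x t. T \<le> t \<Longrightarrow> U x t \<le> a * x - f a * t + low + C / t"
proof -
  obtain y0 where y0: "\<And>k::int. U (y0 + k * p) 0 = a * (y0 + k * p) + low" by (rule low) blast
  have "continuous_on {a..a + 1} f''" using f''_cont continuous_on_subset by blast
  then obtain z where "\<forall>x\<in>{a..a + 1}. f'' z \<le> f'' x"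
    using continuous_attains_inf[of "{a..a + 1}" f''] by auto
  then have z: "f'' z \<le> f'' x" if "x \<in> {a..a + 1}" for x using that by blast
  \<comment> \<open>A lower bound for the convexity on the range \<open>{a..a + 1}\<close>, to which
    the states of the connecting characteristics are confined.\<close>
  define \<kappa> where "\<kappa> = f'' z"
  have \<kappa>: "0 < \<kappa>" using f''_pos by (simp add: \<kappa>_def)
  have grow: "\<kappa> * (m - a) \<le> f' m - f' a" if m: "a \<le> m" "m \<le> a + 1" for m
  proof (cases "a = m")
    case False
    with m obtain w where w: "a < w" "w < m" "f' m - f' a = (m - a) * f'' w"
      using MVT2[of a m f' f''] f'' by auto
    have "\<kappa> * (m - a) \<le> f'' w * (m - a)"
      unfolding \<kappa>_def using w m by (intro mult_right_mono z) auto
    then show ?thesis using w by (simp add: mult.commute)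
  qed simp
  have d: "0 < f' (a + 1) - f' a" using f'_strict[of a "a + 1"] by simp
  \<comment> \<open>From this time on the characteristics with states in \<open>{a..a + 1}\<close>
    fan out over at least one period, so one of them connects the chosen minimum point to
    \<open>x\<close>.\<close>
  define T where "T = p / (f' (a + 1) - f' a)"
  have T: "0 < T" using p d by (simp add: T_def)
  have "U x t \<le> a * x - f a * t + low + (p\<^sup>2 / \<kappa>) / t" if t: "T \<le> t" for x t
  proof -
    have t0: "0 < t" using t T by simp
    define k where "k = \<lfloor>(x - t * f' a - y0) / p\<rfloor>"
    define y where "y = y0 + of_int k * p"
    define r where "r = x - t * f' a - y"
    have "of_int k \<le> (x - t * f' a - y0) / p" "(x - t * f' a - y0) / p < of_int k + 1" by (auto simp: k_def)
    then have "of_int k * p \<le> x - t * f' a - y0" "x - t * f' a - y0 < (of_int k + 1) * p"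
      using p by (simp_all add: pos_le_divide_eq pos_divide_less_eq)
    then have r: "0 \<le> r" "r \<le> p" by (auto simp: r_def y_def algebra_simps)
    have "p \<le> t * (f' (a + 1) - f' a)"
      using t d by (simp add: T_def pos_divide_le_eq)
    then have "r / t \<le> f' (a + 1) - f' a" using r t0 by (simp add: pos_divide_le_eq mult.commute)
    moreover have "0 \<le> r / t" using r t0 by simp
    ultimately obtain m where m: "a \<le> m" "m \<le> a + 1" "f' m = f' a + r / t"
      using IVT'[of f' a "f' a + r / t" "a + 1"] f'_cont by auto
    have xm: "x = y + t * f' m" using m(3) t0 by (simp add: r_def field_simps)
    have "U x t \<le> U y 0 + t * (m * f' m - f m)"
      using subsolutionD[OF U_subsolution order_refl less_imp_le[OF t0], of y m] xm by simp
    also have "U y 0 = a * y + low" using y0[of k] by (simp add: y_def)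
    finally have 1: "U x t \<le> a * x - f a * t + low + t * ((f a - f m) - (a - m) * f' m)"
      unfolding xm by (simp add: algebra_simps)
    obtain \<xi> where \<xi>: "min a m \<le> \<xi>" "\<xi> \<le> max a m" "f a - f m = f' \<xi> * (a - m)" by (rule f_mvt)
    \<comment> \<open>The excess over the plane is quadratic in the change of speed
      \<open>r / t\<close>; multiplied by \<open>t\<close> it becomes
      \<open>O(1 / t)\<close>.\<close>
    have "(f a - f m) - (a - m) * f' m = (m - a) * (f' m - f' \<xi>)" unfolding \<xi>(3) by (simp add: algebra_simps)
    also have "\<dots> \<le> (m - a) * (f' m - f' a)"
      using \<xi> m f'_mono[of a \<xi>] by (intro mult_left_mono) auto
    also have "\<dots> \<le> (r / t / \<kappa>) * (r / t)"
    proof (rule mult_mono)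
      show "m - a \<le> r / t / \<kappa>"
        unfolding pos_le_divide_eq[OF \<kappa>] using grow[OF m(1,2)] m(3) by (simp add: mult.commute)
    qed (use m r t0 \<kappa> in auto)
    finally have "t * ((f a - f m) - (a - m) * f' m) \<le> t * ((r / t / \<kappa>) * (r / t))"
      using t0 by (intro mult_left_mono) auto
    also have "\<dots> = r\<^sup>2 / \<kappa> / t" using t0 by (simp add: power2_eq_square)
    also have "\<dots> \<le> p\<^sup>2 / \<kappa> / t"
      using r \<kappa> t0 by (intro divide_right_mono power_mono) auto
    finally show ?thesis using 1 by simp
  qed
  then show ?thesis using T \<kappa> by (intro that[of "p\<^sup>2 / \<kappa>" T]) auto
qed

lemma slice_increment_bounds:
  assumes t: "0 < t" and xy: "x \<le> y"
  shows "(a - E * p / t) * (y - x) \<le> U y t - U x t" "U y t - U x t \<le> (a + E * p / t) * (y - x)"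
proof -
  have i: "(\<lambda>x. v x t) integrable_on {x..y}" by (rule bdd_meas_integrable[OF v[OF t]])
  have lo: "AE x in lebesgue. a - E * p / t \<le> v x t" and up: "AE x in lebesgue. v x t \<le> a + E * p / t"
    using slice_near_mean[OF t] by (eventually_elim, simp add: abs_le_iff)+
  have "integral {x..y} (\<lambda>_. a - E * p / t) \<le> integral {x..y} (\<lambda>x. v x t)"
    by (rule integral_mono_lebesgue_AE[OF _ i]) (use lo in \<open>auto elim: eventually_mono\<close>)
  then show "(a - E * p / t) * (y - x) \<le> U y t - U x t"
    using U_diff[OF t xy] xy by (simp add: mult.commute)
  have "integral {x..y} (\<lambda>x. v x t) \<le> integral {x..y} (\<lambda>_. a + E * p / t)"
    by (rule integral_mono_lebesgue_AE[OF i]) (use up in \<open>auto elim: eventually_mono\<close>)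
  then show "U y t - U x t \<le> (a + E * p / t) * (y - x)"
    using U_diff[OF t xy] xy by (simp add: mult.commute)
qed

end

section \<open>Formation of the shock\<close>

locale two_periodic_states = convex_flux f f' f'' +
  U: entropy_potential f f' f'' u v U M F E +
  P: periodic_potential f f' f'' ul vl P Ml Fl El a pl +
  Q: periodic_potential f f' f'' ur vr Q Mr Fr Er b pr
  for f f' f'' u v U M F E ul vl P Ml Fl El a pl ur vr Q Mr Fr Er b pr +
  fixes A B N :: real
  assumes ba: "b < a" and N: "0 < N" and U00: "U 0 0 = 0"
    and left_data: "\<And>x. x \<le> - N \<Longrightarrow> U x 0 = P x 0 + A"
    and right_data: "\<And>x. N \<le> x \<Longrightarrow> U x 0 = Q x 0 + B"
begin

definition m where "m = (a + b) / 2"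

text \<open>The gap in Jensen's inequality at the midpoint; it is positive by strict
  convexity.\<close>

definition \<gamma> where "\<gamma> = (f a + f b) / 2 - f m"

lemma \<gamma>_pos: "0 < \<gamma>"
proof -
  have ma: "m < a" using ba by (simp add: m_def)
  then obtain z where z: "m < z" "z < a" "f a - f m = (a - m) * f' z"
    using MVT2[of m a f f'] f' by blast
  have "f' m * (a - m) < f a - f m"
    unfolding z(3) using f'_strict[OF z(1)] ma by (simp add: mult.commute)
  moreover have "f' m * (b - m) \<le> f b - f m" using tangent[of m b] by simp
  moreover have "f' m * (a - m) + f' m * (b - m) = 0" by (simp add: m_def algebra_simps)
  ultimately show ?thesis by (simp add: \<gamma>_def)
qed

text \<open>The plane of slope \<open>m\<close> lies below the data where neither periodic state prescribes them; it overtakes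
  the smaller of the two shifted periodic potentials at the rate \<open>\<gamma>\<close>.\<close>

definition K where
  "K = \<bar>m\<bar> * N + M * N + \<bar>(a - m) * N - P.low - A\<bar> + \<bar>(m - b) * N - Q.low - B\<bar>"

definition Z where "Z x t = m * x - f m * t + (- K)"

lemma Z_subsolution: "subsolution Z"
  unfolding Z_def[abs_def] by (rule subsolution_plane)

lemma Z_cont: "continuous_on S (\<lambda>x. Z x t)"
  unfolding Z_def by (intro continuous_intros)

lemma M_nonneg: "0 \<le> M"
  using bdd_meas_nonneg[OF U.v[OF zero_less_one]] .

text \<open>At \<open>t = 0\<close> one of the three functions lies below \<open>U\<close> at each
  point: the shifted periodic potentials outside \<open>{-N..N}\<close>, where they equal
  \<open>U\<close>, and the plane inside, by the first two summands of \<open>K\<close>.\<close>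

lemma glued_below:
  assumes "0 \<le> t"
  shows "min (min (P x t + A) (Q x t + B)) (Z x t) \<le> U x t"
proof (rule U.comparison[OF _ _ _ assms])
  show "subsolution (\<lambda>x t. min (min (P x t + A) (Q x t + B)) (Z x t))"
    by (intro subsolution_min subsolution_add P.U_subsolution Q.U_subsolution Z_subsolution)
  show "continuous_on UNIV (\<lambda>x. min (min (P x t + A) (Q x t + B)) (Z x t))" if "0 \<le> t" for t
    by (intro continuous_intros P.U_cont Q.U_cont Z_cont that)
  fix x
  consider "x \<le> - N" | "N \<le> x" | "\<bar>x\<bar> \<le> N" by linarith
  then show "min (min (P x 0 + A) (Q x 0 + B)) (Z x 0) \<le> U x 0"
  proof cases
    case 1 then show ?thesis using left_data by simp
  next
    case 2 then show ?thesis using right_data by simp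
  next
    case 3
    have "\<bar>U x 0\<bar> \<le> M * \<bar>x\<bar>" using U.U_lip[of 0 x 0] U00 by simp
    also have "\<dots> \<le> M * N" using 3 M_nonneg by (intro mult_left_mono)
    finally have 1: "- (M * N) \<le> U x 0" by linarith
    have "\<bar>m * x\<bar> \<le> \<bar>m\<bar> * N" unfolding abs_mult using 3 by (intro mult_left_mono) auto
    then have "m * x \<le> \<bar>m\<bar> * N" by linarith
    then have "Z x 0 \<le> U x 0" unfolding Z_def K_def using 1 by linarith
    then show ?thesis by simp
  qed
qed

text \<open>To the right of \<open>-N\<close> the plane takes over: its slope is below
  \<open>a\<close>, so the third summand of \<open>K\<close> places it below the plane that bounds
  \<open>P + A\<close> from below. \<open>right_above\<close> is the mirror image with
  \<open>b\<close> and the fourth summand.\<close>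

lemma left_above:
  assumes "0 \<le> t"
  shows "min (U x t) (Z x t) \<le> P x t + A"
proof -
  have "min (U x t) (Z x t) + (- A) \<le> P x t"
  proof (rule P.comparison[OF _ _ _ assms])
    show "subsolution (\<lambda>x t. min (U x t) (Z x t) + (- A))"
      by (intro subsolution_min subsolution_add U.U_subsolution Z_subsolution)
    show "continuous_on UNIV (\<lambda>x. min (U x t) (Z x t) + (- A))" if "0 \<le> t" for t
      by (intro continuous_intros U.U_cont Z_cont that)
    fix x
    show "min (U x 0) (Z x 0) + (- A) \<le> P x 0"
    proof (cases "x \<le> - N")
      case False
      have "(a - m) * (- N) \<le> (a - m) * x" using False ba by (intro mult_left_mono) (auto simp: m_def)
      then have "m * x \<le> a * x + (a - m) * N" by (simp add: algebra_simps)
      moreover have "0 \<le> \<bar>m\<bar> * N + M * N" using N M_nonneg by simp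
      ultimately have "Z x 0 \<le> a * x - f a * 0 + P.low + A" unfolding Z_def K_def by linarith
      then show ?thesis using P.lower_bound[of 0 x] by simp
    qed (use left_data in simp)
  qed
  then show ?thesis by simp
qed

lemma right_above:
  assumes "0 \<le> t"
  shows "min (U x t) (Z x t) \<le> Q x t + B"
proof -
  have "min (U x t) (Z x t) + (- B) \<le> Q x t"
  proof (rule Q.comparison[OF _ _ _ assms])
    show "subsolution (\<lambda>x t. min (U x t) (Z x t) + (- B))"
      by (intro subsolution_min subsolution_add U.U_subsolution Z_subsolution)
    show "continuous_on UNIV (\<lambda>x. min (U x t) (Z x t) + (- B))" if "0 \<le> t" for t
      by (intro continuous_intros U.U_cont Z_cont that)
    fix x
    show "min (U x 0) (Z x 0) + (- B) \<le> Q x 0"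
    proof (cases "N \<le> x")
      case False
      have "(m - b) * x \<le> (m - b) * N" using False ba by (intro mult_left_mono) (auto simp: m_def)
      then have "m * x \<le> b * x + (m - b) * N" by (simp add: algebra_simps)
      moreover have "0 \<le> \<bar>m\<bar> * N + M * N" using N M_nonneg by simp
      ultimately have "Z x 0 \<le> b * x - f b * 0 + Q.low + B" unfolding Z_def K_def by linarith
      then show ?thesis using Q.lower_bound[of 0 x] by simp
    qed (use right_data in simp)
  qed
  then show ?thesis by simp
qed

text \<open>The abscissa at which the asymptotic planes of \<open>P + A\<close> and
  \<open>Q + B\<close> meet when extended back to \<open>t = 0\<close>.\<close>

definition shift :: real where
  "shift = (B - A - P.low + Q.low) / (a - b)"

lemma shock_curve:
  obtains T X C where "0 < T" "0 \<le> C"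
    "\<And>t. T < t \<Longrightarrow> El * pl / t + Er * pr / t < a - b"
    "\<And>t x. T < t \<Longrightarrow> x \<le> X t \<Longrightarrow> U x t = P x t + A"
    "\<And>t x. T < t \<Longrightarrow> X t \<le> x \<Longrightarrow> U x t = Q x t + B"
    "\<exists>L. L-lipschitz_on {T<..} X"
    "\<And>t. T < t \<Longrightarrow> \<bar>X t - (f a - f b) / (a - b) * t - shift\<bar> \<le> C / t"
proof -
  obtain Cl Tl where l: "0 \<le> Cl" "0 < Tl" "\<And>x t. Tl \<le> t \<Longrightarrow> P x t \<le> a * x - f a * t + P.low + Cl / t"
    by (rule P.upper_bound) blast
  obtain Cr Tr where r: "0 \<le> Cr" "0 < Tr" "\<And>x t. Tr \<le> t \<Longrightarrow> Q x t \<le> b * x - f b * t + Q.low + Cr / t"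
    by (rule Q.upper_bound) blast
  define c where "c = \<bar>P.low + A\<bar> + Cl / Tl + \<bar>Q.low + B\<bar> + Cr / Tr"
  define e where "e = El * pl + Er * pr"
  have e: "0 < e" using P.E P.p Q.E Q.p by (simp add: e_def add_pos_pos)
  have ab: "0 < a - b" using ba by simp
  \<comment> \<open>Four requirements: the two Hopf-Lax bounds are in force, the plane has overtaken
    the smaller potential, and the gradients of the two potentials stay at least
    \<open>(a - b) / 2\<close> apart.\<close>
  define T where "T = max (max Tl Tr) (max (\<bar>K + c\<bar> / \<gamma>) (2 * e / (a - b)))"
  have TT: "Tl \<le> T" "Tr \<le> T" "\<bar>K + c\<bar> / \<gamma> \<le> T" "2 * e / (a - b) \<le> T" by (auto simp: T_def)
  have T0: "0 < T" using TT(1) l(2) by linarith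
  have et: "e / t \<le> (a - b) / 2" if "T < t" for t
  proof -
    have "2 * e / (a - b) \<le> t" using that TT(4) by linarith
    then have "2 * e \<le> t * (a - b)" using ab by (simp add: pos_divide_le_eq)
    then have "e \<le> (a - b) / 2 * t" by (simp add: field_simps)
    moreover have "0 < t" using that T0 by simp
    ultimately show ?thesis by (simp only: pos_divide_le_eq)
  qed
  have e_split: "El * pl / t + Er * pr / t = e / t" for t by (simp add: e_def add_divide_distrib)
  define D where "D x t = P x t + A - (Q x t + B)" for x t
  have Zmin: "min (P x t + A) (Q x t + B) < Z x t" if t: "T < t" for x t
  proof -
    have t0: "0 < t" using t T0 by simp
    have "Cl / t \<le> Cl / Tl" using t TT l by (intro divide_left_mono mult_pos_pos) auto
    moreover have "Cr / t \<le> Cr / Tr" using t TT r by (intro divide_left_mono mult_pos_pos) auto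
    moreover have "0 \<le> Cl / Tl" "0 \<le> Cr / Tr" using l r by auto
    moreover have "P x t \<le> a * x - f a * t + P.low + Cl / t" using t TT by (intro l) auto
    moreover have "Q x t \<le> b * x - f b * t + Q.low + Cr / t" using t TT by (intro r) auto
    ultimately have "P x t + A \<le> a * x - f a * t + c" "Q x t + B \<le> b * x - f b * t + c"
      unfolding c_def by linarith+
    \<comment> \<open>The minimum is at most the mean, and the mean of the two asymptotic planes is
      the plane of slope \<open>m\<close>, except that it falls faster by \<gamma> per unit
      time.\<close>
    then have "2 * min (P x t + A) (Q x t + B) \<le> (a * x - f a * t + c) + (b * x - f b * t + c)"
      by (simp add: min_def)
    then have "min (P x t + A) (Q x t + B) \<le> ((a * x - f a * t) + (b * x - f b * t)) / 2 + c"
      by (simp add: field_simps)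
    also have "\<dots> = m * x - f m * t - \<gamma> * t + c" by (simp add: m_def \<gamma>_def field_simps)
    also have "\<dots> < Z x t"
    proof -
      have "\<bar>K + c\<bar> / \<gamma> < t" using t TT(3) by linarith
      then have "\<bar>K + c\<bar> < t * \<gamma>" using \<gamma>_pos by (simp add: pos_divide_less_eq)
      then show ?thesis unfolding Z_def by (simp add: mult.commute)
    qed
    finally show ?thesis .
  qed
  have glue: "U x t = min (P x t + A) (Q x t + B)" if t: "T < t" for x t
  proof -
    have t0: "0 \<le> t" using t T0 by simp
    show ?thesis using glued_below[OF t0, of x] left_above[OF t0, of x] right_above[OF t0, of x] Zmin[OF t, of x]
      by linarith
  qed
  \<comment> \<open>Strict growth of \<open>D\<close> in \<open>x\<close> yields that its sign
    changes only at \<open>X t\<close>, and also the Lipschitz bound for the curve.\<close>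
  have inc: "(a - b) / 2 * (y - x) \<le> D y t - D x t" if t: "T < t" and xy: "x \<le> y" for t x y
  proof -
    have t0: "0 < t" using t T0 by simp
    have "(a - b - e / t) * (y - x) \<le> D y t - D x t"
      using P.slice_increment_bounds(1)[OF t0 xy] Q.slice_increment_bounds(2)[OF t0 xy]
      unfolding D_def e_split[symmetric] by (simp add: algebra_simps)
    moreover have "(a - b) / 2 * (y - x) \<le> (a - b - e / t) * (y - x)"
      using et[OF t] xy by (intro mult_right_mono) auto
    ultimately show ?thesis by linarith
  qed
  define C where "C = Cl + Cr"
  have C: "0 \<le> C" using l r by (simp add: C_def)
  define \<sigma> where "\<sigma> = (f a - f b) / (a - b)"
  have asym: "\<bar>D x t - (a - b) * (x - \<sigma> * t - shift)\<bar> \<le> C / t" if t: "T < t" for x t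
  proof -
    have t0: "0 < t" using t T0 by simp
    have "(a - b) * \<sigma> = f a - f b" "(a - b) * shift = B - A - P.low + Q.low"
      using ab by (simp_all add: \<sigma>_def shift_def)
    then have eq: "(a - b) * (x - \<sigma> * t - shift) = (a * x - f a * t + P.low + A) - (b * x - f b * t + Q.low + B)"
      by (simp add: right_diff_distrib mult.assoc[symmetric]) (simp add: algebra_simps)
    have "P x t \<le> a * x - f a * t + P.low + Cl / t" using t TT by (intro l) auto
    moreover have "Q x t \<le> b * x - f b * t + Q.low + Cr / t" using t TT by (intro r) auto
    moreover have "0 \<le> Cl / t" "0 \<le> Cr / t" using l r t0 by auto
    ultimately show ?thesis
      using P.lower_bound[of t x] Q.lower_bound[of t x] t0 unfolding eq D_def C_def add_divide_distrib abs_le_iff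
      by linarith
  qed
  have Dcont: "continuous_on S (\<lambda>x. D x t)" if "0 \<le> t" for t S
    unfolding D_def by (intro continuous_intros P.U_cont Q.U_cont that)
  have "\<exists>x. D x t = 0" if t: "T < t" for t
  proof -
    have t0: "0 < t" using t T0 by simp
    \<comment> \<open>\<open>D\<close> differs by at most \<open>C / t\<close> from a linear
      function of slope \<open>a - b\<close>, so its zero is within \<open>q\<close> of the zero of
      that function.\<close>
    define q where "q = C / t / (a - b)"
    have q: "0 \<le> q" "(a - b) * q = C / t" using C t0 ab by (auto simp: q_def)
    have "D (\<sigma> * t + shift - q) t \<le> 0"
      using asym[OF t, of "\<sigma> * t + shift - q"] q(2) by (simp add: abs_le_iff)
    moreover have "0 \<le> D (\<sigma> * t + shift + q) t"
      using asym[OF t, of "\<sigma> * t + shift + q"] q(2) by (simp add: abs_le_iff)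
    ultimately show ?thesis
      using IVT'[of "\<lambda>x. D x t" "\<sigma> * t + shift - q" 0 "\<sigma> * t + shift + q"] q(1) Dcont t0 by auto
  qed
  then obtain X where X: "\<And>t. T < t \<Longrightarrow> D (X t) t = 0" by metis
  show ?thesis
  proof (rule that[of T "C / (a - b)" X])
    show "0 < T" by (rule T0)
    show "0 \<le> C / (a - b)" using C ab by simp
    show "El * pl / t + Er * pr / t < a - b" if "T < t" for t
      unfolding e_split by (rule le_less_trans[OF et[OF that]]) (use ab in simp)
    show "U x t = P x t + A" if "T < t" "x \<le> X t" for t x
    proof -
      have "0 \<le> (a - b) / 2 * (X t - x)" using that ab by simp
      then have "D x t \<le> 0" using inc[OF that] X[OF that(1)] by linarith
      then show ?thesis using glue[OF that(1), of x] by (simp add: D_def min_def)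
    qed
    show "U x t = Q x t + B" if "T < t" "X t \<le> x" for t x
    proof -
      have "0 \<le> (a - b) / 2 * (x - X t)" using that ab by simp
      then have "0 \<le> D x t" using inc[OF that] X[OF that(1)] by linarith
      then show ?thesis using glue[OF that(1), of x] by (simp add: D_def min_def)
    qed
    show "\<bar>X t - (f a - f b) / (a - b) * t - shift\<bar> \<le> C / (a - b) / t" if t: "T < t" for t
    proof -
      have "(a - b) * \<bar>X t - \<sigma> * t - shift\<bar> \<le> C / t"
        using asym[OF t, of "X t"] X[OF t] ab by (simp add: abs_mult)
      then have "\<bar>X t - \<sigma> * t - shift\<bar> \<le> C / t / (a - b)"
        by (simp only: pos_le_divide_eq[OF ab] mult.commute)
      then show ?thesis by (simp add: \<sigma>_def mult.commute)
    qed
    \<comment> \<open>The time Lipschitz constant \<open>Fl + Fr\<close> of \<open>D\<close> divided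
      by its least slope \<open>(a - b) / 2\<close> in space.\<close>
    define L where "L = 2 * (Fl + Fr) / (a - b)"
    have "L-lipschitz_on {T<..} X"
    proof (rule lipschitz_onI)
      show "0 \<le> L" using P.F Q.F ab by (simp add: L_def)
      fix t s assume ts: "t \<in> {T<..}" "s \<in> {T<..}"
      have s0: "0 \<le> s" "0 \<le> t" using ts T0 by auto
      have 1: "(a - b) / 2 * \<bar>X t - X s\<bar> \<le> \<bar>D (X t) s - D (X s) s\<bar>"
      proof (cases "X s \<le> X t")
        case True
        then show ?thesis
          using order_trans[OF inc[of s "X s" "X t"] abs_ge_self] ts by simp
      next
        case False
        then show ?thesis
          using order_trans[OF inc[of s "X t" "X s"] abs_ge_self] ts by (simp add: abs_minus_commute)
      qed
      \<comment> \<open>As \<open>D\<close> vanishes at both points of the curve, the increment in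
        space at time \<open>s\<close> becomes one in time at the fixed point
        \<open>X t\<close>.\<close>
      have "D (X t) s - D (X s) s = (P (X t) s - P (X t) t) - (Q (X t) s - Q (X t) t)"
        using X[of s] X[of t] ts by (simp add: D_def)
      also have "\<bar>\<dots>\<bar> \<le> Fl * \<bar>s - t\<bar> + Fr * \<bar>s - t\<bar>"
        using P.U_time_lip[OF s0(2,1), of "X t"] Q.U_time_lip[OF s0(2,1), of "X t"] by linarith
      finally have "(a - b) / 2 * \<bar>X t - X s\<bar> \<le> (Fl + Fr) * \<bar>s - t\<bar>" using 1 by (simp add: distrib_right)
      then have "\<bar>X t - X s\<bar> \<le> (Fl + Fr) * \<bar>s - t\<bar> * 2 / (a - b)"
        unfolding pos_le_divide_eq[OF ab] by (simp add: mult.commute)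
      then show "dist (X t) (X s) \<le> L * dist t s"
        by (simp add: dist_real_def L_def abs_minus_commute algebra_simps)
    qed
    then show "\<exists>L. L-lipschitz_on {T<..} X" by blast
  qed
qed

end

section \<open>Primitives of the data and conclusion\<close>

lemma prim_const_add:
  assumes w: "\<And>a b. w integrable_on {a..b}"
  shows "prim (\<lambda>x. a + w x) x = a * x + prim w x"
proof -
  have "integral {p..q} (\<lambda>x. a + w x) = a * (q - p) + integral {p..q} w" if "p \<le> q" for p q
    using that by (subst Henstock_Kurzweil_Integration.integral_add) (auto intro: w)
  from this[of 0 x] this[of x 0] show ?thesis
    by (cases "0 \<le> x"; cases "x = 0") (auto simp: prim_def algebra_simps)
qed

lemma prim_periodic:
  assumes w: "Linfty_on UNIV w" and per: "periodic_ae p w" and p: "0 < p" and mean: "integral {0..p} w = 0"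
  shows "prim w (x + p) = prim w x"
proof -
  have i: "w integrable_on {a..b}" for a b by (rule Linfty_integrable[OF w])
  have sh: "integral {a + p..b + p} w = integral {a..b} w" for a b
  proof -
    have "integral {a + p..b + p} w = integral {a..b} (\<lambda>x. w (x + p))"
      using integral_shift_real_ivl[of "a + p" p "b + p" w] by simp
    also have "\<dots> = integral {a..b} w"
      by (rule integral_cong_lebesgue_AE(1)) (use per in \<open>simp add: periodic_ae_def\<close>)
    finally show ?thesis .
  qed
  have d: "prim w (b + p) - prim w (a + p) = prim w b - prim w a" if "a \<le> b" for a b
    using prim_diff[OF i, of a b] prim_diff[OF i, of "a + p" "b + p"] sh[of a b] that by simp
  have "prim w p = 0" using prim_diff[OF i, of 0 p] p mean by simp
  then show ?thesis using d[of 0 x] d[of x 0] by (cases "0 \<le> x") auto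
qed

lemma Linfty_const_add: "Linfty_on UNIV w \<Longrightarrow> Linfty_on UNIV (\<lambda>x::real. c + w x)"
  using Linfty_lin[of w w c 1 0] by simp

lemma prim_AE_diff:
  assumes g: "Linfty_on UNIV g" "Linfty_on UNIV h" and "x \<le> y"
    and eq: "AE z in lebesgue. z \<in> {x..y} \<longrightarrow> g z = h z"
  shows "prim g y - prim g x = prim h y - prim h x"
proof -
  have "integral {x..y} g = integral {x..y} h"
    by (rule antisym; rule integral_mono_lebesgue_AE)
       (use eq in \<open>auto intro!: Linfty_integrable g elim: eventually_mono\<close>)
  then show ?thesis
    using prim_diff[OF Linfty_integrable[OF g(1)] assms(3)] prim_diff[OF Linfty_integrable[OF g(2)] assms(3)] by simp
qed

text \<open>The integrands vanish beyond \<open>N\<close> on their half-lines, so both improper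
  integrals are finite and become values of primitives at \<open>N\<close> and \<open>-N\<close>;
  these are the constants \<open>B\<close> and \<open>-A\<close> of the shock formation.\<close>

lemma shock_shift_prim:
  assumes "0 < N" and w: "Linfty_on UNIV w0l" "Linfty_on UNIV w0r" and u0: "Linfty_on UNIV u0"
    and left: "AE x in lebesgue. x < - N \<longrightarrow> u0 x = ul + w0l x"
    and right: "AE x in lebesgue. N < x \<longrightarrow> u0 x = ur + w0r x"
  shows "shock_shift ul ur w0l w0r u0 =
    ((prim u0 N - prim (\<lambda>x. ur + w0r x) N) - (prim u0 (- N) - prim (\<lambda>x. ul + w0l x) (- N))
      - (INF x. prim w0l x) + (INF x. prim w0r x)) / (ul - ur)"
proof -
  have g: "Linfty_on UNIV (\<lambda>y. u0 y - c - w y)" if "Linfty_on UNIV w" for c and w :: "real \<Rightarrow> real"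
    using Linfty_lin[OF u0 that, of "- c" 1 "- 1"] by (simp add: algebra_simps)
  have d: "integral {p..q} (\<lambda>y. u0 y - c - w y)
      = (prim u0 q - prim u0 p) - (prim (\<lambda>x. c + w x) q - prim (\<lambda>x. c + w x) p)"
    if w: "Linfty_on UNIV w" and pq: "p \<le> q" for c p q and w :: "real \<Rightarrow> real"
  proof -
    have "integral {p..q} (\<lambda>y. u0 y - (c + w y)) = integral {p..q} u0 - integral {p..q} (\<lambda>y. c + w y)"
      by (rule Henstock_Kurzweil_Integration.integral_diff) (intro Linfty_integrable u0 Linfty_const_add w)+
    then show ?thesis
      using prim_diff[OF Linfty_integrable[OF u0] pq] prim_diff[OF Linfty_integrable[OF Linfty_const_add[OF w, of c]] pq]
      by (simp add: algebra_simps)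
  qed
  have "(LINT y=(-\<infinity>)..0|lebesgue. (u0 y - ul - w0l y)) = integral {-N..0} (\<lambda>y. u0 y - ul - w0l y)"
    by (rule LINT_lower_half_line[OF g[OF w(1)] _ assms(1)]) (use left in \<open>auto elim: eventually_mono\<close>)
  moreover have "(LINT y=0..\<infinity>|lebesgue. (u0 y - ur - w0r y)) = integral {0..N} (\<lambda>y. u0 y - ur - w0r y)"
    by (rule LINT_upper_half_line[OF g[OF w(2)] _ assms(1)]) (use right in \<open>auto elim: eventually_mono\<close>)
  ultimately show ?thesis
    unfolding shock_shift_def LINT_prim[OF w(1)] LINT_prim[OF w(2)] using assms(1) by (simp add: d w)
qed

lemma esssup_le_AE:
  assumes g: "Linfty_on UNIV g" and S: "S \<in> sets lebesgue"
    and ae: "AE x in lebesgue. x \<in> S \<longrightarrow> \<bar>g x - a\<bar> \<le> c"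
  shows "esssup (lebesgue_on S) (\<lambda>x::real. ereal \<bar>g x - a\<bar>) \<le> ereal c"
proof (rule esssup_I)
  have "g \<in> borel_measurable (lebesgue_on S)"
    using g unfolding Linfty_on_def lebesgue_on_UNIV_eq by (auto intro: measurable_restrict_space1)
  then show "(\<lambda>x. ereal \<bar>g x - a\<bar>) \<in> borel_measurable (lebesgue_on S)" by measurable
  show "AE x in lebesgue_on S. ereal \<bar>g x - a\<bar> \<le> ereal c" using ae S by (simp add: AE_lebesgue_on_iff)
qed

lemma interval_not_AE_excluded:
  assumes "x < (y::real)" shows "\<not> (AE z in lebesgue. \<not> (x < z \<and> z < y))"
proof
  assume "AE z in lebesgue. \<not> (x < z \<and> z < y)"
  then have "AE z in lborel. z \<notin> {x<..<y}" by (simp add: AE_completion_iff)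
  then have "{x<..<y} \<in> null_sets lborel" by (subst AE_iff_null_sets) auto
  then show False using assms by (auto simp: null_sets_def)
qed

theorem theorem2p1:
  fixes f f' f'' :: "real \<Rightarrow> real"
    and ubar_l ubar_r p_l p_r N s X_inf :: real
    and w0l w0r u0 :: "real \<Rightarrow> real"
    and u u_l u_r :: "real \<Rightarrow> real \<Rightarrow> real"
  assumes "\<And>x. (f has_real_derivative f' x) (at x)"
    and "\<And>x. (f' has_real_derivative f'' x) (at x)"
    and "continuous_on UNIV f''"
    and "\<And>x. f'' x > 0"
    and "ubar_l > ubar_r"
    and "Linfty_on UNIV w0l" and "Linfty_on UNIV w0r"
    and "p_l > 0" and "p_r > 0"
    and "periodic_ae p_l w0l" and "periodic_ae p_r w0r"
    and "1 / p_l * (LINT x=0..ereal p_l|lebesgue. w0l x) = 0"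
    and "1 / p_r * (LINT x=0..ereal p_r|lebesgue. w0r x) = 0"
    and "N > 0"
    and "Linfty_on UNIV u0"
    and "AE x in lebesgue. x < -N \<longrightarrow> u0 x = ubar_l + w0l x"
    and "AE x in lebesgue. x > N \<longrightarrow> u0 x = ubar_r + w0r x"
    and "entropy_solution f u0 u"
    and "entropy_solution f (\<lambda>x. ubar_l + w0l x) u_l"
    and "entropy_solution f (\<lambda>x. ubar_r + w0r x) u_r"
    and "s = (f ubar_l - f ubar_r) / (ubar_l - ubar_r)"
    and "X_inf = shock_shift ubar_l ubar_r w0l w0r u0"
  shows "\<exists>T_S>0. \<exists>X :: real \<Rightarrow> real.
           glues_along T_S X u u_l u_r \<and>
           (\<forall>Y. glues_along T_S Y u u_l u_r \<longrightarrow> (\<forall>t>T_S. Y t = X t)) \<and>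
           (\<exists>C>0. \<forall>t>T_S.
              esssup (lebesgue_on {..<X t}) (\<lambda>x. ereal \<bar>u x t - ubar_l\<bar>)
              + esssup (lebesgue_on {X t<..}) (\<lambda>x. ereal \<bar>u x t - ubar_r\<bar>)
              + ereal \<bar>X t - s * t - X_inf\<bar> \<le> ereal (C / t))"
proof -
  note w0l = \<open>Linfty_on UNIV w0l\<close> and w0r = \<open>Linfty_on UNIV w0r\<close> and u0 = \<open>Linfty_on UNIV u0\<close>
  interpret flux: convex_flux f f' f'' by unfold_locales (fact assms)+
  obtain v U M F E where U: "entropy_potential f f' f'' u v U M F E" and U0: "\<And>x. U x 0 = prim u0 x"
    by (rule flux.entropy_solution_potential[OF \<open>entropy_solution f u0 u\<close> u0]) blast
  obtain vl P Ml Fl El where P: "entropy_potential f f' f'' u_l vl P Ml Fl El"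
    and P0: "\<And>x. P x 0 = prim (\<lambda>x. ubar_l + w0l x) x"
    by (rule flux.entropy_solution_potential[OF \<open>entropy_solution f (\<lambda>x. ubar_l + w0l x) u_l\<close> Linfty_const_add[OF w0l]]) blast
  obtain vr Q Mr Fr Er where Q: "entropy_potential f f' f'' u_r vr Q Mr Fr Er"
    and Q0: "\<And>x. Q x 0 = prim (\<lambda>x. ubar_r + w0r x) x"
    by (rule flux.entropy_solution_potential[OF \<open>entropy_solution f (\<lambda>x. ubar_r + w0r x) u_r\<close> Linfty_const_add[OF w0r]]) blast
  have P0': "P x 0 = ubar_l * x + prim w0l x" and Q0': "Q x 0 = ubar_r * x + prim w0r x" for x
    unfolding P0 Q0 by (rule prim_const_add; rule Linfty_integrable; fact)+
  have mean: "integral {0..p_l} w0l = 0" "integral {0..p_r} w0r = 0"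
    using LINT_Linfty[OF w0l, of 0 p_l] LINT_Linfty[OF w0r, of 0 p_r] assms(8,9,12,13)
    by (simp_all add: zero_ereal_def)
  define A where "A = U (- N) 0 - P (- N) 0"
  define B where "B = U N 0 - Q N 0"
  have left: "U x 0 = P x 0 + A" if "x \<le> - N" for x
  proof -
    have "prim u0 (- N) - prim u0 x = prim (\<lambda>x. ubar_l + w0l x) (- N) - prim (\<lambda>x. ubar_l + w0l x) x"
    proof (rule prim_AE_diff[OF u0 Linfty_const_add[OF w0l] that])
      show "AE z in lebesgue. z \<in> {x..- N} \<longrightarrow> u0 z = ubar_l + w0l z"
        using assms(16) AE_lebesgue_neq[of "- N"] by eventually_elim auto
    qed
    then show ?thesis by (simp add: A_def U0 P0)
  qed
  have right: "U x 0 = Q x 0 + B" if "N \<le> x" for x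
  proof -
    have "prim u0 x - prim u0 N = prim (\<lambda>x. ubar_r + w0r x) x - prim (\<lambda>x. ubar_r + w0r x) N"
    proof (rule prim_AE_diff[OF u0 Linfty_const_add[OF w0r] that])
      show "AE z in lebesgue. z \<in> {N..x} \<longrightarrow> u0 z = ubar_r + w0r z"
        using assms(17) AE_lebesgue_neq[of N] by eventually_elim auto
    qed
    then show ?thesis by (simp add: B_def U0 Q0)
  qed
  interpret U: entropy_potential f f' f'' u v U M F E by (rule U)
  interpret P: entropy_potential f f' f'' u_l vl P Ml Fl El by (rule P)
  interpret Q: entropy_potential f f' f'' u_r vr Q Mr Fr Er by (rule Q)
  interpret P: periodic_potential f f' f'' u_l vl P Ml Fl El ubar_l p_l
    by unfold_locales
       (use assms(8) prim_periodic[OF w0l \<open>periodic_ae p_l w0l\<close> assms(8) mean(1)] in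
         \<open>auto simp: P0' algebra_simps\<close>)
  interpret Q: periodic_potential f f' f'' u_r vr Q Mr Fr Er ubar_r p_r
    by unfold_locales
       (use assms(9) prim_periodic[OF w0r \<open>periodic_ae p_r w0r\<close> assms(9) mean(2)] in
         \<open>auto simp: Q0' algebra_simps\<close>)
  interpret S: two_periodic_states f f' f'' u v U M F E u_l vl P Ml Fl El ubar_l p_l u_r vr Q Mr Fr Er ubar_r p_r A B N
    by unfold_locales (use assms(5,14) left right U0 in auto)
  obtain T X C where T: "0 < T" and C: "0 \<le> C"
    and sep: "\<And>t. T < t \<Longrightarrow> El * p_l / t + Er * p_r / t < ubar_l - ubar_r"
    and Ul: "\<And>t x. T < t \<Longrightarrow> x \<le> X t \<Longrightarrow> U x t = P x t + A"
    and Ur: "\<And>t x. T < t \<Longrightarrow> X t \<le> x \<Longrightarrow> U x t = Q x t + B"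
    and Xlip: "\<exists>L. L-lipschitz_on {T<..} X"
    and Xasym: "\<And>t. T < t \<Longrightarrow> \<bar>X t - (f ubar_l - f ubar_r) / (ubar_l - ubar_r) * t - S.shift\<bar> \<le> C / t"
    by (rule S.shock_curve) blast
  have shift: "S.shift = X_inf"
  proof -
    have "P.low = (INF x. prim w0l x)" "Q.low = (INF x. prim w0r x)"
      by (simp_all add: P.low_def Q.low_def P0' Q0')
    then show ?thesis
      unfolding S.shift_def assms(22)
      by (subst shock_shift_prim[OF assms(14) w0l w0r u0 assms(16,17)]) (simp add: A_def B_def U0 P0 Q0)
  qed
  have near_l: "AE x in lebesgue. \<bar>u_l x t - ubar_l\<bar> \<le> El * p_l / t" if "0 < t" for t
    using P.slice_near_mean[OF that] P.vu[OF that] by eventually_elim simp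
  have near_r: "AE x in lebesgue. \<bar>u_r x t - ubar_r\<bar> \<le> Er * p_r / t" if "0 < t" for t
    using Q.slice_near_mean[OF that] Q.vu[OF that] by eventually_elim simp
  have glue_l: "AE x in lebesgue. x < X t \<longrightarrow> u x t = u_l x t" if t: "T < t" for t
  proof -
    have t0: "0 < t" using t T by simp
    have "AE x in lebesgue. x < X t \<longrightarrow> v x t = vl x t"
    proof (rule AE_eq_below[OF U.v[OF t0] P.v[OF t0]])
      show "integral {x..y} (\<lambda>x. v x t) = integral {x..y} (\<lambda>x. vl x t)" if "x \<le> y" "y \<le> X t" for x y
        using U.U_diff[OF t0 that(1)] P.U_diff[OF t0 that(1)] Ul[OF t that(2)] Ul[OF t order_trans[OF that]] by simp
    qed
    with U.vu[OF t0] P.vu[OF t0] show ?thesis by eventually_elim auto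
  qed
  have glue_r: "AE x in lebesgue. X t < x \<longrightarrow> u x t = u_r x t" if t: "T < t" for t
  proof -
    have t0: "0 < t" using t T by simp
    have "AE x in lebesgue. X t < x \<longrightarrow> v x t = vr x t"
    proof (rule AE_eq_above[OF U.v[OF t0] Q.v[OF t0]])
      show "integral {x..y} (\<lambda>x. v x t) = integral {x..y} (\<lambda>x. vr x t)" if "x \<le> y" "X t \<le> x" for x y
        using U.U_diff[OF t0 that(1)] Q.U_diff[OF t0 that(1)] Ur[OF t that(2)] Ur[OF t order_trans[OF that(2,1)]] by simp
    qed
    with U.vu[OF t0] Q.vu[OF t0] show ?thesis by eventually_elim auto
  qed
  have glues: "glues_along T X u u_l u_r"
    unfolding glues_along_def
  proof (intro conjI allI impI Xlip)
    show "AE x in lebesgue. (x < X t \<longrightarrow> u x t = u_l x t) \<and> (X t < x \<longrightarrow> u x t = u_r x t)" if "T < t" for t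
      using glue_l[OF that] glue_r[OF that] by eventually_elim auto
  qed
  \<comment> \<open>After time \<open>T\<close> the two periodic solutions are closer to their means
    than allows them to meet.\<close>
  have differ: "AE x in lebesgue. u_l x t \<noteq> u_r x t" if t: "T < t" for t
  proof -
    have t0: "0 < t" using t T by simp
    show ?thesis using near_l[OF t0] near_r[OF t0]
    proof eventually_elim
      case (elim x)
      then show ?case using sep[OF t] by (auto simp: abs_le_iff)
    qed
  qed
  \<comment> \<open>Between two different candidates for the shock position \<open>u\<close> would
    equal both periodic solutions on an interval of positive length.\<close>
  have unique: "Y t = X t" if Y: "glues_along T Y u u_l u_r" and t: "T < t" for Y t
  proof (rule ccontr)
    assume "Y t \<noteq> X t"
    have "AE x in lebesgue. (x < Y t \<longrightarrow> u x t = u_l x t) \<and> (Y t < x \<longrightarrow> u x t = u_r x t)"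
      using Y t unfolding glues_along_def by blast
    with glue_l[OF t] glue_r[OF t] differ[OF t]
    have "AE x in lebesgue. \<not> (Y t < x \<and> x < X t) \<and> \<not> (X t < x \<and> x < Y t)"
      by eventually_elim auto
    then have "AE x in lebesgue. \<not> (Y t < x \<and> x < X t)" "AE x in lebesgue. \<not> (X t < x \<and> x < Y t)"
      by (auto elim: eventually_mono)
    then show False
      using interval_not_AE_excluded[of "Y t" "X t"] interval_not_AE_excluded[of "X t" "Y t"] \<open>Y t \<noteq> X t\<close>
      by (cases "Y t < X t") auto
  qed
  define D where "D = El * p_l + Er * p_r + C"
  have D: "0 < D" using P.E P.p Q.E Q.p C by (simp add: D_def add_pos_pos add_pos_nonneg)
  have rate: "esssup (lebesgue_on {..<X t}) (\<lambda>x. ereal \<bar>u x t - ubar_l\<bar>)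
      + esssup (lebesgue_on {X t<..}) (\<lambda>x. ereal \<bar>u x t - ubar_r\<bar>)
      + ereal \<bar>X t - s * t - X_inf\<bar> \<le> ereal (D / t)" if t: "T < t" for t
  proof -
    have t0: "0 < t" using t T by simp
    have ut: "Linfty_on UNIV (\<lambda>x. u x t)"
      using \<open>entropy_solution f u0 u\<close> t0 unfolding entropy_solution_def by blast
    have "esssup (lebesgue_on {..<X t}) (\<lambda>x. ereal \<bar>u x t - ubar_l\<bar>) \<le> ereal (El * p_l / t)"
    proof (rule esssup_le_AE[OF ut])
      show "AE x in lebesgue. x \<in> {..<X t} \<longrightarrow> \<bar>u x t - ubar_l\<bar> \<le> El * p_l / t"
        using glue_l[OF t] near_l[OF t0] by eventually_elim auto
    qed simp
    moreover have "esssup (lebesgue_on {X t<..}) (\<lambda>x. ereal \<bar>u x t - ubar_r\<bar>) \<le> ereal (Er * p_r / t)"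
    proof (rule esssup_le_AE[OF ut])
      show "AE x in lebesgue. x \<in> {X t<..} \<longrightarrow> \<bar>u x t - ubar_r\<bar> \<le> Er * p_r / t"
        using glue_r[OF t] near_r[OF t0] by eventually_elim auto
    qed simp
    moreover have "ereal \<bar>X t - s * t - X_inf\<bar> \<le> ereal (C / t)"
      using Xasym[OF t] by (simp add: shift assms(21))
    ultimately have "esssup (lebesgue_on {..<X t}) (\<lambda>x. ereal \<bar>u x t - ubar_l\<bar>)
      + esssup (lebesgue_on {X t<..}) (\<lambda>x. ereal \<bar>u x t - ubar_r\<bar>)
      + ereal \<bar>X t - s * t - X_inf\<bar> \<le> ereal (El * p_l / t) + ereal (Er * p_r / t) + ereal (C / t)"
      by (intro add_mono)
    also have "\<dots> = ereal (D / t)" by (simp add: D_def add_divide_distrib)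
    finally show ?thesis .
  qed
  show ?thesis using T glues unique D rate by blast
qed

end
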